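(* The unique seven dimensional nilpotent Lie group admitting an integrable left invariant quaternionic contact structure is the (seven dimensional) quaternionic Heisenberg group.
   Context: Notation: $e^{ij}=e^i\wedge e^j$; $d$ is the Chevalley–Eilenberg differential on $\Lambda\mathfrak{g}^*$, where $\mathfrak{g}$ is the Lie algebra of the Lie group $G$ under consideration. A $7$-dimensional Lie group $G$ with Lie algebra $\mathfrak{g}$ has an integrable left invariant quaternionic contact (qc) structure if there is a basis $e^1,\dots,e^7$ of $\mathfrak{g}^*$ (left invariant $1$-forms) and $f_1,f_2,f_3\in\mathrm{Span}\{e^1,e^2,e^3,e^4\}$ such that $$\begin{aligned} de^5&=e^{12}+e^{34}+f_2\wedge e^7-f_3\wedge e^6,\\ de^6&=e^{13}+e^{42}+f_3\wedge e^5-f_1\wedge e^7,\\ de^7&=e^{14}+e^{23}+f_1\wedge e^6-f_2\wedge e^5, \end{aligned}$$ each equality holding modulo $\mathrm{Span}\{e^{56},e^{57},e^{67}\}$. The seven dimensional quaternionic Heisenberg group is $G(\mathbb{H})=\mathbb{H}\times\mathrm{Im}(\mathbb{H})$ with its standard group structure; its Lie algebra has a dual basis $e^1,\dots,e^7$ with $$de^1=de^2=de^3=de^4=0,\quad de^5=e^{12}+e^{34},\quad de^6=e^{13}+e^{42},\quad de^7=e^{14}+e^{23}.$$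
   Formalization: Nilpotent Lie groups are taken to be connected, and uniqueness means: G is covered by the quaternionic Heisenberg group, and is isomorphic to it if G is simply connected. Quotients of that group by discrete central subgroups show that literal uniqueness fails. *)

theory Defs
  imports "HOL-Analysis.Analysis" "HOL-Algebra.Group"
begin

unbundle no cross3_syntax
unbundle set_product_syntax

section \<open>Smooth maps and Lie groups\<close>

text \<open>The predicates below are only used on open sets. There \<open>ck_on (Suc k)\<close> asks for
  differentiability with all directional derivatives of class \<open>C^k\<close>.\<close>

primrec ck_on :: "nat \<Rightarrow> ('a::euclidean_space \<Rightarrow> 'b::euclidean_space) \<Rightarrow> 'a set \<Rightarrow> bool" where
  "ck_on 0 f S \<longleftrightarrow> continuous_on S f"
| "ck_on (Suc k) f S \<longleftrightarrow>
     (\<forall>x\<in>S. f differentiable (at x)) \<and> (\<forall>v. ck_on k (\<lambda>x. frechet_derivative f (at x) v) S)"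

definition smooth_on :: "('a::euclidean_space \<Rightarrow> 'b::euclidean_space) \<Rightarrow> 'a set \<Rightarrow> bool" where
  "smooth_on f S \<longleftrightarrow> (\<forall>k. ck_on k f S)"

type_synonym ('g, 'e) chart = "'g set \<times> ('g \<Rightarrow> 'e)"

definition smooth_atlas :: "('g::topological_space, 'e::euclidean_space) chart set \<Rightarrow> bool" where
  "smooth_atlas A \<longleftrightarrow>
     (\<Union>(U, \<phi>)\<in>A. U) = UNIV \<and>
     (\<forall>(U, \<phi>)\<in>A. open U \<and> open (\<phi> ` U) \<and> homeomorphism U (\<phi> ` U) \<phi> (inv_into U \<phi>)) \<and>
     (\<forall>(U, \<phi>)\<in>A. \<forall>(V, \<psi>)\<in>A. smooth_on (\<psi> \<circ> inv_into U \<phi>) (\<phi> ` (U \<inter> V)))"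

definition smooth_map ::
    "('g::topological_space, 'e::euclidean_space) chart set \<Rightarrow>
     ('h::topological_space, 'f::euclidean_space) chart set \<Rightarrow> ('g \<Rightarrow> 'h) \<Rightarrow> bool" where
  "smooth_map A B f \<longleftrightarrow>
     continuous_on UNIV f \<and>
     (\<forall>(U, \<phi>)\<in>A. \<forall>(V, \<psi>)\<in>B. smooth_on (\<psi> \<circ> f \<circ> inv_into U \<phi>) (\<phi> ` (U \<inter> f -` V)))"

definition prod_atlas ::
    "('g, 'e) chart set \<Rightarrow> ('h, 'f) chart set \<Rightarrow> ('g \<times> 'h, 'e \<times> 'f) chart set" where
  "prod_atlas A B = {(U \<times> V, map_prod \<phi> \<psi>) |U \<phi> V \<psi>. (U, \<phi>) \<in> A \<and> (V, \<psi>) \<in> B}"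

text \<open>The underlying manifold is a whole Hausdorff, second countable type \<open>'g\<close>, modelled on the
  Euclidean space \<open>'e\<close>; its dimension is \<open>DIM('e)\<close>. The atlas need not be maximal.\<close>

locale lie_group = group G
  for G :: "'g::{t2_space, second_countable_topology} monoid" (structure)
    and A :: "('g, 'e::euclidean_space) chart set" +
  assumes carrier_UNIV: "carrier G = UNIV"
    and atlas: "smooth_atlas A"
    and smooth_mult: "smooth_map (prod_atlas A A) A (\<lambda>(x, y). x \<otimes> y)"
    and smooth_inv: "smooth_map A A (m_inv G)"

definition lie_group_isomorphic ::
    "'g::topological_space monoid \<Rightarrow> ('g, 'e::euclidean_space) chart set \<Rightarrow>
     'h::topological_space monoid \<Rightarrow> ('h, 'f::euclidean_space) chart set \<Rightarrow> bool" where
  "lie_group_isomorphic G A H B \<longleftrightarrow>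
     (\<exists>f\<in>iso G H. smooth_map A B f \<and> smooth_map B A (inv_into UNIV f))"

text \<open>A covering homomorphism of Lie groups from \<open>G\<close> onto \<open>H\<close>.\<close>

definition lie_covering_hom ::
    "'g::topological_space monoid \<Rightarrow> ('g, 'e::euclidean_space) chart set \<Rightarrow>
     'h::topological_space monoid \<Rightarrow> ('h, 'f::euclidean_space) chart set \<Rightarrow> ('g \<Rightarrow> 'h) \<Rightarrow> bool" where
  "lie_covering_hom G A H B p \<longleftrightarrow>
     p \<in> hom G H \<and> smooth_map A B p \<and> covering_space UNIV p UNIV"


section \<open>The Lie algebra of a Lie group\<close>

text \<open>A chart around the identity identifies the tangent space at the identity with the model
  space \<open>'e\<close>. In the coordinates of this chart, \<open>left_inv_field G A v\<close> is the left invariant vector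
  field with value \<open>v\<close> at the identity: its value at the point with coordinates \<open>x\<close> is the image of
  \<open>v\<close> under the differential of left translation by that point. The bracket of two tangent vectors
  is the value at the identity of the commutator \<open>[X, Y] = DY X - DX Y\<close> of the corresponding
  left invariant fields.\<close>

definition one_chart :: "'g monoid \<Rightarrow> ('g, 'e) chart set \<Rightarrow> ('g, 'e) chart" where
  "one_chart G A = (SOME c. c \<in> A \<and> \<one>\<^bsub>G\<^esub> \<in> fst c)"

definition left_inv_field ::
    "'g monoid \<Rightarrow> ('g, 'e::euclidean_space) chart set \<Rightarrow> 'e \<Rightarrow> 'e \<Rightarrow> 'e" where
  "left_inv_field G A v x =
     (let (U, \<phi>) = one_chart G A
      in frechet_derivative (\<lambda>y. \<phi> (inv_into U \<phi> x \<otimes>\<^bsub>G\<^esub> inv_into U \<phi> y)) (at (\<phi> \<one>\<^bsub>G\<^esub>)) v)"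

definition lie_bracket ::
    "'g monoid \<Rightarrow> ('g, 'e::euclidean_space) chart set \<Rightarrow> 'e \<Rightarrow> 'e \<Rightarrow> 'e" where
  "lie_bracket G A u v =
     (let p = snd (one_chart G A) \<one>\<^bsub>G\<^esub>
      in frechet_derivative (left_inv_field G A v) (at p) u
         - frechet_derivative (left_inv_field G A u) (at p) v)"

primrec lower_central :: "('e::real_vector \<Rightarrow> 'e \<Rightarrow> 'e) \<Rightarrow> nat \<Rightarrow> 'e set" where
  "lower_central br 0 = UNIV"
| "lower_central br (Suc k) = span {br x y |x y. y \<in> lower_central br k}"

definition nilpotent_bracket :: "('e::real_vector \<Rightarrow> 'e \<Rightarrow> 'e) \<Rightarrow> bool" where
  "nilpotent_bracket br \<longleftrightarrow> (\<exists>k. lower_central br k = {0})"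

text \<open>A nilpotent Lie group is a connected Lie group with nilpotent Lie algebra.\<close>

definition nilpotent_lie_group ::
    "'g::{t2_space, second_countable_topology} monoid \<Rightarrow>
     ('g, 'e::euclidean_space) chart set \<Rightarrow> bool" where
  "nilpotent_lie_group G A \<longleftrightarrow>
     lie_group G A \<and> connected (UNIV :: 'g set) \<and> nilpotent_bracket (lie_bracket G A)"


section \<open>Integrable left invariant quaternionic contact structures\<close>

type_synonym 'e two_form = "'e \<Rightarrow> 'e \<Rightarrow> real"

definition wedge :: "('e::real_normed_vector \<Rightarrow>\<^sub>L real) \<Rightarrow> ('e \<Rightarrow>\<^sub>L real) \<Rightarrow> 'e two_form" where
  "wedge a b = (\<lambda>X Y. blinfun_apply a X * blinfun_apply b Y - blinfun_apply a Y * blinfun_apply b X)"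

text \<open>The Chevalley--Eilenberg differential of a left invariant 1-form.\<close>

definition ce_d :: "('e::real_normed_vector \<Rightarrow> 'e \<Rightarrow> 'e) \<Rightarrow> ('e \<Rightarrow>\<^sub>L real) \<Rightarrow> 'e two_form" where
  "ce_d br a = (\<lambda>X Y. - blinfun_apply a (br X Y))"

definition eq_mod_span3 ::
    "'e two_form \<Rightarrow> 'e two_form \<Rightarrow> 'e two_form \<Rightarrow> 'e two_form \<Rightarrow> 'e two_form \<Rightarrow> bool" where
  "eq_mod_span3 \<alpha> \<beta> \<gamma> \<omega> \<eta> \<longleftrightarrow>
     (\<exists>a b c. \<forall>X Y. \<omega> X Y - \<eta> X Y = a * \<alpha> X Y + b * \<beta> X Y + c * \<gamma> X Y)"

text \<open>The dual of the Lie algebra is the type \<open>'e \<Rightarrow>\<^sub>L real\<close>: on a finite dimensional space every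
  linear functional is bounded. The forms are indexed by \<open>1, \<dots>, 7\<close>.\<close>

definition integrable_qc_basis ::
    "('e::euclidean_space \<Rightarrow> 'e \<Rightarrow> 'e) \<Rightarrow> (nat \<Rightarrow> 'e \<Rightarrow>\<^sub>L real) \<Rightarrow> (nat \<Rightarrow> 'e \<Rightarrow>\<^sub>L real) \<Rightarrow> bool" where
  "integrable_qc_basis br e f \<longleftrightarrow>
     inj_on e {1..7} \<and> independent (e ` {1..7}) \<and> span (e ` {1..7}) = UNIV \<and>
     f 1 \<in> span (e ` {1..4}) \<and> f 2 \<in> span (e ` {1..4}) \<and> f 3 \<in> span (e ` {1..4}) \<and>
     (let w = (\<lambda>i j. wedge (e i) (e j));
          eqm = eq_mod_span3 (w 5 6) (w 5 7) (w 6 7)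
      in eqm (ce_d br (e 5))
           (\<lambda>X Y. w 1 2 X Y + w 3 4 X Y + wedge (f 2) (e 7) X Y - wedge (f 3) (e 6) X Y) \<and>
         eqm (ce_d br (e 6))
           (\<lambda>X Y. w 1 3 X Y + w 4 2 X Y + wedge (f 3) (e 5) X Y - wedge (f 1) (e 7) X Y) \<and>
         eqm (ce_d br (e 7))
           (\<lambda>X Y. w 1 4 X Y + w 2 3 X Y + wedge (f 1) (e 6) X Y - wedge (f 2) (e 5) X Y))"

definition admits_integrable_left_inv_qc ::
    "'g monoid \<Rightarrow> ('g, 'e::euclidean_space) chart set \<Rightarrow> bool" where
  "admits_integrable_left_inv_qc G A \<longleftrightarrow> (\<exists>e f. integrable_qc_basis (lie_bracket G A) e f)"


section \<open>The quaternionic Heisenberg group\<close>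

text \<open>A quaternion is a pair of a real part and an imaginary part; \<open>Im(H)\<close> is \<open>real^3\<close> with its
  standard basis in the role of \<open>i, j, k\<close>.\<close>

type_synonym quat = "real \<times> (real^3)"

definition quat_mult :: "quat \<Rightarrow> quat \<Rightarrow> quat" where
  "quat_mult p q = (fst p * fst q - snd p \<bullet> snd q,
                    fst p *\<^sub>R snd q + fst q *\<^sub>R snd p + cross3 (snd p) (snd q))"

definition quat_cnj :: "quat \<Rightarrow> quat" where
  "quat_cnj q = (fst q, - snd q)"

definition quat_heisenberg :: "(quat \<times> (real^3)) monoid" where
  "quat_heisenberg =
     \<lparr>carrier = UNIV,
      mult = (\<lambda>(p, u) (q, w). (p + q, u + w + 2 *\<^sub>R snd (quat_mult p (quat_cnj q)))),
      one = 0\<rparr>"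

definition std_atlas :: "('e, 'e) chart set" where
  "std_atlas = {(UNIV, id)}"

end

theory Submission
  imports Defs
begin

text \<open>
  The proof has an algebraic and a Lie theoretic half.

  \<^emph>\<open>Algebra.\<close> Let a nilpotent Lie algebra have a basis as in the definition of an integrable
  quaternionic contact structure. Paired with the vertical component of a central element, the
  structure equations lose their terms with \<open>f1, f2, f3\<close>, and because every nonzero
  combination of the three fundamental two-forms is nondegenerate, the element must be vertical.
  Repeating this argument for an element that is central modulo the first one shows that the forms
  \<open>f1, f2, f3\<close> are zero (\<open>f_zero\<close>),
  and further repetitions show that the vertical space is central (\<open>ver_central\<close>). The quotient by it is
  a four-dimensional nilpotent Lie algebra on which the three forms, a hyperkaehler triple, are closed;
  such an algebra is abelian (\<open>H_br\<close>). What remains is the bracket of the quaternionic Heisenberg algebra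
  (\<open>qc_iso_heis\<close>). The condition \<open>d \<circ> d = 0\<close> enters as the Jacobi identity, which is derived from
  the group law (\<open>br_jacobi\<close>).

  \<^emph>\<open>Lie theory.\<close> The algebra is two-step nilpotent, so its simply connected group is the vector
  space with the product \<open>x + y + [x, y] / 2\<close>. Near the identity of \<open>G\<close> the Maurer-Cartan form can be
  integrated by applying the Poincare lemma twice (\<open>developing_map\<close>). This yields a local
  isomorphism with that vector space group (\<open>local_chart\<close>). It extends to a global homomorphism
  \<open>x \<mapsto> P (x / N) ^ N\<close> for large \<open>N\<close>; that this is multiplicative is a computation
  with powers in a group with central commutators (\<open>p_bch\<close>). The extension is onto because \<open>G\<close> is
  connected, and it is a covering because it is a local homeomorphism and a homomorphism
  (\<open>covering_p\<close>). If \<open>G\<close> is simply connected, a discrete development along a contracted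
  loop shows that the kernel is trivial (\<open>simply_connected_imp_inj\<close>), so that the covering is an isomorphism.
\<close>

section \<open>Calculus of smooth maps\<close>

lemma ck_on_subset: "ck_on k f S \<Longrightarrow> T \<subseteq> S \<Longrightarrow> ck_on k f T"
  by (induction k arbitrary: f) (auto intro: continuous_on_subset)

lemma frechet_derivative_cong_open:
  assumes "open S" "x \<in> S" "\<And>y. y \<in> S \<Longrightarrow> f y = g y"
  shows "frechet_derivative f (at x) = frechet_derivative g (at x)"
proof -
  have "(f has_derivative D) (at x) \<longleftrightarrow> (g has_derivative D) (at x)" for D
    using has_derivative_transform_within_open[OF _ assms(1,2)] assms(3) by metis
  thus ?thesis unfolding frechet_derivative_def by simp
qed

lemma differentiable_cong_open:
  assumes "open S" "x \<in> S" "\<And>y. y \<in> S \<Longrightarrow> f y = g y" "f differentiable at x"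
  shows "g differentiable at x"
  using assms has_derivative_transform_within_open unfolding differentiable_def by metis

lemma ck_on_cong:
  assumes "open S" "\<And>y. y \<in> S \<Longrightarrow> f y = g y" "ck_on k f S"
  shows "ck_on k g S"
  using assms(2,3)
proof (induction k arbitrary: f g)
  case 0
  then show ?case by (auto intro: continuous_on_eq)
next
  case (Suc k)
  have "ck_on k (\<lambda>x. frechet_derivative g (at x) v) S" for v
    by (rule Suc.IH[of "\<lambda>x. frechet_derivative f (at x) v"])
       (use Suc.prems frechet_derivative_cong_open[OF assms(1), of _ f g] in auto)
  moreover have "\<forall>x\<in>S. g differentiable at x"
    using Suc.prems differentiable_cong_open[OF assms(1), of _ f g] by auto
  ultimately show ?case by simp
qed

lemma ck_on_SucI:
  assumes "open S" "\<And>x. x \<in> S \<Longrightarrow> (f has_derivative f' x) (at x)"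
    "\<And>v. ck_on k (\<lambda>x. f' x v) S"
  shows "ck_on (Suc k) f S"
proof -
  have "ck_on k (\<lambda>x. frechet_derivative f (at x) v) S" for v
    by (rule ck_on_cong[OF assms(1) _ assms(3)[of v]])
       (use frechet_derivative_at[OF assms(2)] in auto)
  thus ?thesis using assms(2) by (auto simp: differentiable_def)
qed

lemma ck_on_SucD: "ck_on (Suc k) f S \<Longrightarrow> ck_on k f S"
proof (induction k arbitrary: f)
  case 0
  then show ?case
    by (auto intro!: continuous_at_imp_continuous_on differentiable_imp_continuous_within)
qed auto

lemma ck_on_has_derivative:
  "ck_on (Suc k) f S \<Longrightarrow> x \<in> S \<Longrightarrow> (f has_derivative frechet_derivative f (at x)) (at x)"
  by (simp add: frechet_derivative_works)

lemma ck_on_const: "ck_on k (\<lambda>x. c) S"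
  by (induction k arbitrary: c) auto

lemma ck_on_linear:
  assumes "bounded_linear h" "open S" shows "ck_on k h S"
proof (cases k)
  case 0
  then show ?thesis using assms by (simp add: linear_continuous_on)
next
  case (Suc j)
  show ?thesis unfolding Suc
    by (rule ck_on_SucI[where f' = "\<lambda>x. h"])
       (auto intro: bounded_linear_imp_has_derivative assms ck_on_const)
qed

lemma ck_on_add:
  assumes "open S" "ck_on k f S" "ck_on k g S" shows "ck_on k (\<lambda>x. f x + g x) S"
  using assms(2,3)
proof (induction k arbitrary: f g)
  case 0
  then show ?case by (auto intro: continuous_intros)
next
  case (Suc k)
  show ?case
    by (rule ck_on_SucI[OF assms(1) has_derivative_add[OF ck_on_has_derivative ck_on_has_derivative]])
       (use Suc in auto)
qed

lemma ck_on_linear_compose: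
  assumes "bounded_linear h" "open S" "ck_on k f S" shows "ck_on k (\<lambda>x. h (f x)) S"
  using assms(3)
proof (induction k arbitrary: f)
  case 0
  then show ?case using assms(1) by (auto intro: bounded_linear.continuous_on)
next
  case (Suc k)
  show ?case
    by (rule ck_on_SucI[OF assms(2) bounded_linear.has_derivative[OF assms(1) ck_on_has_derivative]])
       (use Suc in auto)
qed

lemma ck_on_bilinear:
  assumes "bounded_bilinear b" "open S" "ck_on k f S" "ck_on k g S"
  shows "ck_on k (\<lambda>x. b (f x) (g x)) S"
  using assms(3,4)
proof (induction k arbitrary: f g)
  case 0
  then show ?case using bounded_bilinear.continuous_on[OF assms(1)] by auto
next
  case (Suc k)
  have "ck_on k f S" "ck_on k g S" using Suc.prems ck_on_SucD by blast+
  then show ?case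
    by (intro ck_on_SucI[OF assms(2) bounded_bilinear.FDERIV[OF assms(1) ck_on_has_derivative ck_on_has_derivative]]
              ck_on_add assms(2) Suc.IH)
       (use Suc.prems in auto)
qed

lemma ck_on_sum:
  assumes "open S" "finite I" "\<And>i. i \<in> I \<Longrightarrow> ck_on k (f i) S"
  shows "ck_on k (\<lambda>x. \<Sum>i\<in>I. f i x) S"
  using assms(2,3)
  by (induction I rule: finite_induct) (auto intro: ck_on_const ck_on_add[OF assms(1)])

lemma linear_basis_expansion:
  fixes L :: "'a::euclidean_space \<Rightarrow> 'b::real_normed_vector"
  assumes "linear L" shows "L v = (\<Sum>b\<in>Basis. (v \<bullet> b) *\<^sub>R L b)"
proof -
  have "L v = L (\<Sum>b\<in>Basis. (v \<bullet> b) *\<^sub>R b)" by (simp only: euclidean_representation)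
  also have "\<dots> = (\<Sum>b\<in>Basis. (v \<bullet> b) *\<^sub>R L b)"
    by (simp only: linear_sum[OF assms] linear_scale[OF assms])
  finally show ?thesis .
qed

lemma ck_on_compose:
  fixes g :: "'a::euclidean_space \<Rightarrow> 'b::euclidean_space"
  assumes "open S" "open T" "g ` S \<subseteq> T" "ck_on k f T" "ck_on k g S"
  shows "ck_on k (\<lambda>x. f (g x)) S"
  using assms(4,5)
proof (induction k arbitrary: f)
  case 0
  then show ?case using assms(3) by (auto intro: continuous_on_compose2)
next
  case (Suc k)
  let ?D = "\<lambda>x. frechet_derivative f (at (g x))"
  let ?E = "\<lambda>x. frechet_derivative g (at x)"
  have gT: "x \<in> S \<Longrightarrow> g x \<in> T" for x using assms(3) by auto
  have "((\<lambda>x. f (g x)) has_derivative (\<lambda>v. ?D x (?E x v))) (at x)" if "x \<in> S" for x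
    using has_derivative_compose[OF ck_on_has_derivative[OF Suc.prems(2) that]
        ck_on_has_derivative[OF Suc.prems(1) gT[OF that]]] .
  moreover have "ck_on k (\<lambda>x. ?D x (?E x v)) S" for v
  proof (rule ck_on_cong[OF assms(1)])
    show "(\<Sum>b\<in>Basis. (?E x v \<bullet> b) *\<^sub>R ?D x b) = ?D x (?E x v)" if "x \<in> S" for x
      by (rule linear_basis_expansion[symmetric])
         (use Suc.prems gT[OF that] in \<open>auto intro: linear_frechet_derivative\<close>)
    show "ck_on k (\<lambda>x. \<Sum>b\<in>Basis. (?E x v \<bullet> b) *\<^sub>R ?D x b) S"
      using Suc.prems ck_on_SucD[OF Suc.prems(2)]
      by (intro ck_on_sum assms(1) ck_on_bilinear[OF bounded_bilinear_scaleR]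
           ck_on_linear_compose[OF bounded_linear_inner_left] Suc.IH) auto
  qed
  ultimately show ?case by (rule ck_on_SucI[OF assms(1)])
qed

lemma ck_on_local:
  assumes "\<And>x. x \<in> S \<Longrightarrow> \<exists>T. open T \<and> x \<in> T \<and> ck_on k f T"
  shows "ck_on k f S"
  using assms
proof (induction k arbitrary: f)
  case 0
  have "continuous (at x) f" if x: "x \<in> S" for x
  proof -
    obtain T where "open T" "x \<in> T" "continuous_on T f" using 0[OF x] by auto
    thus ?thesis using continuous_on_eq_continuous_at by blast
  qed
  thus ?case by (simp add: continuous_at_imp_continuous_on)
next
  case (Suc k)
  have "f differentiable at x" if "x \<in> S" for x
    using Suc.prems[OF that] ck_on.simps(2) by blast
  moreover have "ck_on k (\<lambda>x. frechet_derivative f (at x) v) S" for v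
  proof (rule Suc.IH)
    fix x assume "x \<in> S"
    then obtain T where "open T" "x \<in> T" "ck_on (Suc k) f T" using Suc.prems by blast
    thus "\<exists>T. open T \<and> x \<in> T \<and> ck_on k (\<lambda>x. frechet_derivative f (at x) v) T" by auto
  qed
  ultimately show ?case by simp
qed

lemma smooth_onD: "smooth_on f S \<Longrightarrow> ck_on k f S"
  by (simp add: smooth_on_def)

lemma smooth_on_continuous: "smooth_on f S \<Longrightarrow> continuous_on S f"
  using smooth_onD[of f S 0] by simp

lemma smooth_on_has_derivative:
  "smooth_on f S \<Longrightarrow> x \<in> S \<Longrightarrow> (f has_derivative frechet_derivative f (at x)) (at x)"
  using ck_on_has_derivative smooth_onD by blast

lemma smooth_on_deriv: "smooth_on f S \<Longrightarrow> smooth_on (\<lambda>x. frechet_derivative f (at x) v) S"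
  unfolding smooth_on_def
proof
  fix k assume "\<forall>k. ck_on k f S"
  hence "ck_on (Suc k) f S" by blast
  thus "ck_on k (\<lambda>x. frechet_derivative f (at x) v) S" by simp
qed

lemma smooth_on_subset: "smooth_on f S \<Longrightarrow> T \<subseteq> S \<Longrightarrow> smooth_on f T"
  unfolding smooth_on_def using ck_on_subset by blast

lemma smooth_on_cong:
  "open S \<Longrightarrow> (\<And>y. y \<in> S \<Longrightarrow> f y = g y) \<Longrightarrow> smooth_on f S \<Longrightarrow> smooth_on g S"
  unfolding smooth_on_def using ck_on_cong[of S f g] by blast

lemma smooth_on_const: "smooth_on (\<lambda>x. c) S"
  unfolding smooth_on_def using ck_on_const by blast

lemma smooth_on_linear: "bounded_linear h \<Longrightarrow> open S \<Longrightarrow> smooth_on h S"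
  unfolding smooth_on_def using ck_on_linear by blast

lemma smooth_on_add:
  "open S \<Longrightarrow> smooth_on f S \<Longrightarrow> smooth_on g S \<Longrightarrow> smooth_on (\<lambda>x. f x + g x) S"
  unfolding smooth_on_def using ck_on_add by blast

lemma smooth_on_linear_compose:
  "bounded_linear h \<Longrightarrow> open S \<Longrightarrow> smooth_on f S \<Longrightarrow> smooth_on (\<lambda>x. h (f x)) S"
  unfolding smooth_on_def using ck_on_linear_compose by blast

lemma smooth_on_bilinear:
  "bounded_bilinear b \<Longrightarrow> open S \<Longrightarrow> smooth_on f S \<Longrightarrow> smooth_on g S \<Longrightarrow> smooth_on (\<lambda>x. b (f x) (g x)) S"
  unfolding smooth_on_def using ck_on_bilinear by blast

lemma smooth_on_sum:
  "open S \<Longrightarrow> finite I \<Longrightarrow> (\<And>i. i \<in> I \<Longrightarrow> smooth_on (f i) S) \<Longrightarrow> smooth_on (\<lambda>x. \<Sum>i\<in>I. f i x) S"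
  unfolding smooth_on_def using ck_on_sum by blast

lemma smooth_on_compose:
  fixes g :: "'a::euclidean_space \<Rightarrow> 'b::euclidean_space"
  shows "open S \<Longrightarrow> open T \<Longrightarrow> g ` S \<subseteq> T \<Longrightarrow> smooth_on f T \<Longrightarrow> smooth_on g S \<Longrightarrow>
    smooth_on (\<lambda>x. f (g x)) S"
  unfolding smooth_on_def using ck_on_compose by blast

lemma smooth_on_local:
  "(\<And>x. x \<in> S \<Longrightarrow> \<exists>T. open T \<and> x \<in> T \<and> smooth_on f T) \<Longrightarrow> smooth_on f S"
  unfolding smooth_on_def by (intro allI ck_on_local) metis

lemma smooth_on_Pair:
  fixes f :: "'a::euclidean_space \<Rightarrow> 'b::euclidean_space" and g :: "'a \<Rightarrow> 'c::euclidean_space"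
  assumes "open S" "smooth_on f S" "smooth_on g S" shows "smooth_on (\<lambda>x. (f x, g x)) S"
proof -
  have "bounded_linear (\<lambda>a::'b. (a, 0::'c))" "bounded_linear (\<lambda>a::'c. (0::'b, a))"
    by (auto intro!: bounded_linear_Pair bounded_linear_ident bounded_linear_zero)
  from smooth_on_add[OF assms(1) smooth_on_linear_compose[OF this(1) assms(1,2)]
      smooth_on_linear_compose[OF this(2) assms(1,3)]]
  show ?thesis by simp
qed

lemma smooth_on_deriv_apply:
  fixes g :: "'a::euclidean_space \<Rightarrow> 'b::euclidean_space"
  assumes "open S" "open T" "g ` S \<subseteq> T" "smooth_on f T" "smooth_on g S" "smooth_on w S"
  shows "smooth_on (\<lambda>x. frechet_derivative f (at (g x)) (w x)) S"
proof (rule smooth_on_cong[OF assms(1)])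
  show "(\<Sum>b\<in>Basis. (w x \<bullet> b) *\<^sub>R frechet_derivative f (at (g x)) b)
      = frechet_derivative f (at (g x)) (w x)" if "x \<in> S" for x
    by (rule linear_basis_expansion[symmetric])
       (use assms(3,4) that in \<open>auto intro!: has_derivative_linear smooth_on_has_derivative\<close>)
  show "smooth_on (\<lambda>x. \<Sum>b\<in>Basis. (w x \<bullet> b) *\<^sub>R frechet_derivative f (at (g x)) b) S"
    by (intro smooth_on_sum assms(1) smooth_on_bilinear[OF bounded_bilinear_scaleR]
         smooth_on_linear_compose[OF bounded_linear_inner_left] assms(6) finite_Basis
         smooth_on_compose[OF assms(1,2,3) smooth_on_deriv[OF assms(4)] assms(5)])
qed

text \<open>Solutions of a first order equation \<open>Df = \<Phi>(x, f)\<close> with smooth right-hand side are smooth: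
  one more derivative is gained in each step of the induction. All smoothness of maps that are
  constructed here by integration or by inversion comes from this lemma.\<close>
lemma smooth_on_bootstrap:
  assumes "open S" "\<And>x. x \<in> S \<Longrightarrow> (f has_derivative f' x) (at x)"
    "\<And>k v. ck_on k f S \<Longrightarrow> ck_on k (\<lambda>x. f' x v) S"
  shows "smooth_on f S"
proof -
  have "ck_on k f S" for k
  proof (induction k)
    case 0
    show ?case using has_derivative_continuous[OF assms(2)]
      by (simp add: continuous_at_imp_continuous_on)
  next
    case (Suc k)
    show ?case by (rule ck_on_SucI[OF assms(1,2) assms(3)[OF Suc]])
  qed
  thus ?thesis by (simp add: smooth_on_def)
qed

section \<open>Symmetry of second derivatives and the Poincare lemma\<close>

text \<open>The mean value theorem, once in each direction. The left-hand side is symmetric in \<open>u\<close> and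
  \<open>v\<close>, which is why mixed derivatives commute.\<close>
lemma second_difference_eq_mixed_derivative:
  fixes f :: "'a::euclidean_space \<Rightarrow> real"
  assumes "r > 0" and f: "ck_on (Suc (Suc 0)) f S"
    and S: "\<And>s t. 0 \<le> s \<Longrightarrow> s \<le> r \<Longrightarrow> 0 \<le> t \<Longrightarrow> t \<le> r \<Longrightarrow> x + s *\<^sub>R u + t *\<^sub>R v \<in> S"
  obtains s t where "0 \<le> s" "s \<le> r" "0 \<le> t" "t \<le> r"
    "f (x + r *\<^sub>R u + r *\<^sub>R v) - f (x + r *\<^sub>R u) - (f (x + r *\<^sub>R v) - f x)
      = r * (r * frechet_derivative (\<lambda>y. frechet_derivative f (at y) u) (at (x + s *\<^sub>R u + t *\<^sub>R v)) v)"
proof -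
  let ?D = "\<lambda>y. frechet_derivative f (at y) u"
  have D: "(f has_derivative frechet_derivative f (at y)) (at y)" if "y \<in> S" for y
    using ck_on_has_derivative[OF f that] .
  have D2: "(?D has_derivative frechet_derivative ?D (at y)) (at y)" if "y \<in> S" for y
    using f that by (intro ck_on_has_derivative[of 0 _ S]) auto
  have lin: "linear (frechet_derivative f (at y))" "linear (frechet_derivative ?D (at y))"
    if "y \<in> S" for y
    using D[OF that] D2[OF that] by (auto intro: has_derivative_linear)
  have *: "((\<lambda>s. f (x + s *\<^sub>R u + t *\<^sub>R v)) has_real_derivative ?D (x + s *\<^sub>R u + t *\<^sub>R v)) (at s)"
    if "0 \<le> s" "s \<le> r" "0 \<le> t" "t \<le> r" for s t
  proof -
    have "((\<lambda>s. f (x + s *\<^sub>R u + t *\<^sub>R v)) has_derivative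
        (\<lambda>h. frechet_derivative f (at (x + s *\<^sub>R u + t *\<^sub>R v)) (h *\<^sub>R u))) (at s)"
      by (rule has_derivative_compose[where f = "\<lambda>s. x + s *\<^sub>R u + t *\<^sub>R v" and g = f, OF _ D[OF S[OF that]]])
         (auto intro!: derivative_eq_intros)
    thus ?thesis unfolding has_field_derivative_def
      by (simp add: linear_scale[OF lin(1)[OF S[OF that]]] mult_commute_abs)
  qed
  have **: "((\<lambda>t. ?D (x + s *\<^sub>R u + t *\<^sub>R v)) has_real_derivative
      frechet_derivative ?D (at (x + s *\<^sub>R u + t *\<^sub>R v)) v) (at t)"
    if "0 \<le> s" "s \<le> r" "0 \<le> t" "t \<le> r" for s t
  proof -
    have "((\<lambda>t. ?D (x + s *\<^sub>R u + t *\<^sub>R v)) has_derivative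
        (\<lambda>h. frechet_derivative ?D (at (x + s *\<^sub>R u + t *\<^sub>R v)) (h *\<^sub>R v))) (at t)"
      by (rule has_derivative_compose[where f = "\<lambda>t. x + s *\<^sub>R u + t *\<^sub>R v" and g = ?D, OF _ D2[OF S[OF that]]])
         (auto intro!: derivative_eq_intros)
    thus ?thesis unfolding has_field_derivative_def
      by (simp add: linear_scale[OF lin(2)[OF S[OF that]]] mult_commute_abs)
  qed
  define g where "g = (\<lambda>s. f (x + s *\<^sub>R u + r *\<^sub>R v) - f (x + s *\<^sub>R u + 0 *\<^sub>R v))"
  have "(g has_real_derivative ?D (x + s *\<^sub>R u + r *\<^sub>R v) - ?D (x + s *\<^sub>R u + 0 *\<^sub>R v)) (at s)"
    if "0 \<le> s" "s \<le> r" for s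
    unfolding g_def by (intro DERIV_diff *) (use that assms in auto)
  then obtain s where s: "0 < s" "s < r"
    "g r - g 0 = (r - 0) * (?D (x + s *\<^sub>R u + r *\<^sub>R v) - ?D (x + s *\<^sub>R u + 0 *\<^sub>R v))"
    using MVT2[OF \<open>r > 0\<close>, of g "\<lambda>s. ?D (x + s *\<^sub>R u + r *\<^sub>R v) - ?D (x + s *\<^sub>R u + 0 *\<^sub>R v)"]
    by auto
  obtain t where t: "0 < t" "t < r"
    "?D (x + s *\<^sub>R u + r *\<^sub>R v) - ?D (x + s *\<^sub>R u + 0 *\<^sub>R v)
      = (r - 0) * frechet_derivative ?D (at (x + s *\<^sub>R u + t *\<^sub>R v)) v"
    using MVT2[OF \<open>r > 0\<close>, of "\<lambda>t. ?D (x + s *\<^sub>R u + t *\<^sub>R v)"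
        "\<lambda>t. frechet_derivative ?D (at (x + s *\<^sub>R u + t *\<^sub>R v)) v"] ** s
    by auto
  show ?thesis
    by (rule that[of s t]) (use s t in \<open>auto simp: g_def\<close>)
qed

lemma mixed_derivatives_commute_real:
  fixes f :: "'a::euclidean_space \<Rightarrow> real"
  assumes "open S" "x \<in> S" and f: "ck_on (Suc (Suc 0)) f S"
  shows "frechet_derivative (\<lambda>y. frechet_derivative f (at y) u) (at x) v
       = frechet_derivative (\<lambda>y. frechet_derivative f (at y) v) (at x) u"
    (is "?A x = ?B x")
proof (rule ccontr)
  assume "?A x \<noteq> ?B x"
  define e where "e = \<bar>?A x - ?B x\<bar> / 2"
  have e: "e > 0" using \<open>?A x \<noteq> ?B x\<close> by (simp add: e_def)
  have cont: "continuous_on S ?A" "continuous_on S ?B" using f by auto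
  obtain d0 where d0: "d0 > 0" "ball x d0 \<subseteq> S"
    using assms(1,2) open_contains_ball by blast
  obtain d1 where d1: "d1 > 0" "\<And>y. y \<in> S \<Longrightarrow> dist y x < d1 \<Longrightarrow> dist (?A y) (?A x) < e"
    using cont(1) assms(2) e unfolding continuous_on_iff by blast
  obtain d2 where d2: "d2 > 0" "\<And>y. y \<in> S \<Longrightarrow> dist y x < d2 \<Longrightarrow> dist (?B y) (?B x) < e"
    using cont(2) assms(2) e unfolding continuous_on_iff by blast
  define d where "d = min d0 (min d1 d2)"
  have d: "d > 0" using d0 d1 d2 by (simp add: d_def)
  define r where "r = d / (2 * (norm u + norm v + 1))"
  have r: "r > 0" using d by (simp add: r_def add_nonneg_pos)
  have near: "dist (x + s *\<^sub>R u' + t *\<^sub>R v') x < d"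
    if "0 \<le> s" "s \<le> r" "0 \<le> t" "t \<le> r" "(u', v') = (u, v) \<or> (u', v') = (v, u)" for s t u' v'
  proof -
    have "dist (x + s *\<^sub>R u' + t *\<^sub>R v') x \<le> s * norm u' + t * norm v'"
      using norm_triangle_ineq[of "s *\<^sub>R u'" "t *\<^sub>R v'"] that by (simp add: dist_norm add.assoc)
    also have "\<dots> \<le> r * norm u' + r * norm v'"
      by (intro add_mono mult_right_mono) (use that in auto)
    also have "\<dots> = r * (norm u + norm v)" using that by (auto simp: algebra_simps)
    also have "\<dots> < r * (2 * (norm u + norm v + 1))"
      by (intro mult_strict_left_mono r) (simp add: add_nonneg_pos)
    also have "\<dots> = d"
    proof -
      have "norm u + norm v + 1 > 0" by (simp add: add_nonneg_pos)
      thus ?thesis unfolding r_def by simp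
    qed
    finally show ?thesis .
  qed
  have inS: "x + s *\<^sub>R u' + t *\<^sub>R v' \<in> S"
    if "0 \<le> s" "s \<le> r" "0 \<le> t" "t \<le> r" "(u', v') = (u, v) \<or> (u', v') = (v, u)" for s t u' v'
    using near[OF that] d0 by (auto simp: d_def dist_commute)
  obtain s t where st: "0 \<le> s" "s \<le> r" "0 \<le> t" "t \<le> r"
    "f (x + r *\<^sub>R u + r *\<^sub>R v) - f (x + r *\<^sub>R u) - (f (x + r *\<^sub>R v) - f x)
      = r * (r * ?A (x + s *\<^sub>R u + t *\<^sub>R v))"
    using second_difference_eq_mixed_derivative[OF r f, of x u v] inS by blast
  obtain s' t' where st': "0 \<le> s'" "s' \<le> r" "0 \<le> t'" "t' \<le> r"
    "f (x + r *\<^sub>R v + r *\<^sub>R u) - f (x + r *\<^sub>R v) - (f (x + r *\<^sub>R u) - f x)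
      = r * (r * ?B (x + s' *\<^sub>R v + t' *\<^sub>R u))"
    using second_difference_eq_mixed_derivative[OF r f, of x v u] inS by blast
  have xx: "x + r *\<^sub>R v + r *\<^sub>R u = x + r *\<^sub>R u + r *\<^sub>R v" by simp
  hence "r * (r * ?A (x + s *\<^sub>R u + t *\<^sub>R v)) = r * (r * ?B (x + s' *\<^sub>R v + t' *\<^sub>R u))"
    using st(5) st'(5)[unfolded xx] by linarith
  hence eq: "?A (x + s *\<^sub>R u + t *\<^sub>R v) = ?B (x + s' *\<^sub>R v + t' *\<^sub>R u)" using r by simp
  have "dist (?A (x + s *\<^sub>R u + t *\<^sub>R v)) (?A x) < e"
    using d1(2)[OF inS[OF st(1-4)]] near[OF st(1-4)] by (simp add: d_def)
  moreover have "dist (?B (x + s' *\<^sub>R v + t' *\<^sub>R u)) (?B x) < e"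
    using d2(2)[OF inS[OF st'(1-4)]] near[OF st'(1-4)] by (simp add: d_def)
  ultimately have "\<bar>?A x - ?B x\<bar> < 2 * e" unfolding eq dist_real_def by linarith
  thus False by (simp add: e_def)
qed

lemma frechet_derivative_linear_compose:
  assumes "bounded_linear h" "f differentiable at x"
  shows "frechet_derivative (\<lambda>y. h (f y)) (at x) v = h (frechet_derivative f (at x) v)"
  using frechet_derivative_at[OF bounded_linear.has_derivative[OF assms(1)
        assms(2)[unfolded frechet_derivative_works]]] by (metis (no_types))

lemma mixed_derivatives_commute:
  fixes f :: "'a::euclidean_space \<Rightarrow> 'b::euclidean_space"
  assumes "open S" "x \<in> S" and f: "smooth_on f S"
  shows "frechet_derivative (\<lambda>y. frechet_derivative f (at y) u) (at x) v
       = frechet_derivative (\<lambda>y. frechet_derivative f (at y) v) (at x) u"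
proof (rule euclidean_eqI)
  fix b :: 'b assume "b \<in> Basis"
  let ?h = "\<lambda>z::'b. z \<bullet> b"
  have bl: "bounded_linear ?h" by (rule bounded_linear_inner_left)
  have diff: "f differentiable at y" "(\<lambda>y. frechet_derivative f (at y) u) differentiable at y"
    if "y \<in> S" for y u
    using smooth_on_has_derivative[OF f that] smooth_on_has_derivative[OF smooth_on_deriv[OF f] that]
    by (auto simp: differentiable_def)
  have *: "frechet_derivative (\<lambda>y. frechet_derivative (\<lambda>y. ?h (f y)) (at y) u) (at x) v
      = ?h (frechet_derivative (\<lambda>y. frechet_derivative f (at y) u) (at x) v)" for u v
  proof -
    have "frechet_derivative (\<lambda>y. frechet_derivative (\<lambda>y. ?h (f y)) (at y) u) (at x)
        = frechet_derivative (\<lambda>y. ?h (frechet_derivative f (at y) u)) (at x)"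
      by (rule frechet_derivative_cong_open[OF assms(1,2)])
         (rule frechet_derivative_linear_compose[OF bl diff(1)])
    thus ?thesis by (simp add: frechet_derivative_linear_compose[OF bl diff(2)[OF assms(2)]])
  qed
  have "ck_on (Suc (Suc 0)) (\<lambda>y. ?h (f y)) S"
    by (rule smooth_onD[OF smooth_on_linear_compose[OF bl assms(1) f]])
  from mixed_derivatives_commute_real[OF assms(1,2) this, of u v]
  show "?h (frechet_derivative (\<lambda>y. frechet_derivative f (at y) u) (at x) v)
    = ?h (frechet_derivative (\<lambda>y. frechet_derivative f (at y) v) (at x) u)"
    unfolding * .
qed

text \<open>The primitive is the integral of \<open>\<alpha>\<close> along the segment from \<open>a\<close> to \<open>x\<close>. Closedness turns
  the derivative of the integrand in direction \<open>h\<close> into the derivative of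
  \<open>t *\<^sub>R \<alpha> (a + t *\<^sub>R (x - a)) h\<close> with respect to \<open>t\<close>.\<close>
lemma poincare_lemma_1_forms:
  fixes \<alpha> :: "'a::euclidean_space \<Rightarrow> 'a \<Rightarrow> 'b::euclidean_space"
  assumes "open S" "convex S" "a \<in> S"
    and lin: "\<And>x. x \<in> S \<Longrightarrow> linear (\<alpha> x)"
    and smooth: "\<And>v. smooth_on (\<lambda>x. \<alpha> x v) S"
    and closed: "\<And>x u v. x \<in> S \<Longrightarrow> frechet_derivative (\<lambda>y. \<alpha> y v) (at x) u
                                  = frechet_derivative (\<lambda>y. \<alpha> y u) (at x) v"
  obtains f where "f a = 0" "\<And>x. x \<in> S \<Longrightarrow> (f has_derivative \<alpha> x) (at x)"
proof -
  let ?D = "\<lambda>v x. frechet_derivative (\<lambda>y. \<alpha> y v) (at x)"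
  define p where "p x t = a + t *\<^sub>R (x - a)" for x :: 'a and t :: real
  have pS: "p x t \<in> S" if "x \<in> S" "t \<in> {0..1}" for x t
  proof -
    have "p x t = (1 - t) *\<^sub>R a + t *\<^sub>R x" by (simp add: p_def algebra_simps)
    thus ?thesis using convexD_alt[OF assms(2,3) that(1)] that(2) by simp
  qed
  have der: "((\<lambda>y. \<alpha> y v) has_derivative ?D v x) (at x)" if "x \<in> S" for x v
    by (rule smooth_on_has_derivative[OF smooth that])
  \<comment> \<open>The derivative of the integrand in direction \<open>h\<close>, after closedness has been used to exchange
    \<open>h\<close> and \<open>x - a\<close> in the second term.\<close>
  define g where "g x t h = \<alpha> (p x t) h + t *\<^sub>R ?D h (p x t) (x - a)" for x t h
  have g_sum: "g x t h = (\<Sum>b\<in>Basis. (h \<bullet> b) *\<^sub>R \<alpha> (p x t) b + ((x - a) \<bullet> b) *\<^sub>R ?D b (p x t) (t *\<^sub>R h))"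
    if "x \<in> S" "t \<in> {0..1}" for x t h
  proof -
    have "\<alpha> (p x t) h = (\<Sum>b\<in>Basis. (h \<bullet> b) *\<^sub>R \<alpha> (p x t) b)"
      by (rule linear_basis_expansion[OF lin[OF pS[OF that]]])
    moreover have "?D h (p x t) (x - a) = (\<Sum>b\<in>Basis. ((x - a) \<bullet> b) *\<^sub>R ?D h (p x t) b)"
      by (rule linear_basis_expansion[OF has_derivative_linear[OF der[OF pS[OF that]]]])
    moreover have "?D b (p x t) (t *\<^sub>R h) = t *\<^sub>R ?D h (p x t) b" for b
      unfolding closed[OF pS[OF that], of h b]
      by (rule linear_scale[OF has_derivative_linear[OF der[OF pS[OF that]]]])
    ultimately show ?thesis
      by (simp add: g_def scaleR_sum_right sum.distrib mult.commute)
  qed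
  have g_deriv: "((\<lambda>x. \<alpha> (p x t) (x - a)) has_derivative g x t) (at x)"
    if "x \<in> S" "t \<in> {0..1}" for x t
  proof (rule has_derivative_transform_within_open[OF _ assms(1) that(1)])
    have "((\<lambda>x. \<alpha> (p x t) b) has_derivative (\<lambda>h. ?D b (p x t) (t *\<^sub>R h))) (at x)" for b
      by (rule has_derivative_compose[where f = "\<lambda>x. p x t" and g = "\<lambda>y. \<alpha> y b", OF _ der[OF pS[OF that]]])
         (auto simp: p_def intro!: derivative_eq_intros)
    hence "((\<lambda>x. \<Sum>b\<in>Basis. ((x - a) \<bullet> b) *\<^sub>R \<alpha> (p x t) b) has_derivative
       (\<lambda>h. \<Sum>b\<in>Basis. ((x - a) \<bullet> b) *\<^sub>R ?D b (p x t) (t *\<^sub>R h) + (h \<bullet> b) *\<^sub>R \<alpha> (p x t) b)) (at x)"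
      by (intro has_derivative_sum has_derivative_scaleR) (auto intro!: derivative_eq_intros)
    thus "((\<lambda>x. \<Sum>b\<in>Basis. ((x - a) \<bullet> b) *\<^sub>R \<alpha> (p x t) b) has_derivative g x t) (at x)"
      unfolding g_sum[OF that, abs_def] by (simp add: add.commute)
  next
    fix x assume "x \<in> S"
    show "(\<Sum>b\<in>Basis. ((x - a) \<bullet> b) *\<^sub>R \<alpha> (p x t) b) = \<alpha> (p x t) (x - a)"
      by (rule linear_basis_expansion[OF lin[OF pS[OF \<open>x \<in> S\<close> that(2)]], symmetric])
  qed
  have bl: "bounded_linear (g x t)" if "x \<in> S" "t \<in> {0..1}" for x t
    by (rule has_derivative_bounded_linear[OF g_deriv[OF that]])
  define G where "G x t = Blinfun (g x t)" for x t
  have G: "blinfun_apply (G x t) = g x t" if "x \<in> S" "t \<in> {0..1}" for x t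
    unfolding G_def by (rule bounded_linear_Blinfun_apply[OF bl[OF that]])
  have p_cont: "continuous_on (S \<times> {0..1}) (\<lambda>(x, t). p x t)"
    unfolding p_def split_beta by (intro continuous_intros)
  have comp: "continuous_on (S \<times> {0..1}) (\<lambda>z. k (p (fst z) (snd z)))" if "continuous_on S k" for k :: "'a \<Rightarrow> 'b"
    by (rule continuous_on_compose2[OF that p_cont[unfolded split_beta]]) (auto intro: pS)
  have G_cont: "continuous_on (S \<times> {0..1}) (\<lambda>(x, t). G x t)"
  proof (rule continuous_on_blinfun_componentwise)
    fix h :: 'a assume "h \<in> Basis"
    have "continuous_on (S \<times> {0..1}) (\<lambda>z. \<Sum>b\<in>Basis. (h \<bullet> b) *\<^sub>R \<alpha> (p (fst z) (snd z)) b
        + ((fst z - a) \<bullet> b) *\<^sub>R snd z *\<^sub>R ?D b (p (fst z) (snd z)) h)"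
      by (intro continuous_intros comp smooth_on_continuous[OF smooth]
          smooth_on_continuous[OF smooth_on_deriv[OF smooth]])
    moreover have "(\<Sum>b\<in>Basis. (h \<bullet> b) *\<^sub>R \<alpha> (p (fst z) (snd z)) b
        + ((fst z - a) \<bullet> b) *\<^sub>R snd z *\<^sub>R ?D b (p (fst z) (snd z)) h) = blinfun_apply (case z of (x, t) \<Rightarrow> G x t) h"
      if z: "z \<in> S \<times> {0..1}" for z
    proof -
      have *: "fst z \<in> S" "snd z \<in> {0..1}" using z by auto
      have "?D b (p (fst z) (snd z)) (snd z *\<^sub>R h) = snd z *\<^sub>R ?D b (p (fst z) (snd z)) h" for b
        by (rule linear_scale[OF has_derivative_linear[OF der[OF pS[OF *]]]])
      thus ?thesis using g_sum[OF *, of h] G[OF *] by (simp add: split_beta)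
    qed
    ultimately show "continuous_on (S \<times> {0..1}) (\<lambda>z. blinfun_apply (case z of (x, t) \<Rightarrow> G x t) h)"
      using continuous_on_cong by (metis (no_types, lifting))
  qed
  define f where "f x = integral (cbox 0 1) (\<lambda>t. \<alpha> (p x t) (x - a))" for x
  have int: "(\<lambda>t. \<alpha> (p x t) (x - a)) integrable_on cbox 0 1" if "x \<in> S" for x
  proof (rule integrable_continuous)
    have "continuous_on (cbox 0 1) (p x)" unfolding p_def by (intro continuous_intros)
    thus "continuous_on (cbox 0 1) (\<lambda>t. \<alpha> (p x t) (x - a))"
      by (rule continuous_on_compose2[OF smooth_on_continuous[OF smooth[of "x - a"]]])
         (use pS[OF that] in auto)
  qed
  have "(f has_derivative \<alpha> x) (at x)" if "x \<in> S" for x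
  proof -
    have "(f has_derivative blinfun_apply (integral (cbox 0 1) (G x))) (at x within S)"
      unfolding f_def
    proof (rule leibniz_rule[OF _ int _ that assms(2)])
      show "((\<lambda>x. \<alpha> (p x t) (x - a)) has_derivative blinfun_apply (G x t)) (at x within S)"
        if "x \<in> S" "t \<in> cbox 0 1" for x t
        using g_deriv[of x t] that by (auto simp: G intro: has_derivative_at_withinI)
      show "continuous_on (S \<times> cbox 0 1) (\<lambda>(x, t). G x t)" using G_cont by simp
    qed
    moreover have "blinfun_apply (integral (cbox 0 1) (G x)) h = \<alpha> x h" for h
    proof -
      have Gint: "G x integrable_on cbox 0 1"
      proof (rule integrable_continuous)
        have "continuous_on {0..1} (\<lambda>t::real. (x, t))" by (intro continuous_intros)
        hence "continuous_on {0..1} (\<lambda>t. case (x, t) of (x, t) \<Rightarrow> G x t)"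
          by (rule continuous_on_compose2[OF G_cont]) (use that in auto)
        thus "continuous_on (cbox 0 1) (G x)" by simp
      qed
      have "integral (cbox 0 1) ((\<lambda>A. blinfun_apply A h) \<circ> G x) = blinfun_apply (integral (cbox 0 1) (G x)) h"
        by (rule integral_linear[OF Gint blinfun.bounded_linear_left])
      moreover have "((\<lambda>A. blinfun_apply A h) \<circ> G x has_integral 1 *\<^sub>R \<alpha> (p x 1) h - 0 *\<^sub>R \<alpha> (p x 0) h) {0..1}"
      proof (rule fundamental_theorem_of_calculus)
        fix t :: real assume t: "t \<in> {0..1}"
        have "(p x has_derivative (\<lambda>s. s *\<^sub>R (x - a))) (at t)"
          unfolding p_def by (auto intro!: derivative_eq_intros)
        from has_derivative_compose[OF this der[OF pS[OF that t], of h]]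
        have "((\<lambda>t. \<alpha> (p x t) h) has_derivative (\<lambda>s. s *\<^sub>R ?D h (p x t) (x - a))) (at t)"
          by (simp add: linear_scale[OF has_derivative_linear[OF der[OF pS[OF that t]]]])
        hence "((\<lambda>t. \<alpha> (p x t) h) has_vector_derivative ?D h (p x t) (x - a)) (at t)"
          by (simp add: has_vector_derivative_def)
        hence "((\<lambda>t. t *\<^sub>R \<alpha> (p x t) h) has_vector_derivative (t *\<^sub>R ?D h (p x t) (x - a) + 1 *\<^sub>R \<alpha> (p x t) h)) (at t)"
          by (intro has_vector_derivative_scaleR) auto
        moreover have "((\<lambda>A. blinfun_apply A h) \<circ> G x) t = t *\<^sub>R ?D h (p x t) (x - a) + 1 *\<^sub>R \<alpha> (p x t) h"
          using G[OF that t] by (simp add: g_def)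
        ultimately show "((\<lambda>t. t *\<^sub>R \<alpha> (p x t) h) has_vector_derivative ((\<lambda>A. blinfun_apply A h) \<circ> G x) t) (at t within {0..1})"
          by (simp add: has_vector_derivative_at_within)
      qed simp
      ultimately show ?thesis by (simp add: integral_unique p_def)
    qed
    hence "blinfun_apply (integral (cbox 0 1) (G x)) = \<alpha> x" by auto
    ultimately show ?thesis using at_within_open[OF that assms(1)] by simp
  qed
  moreover have "f a = 0"
  proof -
    have "\<alpha> (p a t) (a - a) = 0" for t
      using linear_0[OF lin[OF assms(3)]] by (simp add: p_def)
    thus ?thesis by (simp add: f_def)
  qed
  ultimately show ?thesis using that by blast
qed

lemma smooth_on_ident: "open S \<Longrightarrow> smooth_on (\<lambda>x. x) S"
  by (rule smooth_on_linear[OF bounded_linear_ident])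

lemma has_derivative_linear_family:
  fixes \<alpha> :: "'a::euclidean_space \<Rightarrow> 'c::euclidean_space \<Rightarrow> 'b::euclidean_space"
  assumes "open S" "x \<in> S" and lin: "\<And>y. y \<in> S \<Longrightarrow> linear (\<alpha> y)"
    and smooth: "\<And>v. smooth_on (\<lambda>y. \<alpha> y v) S" and w: "(w has_derivative w') (at x)"
  shows "((\<lambda>y. \<alpha> y (w y)) has_derivative
           (\<lambda>u. frechet_derivative (\<lambda>y. \<alpha> y (w x)) (at x) u + \<alpha> x (w' u))) (at x)"
proof (rule has_derivative_transform_within_open[OF _ assms(1,2)])
  let ?D = "\<lambda>b. frechet_derivative (\<lambda>y. \<alpha> y b) (at x)"
  have *: "((\<lambda>y. \<Sum>b\<in>Basis. (c y \<bullet> b) *\<^sub>R \<alpha> y b) has_derivative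
      (\<lambda>u. \<Sum>b\<in>Basis. (c x \<bullet> b) *\<^sub>R ?D b u + (c' u \<bullet> b) *\<^sub>R \<alpha> x b)) (at x)"
    if "(c has_derivative c') (at x)" for c c'
    by (intro has_derivative_sum has_derivative_scaleR has_derivative_inner_left that
        smooth_on_has_derivative[OF smooth assms(2)])
  have exp: "(\<Sum>b\<in>Basis. (v \<bullet> b) *\<^sub>R \<alpha> y b) = \<alpha> y v" if "y \<in> S" for y v
    using linear_basis_expansion[OF lin[OF that], of v] by simp
  have "((\<lambda>y. \<alpha> y (w x)) has_derivative (\<lambda>u. \<Sum>b\<in>Basis. (w x \<bullet> b) *\<^sub>R ?D b u)) (at x)"
    by (rule has_derivative_transform_within_open[OF _ assms(1,2) exp])
       (use *[of "\<lambda>_. w x" "\<lambda>_. 0"] in auto)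
  hence "?D (w x) = (\<lambda>u. \<Sum>b\<in>Basis. (w x \<bullet> b) *\<^sub>R ?D b u)"
    by (rule frechet_derivative_at[symmetric])
  thus "((\<lambda>y. \<Sum>b\<in>Basis. (w y \<bullet> b) *\<^sub>R \<alpha> y b) has_derivative (\<lambda>u. ?D (w x) u + \<alpha> x (w' u))) (at x)"
    using *[OF w] exp[OF assms(2)] by (simp add: sum.distrib)
  show "(\<Sum>b\<in>Basis. (w y \<bullet> b) *\<^sub>R \<alpha> y b) = \<alpha> y (w y)" if "y \<in> S" for y by (rule exp[OF that])
qed

lemma ck_on_linear_family:
  fixes \<alpha> :: "'a::euclidean_space \<Rightarrow> 'c::euclidean_space \<Rightarrow> 'b::euclidean_space"
  assumes "open S" "\<And>y. y \<in> S \<Longrightarrow> linear (\<alpha> y)" "\<And>v. ck_on k (\<lambda>y. \<alpha> y v) S" "ck_on k w S"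
  shows "ck_on k (\<lambda>y. \<alpha> y (w y)) S"
proof (rule ck_on_cong[OF assms(1)])
  show "ck_on k (\<lambda>y. \<Sum>b\<in>Basis. (w y \<bullet> b) *\<^sub>R \<alpha> y b) S"
    by (intro ck_on_sum assms(1,3) finite_Basis ck_on_bilinear[OF bounded_bilinear_scaleR]
         ck_on_linear_compose[OF bounded_linear_inner_left] assms(4))
qed (simp add: linear_basis_expansion[OF assms(2), symmetric])

section \<open>A Lie group in a chart around its identity\<close>

text \<open>Multiplication \<open>m\<close> and inversion \<open>i\<close> of a Lie group, expressed in a chart with image \<open>W\<close> that
  maps the identity to \<open>e0\<close>. \<open>D\<close> and \<open>I\<close> are the sets where the product and the inverse stay in the
  domain of the chart.\<close>
locale local_lie_group =
  fixes m :: "'e::euclidean_space \<times> 'e \<Rightarrow> 'e" and i :: "'e \<Rightarrow> 'e" and e0 :: 'e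
    and D :: "('e \<times> 'e) set" and W I :: "'e set"
  assumes open_D: "open D" and smooth_m: "smooth_on m D"
    and open_W: "open W" and e0_W: "e0 \<in> W"
    and m_in_W: "p \<in> D \<Longrightarrow> m p \<in> W"
    and right_one: "x \<in> W \<Longrightarrow> (x, e0) \<in> D" "x \<in> W \<Longrightarrow> m (x, e0) = x"
    and left_one: "x \<in> W \<Longrightarrow> m (e0, x) = x"
    and open_I: "open I" and I_W: "I \<subseteq> W" and e0_I: "e0 \<in> I"
    and smooth_i: "smooth_on i I"
    and left_inverse: "x \<in> I \<Longrightarrow> (i x, x) \<in> D" "x \<in> I \<Longrightarrow> m (i x, x) = e0"
    and assoc: "\<lbrakk>(x, y) \<in> D; (y, z) \<in> D; (m (x, y), z) \<in> D\<rbrakk> \<Longrightarrow> (x, m (y, z)) \<in> D"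
      "\<lbrakk>(x, y) \<in> D; (y, z) \<in> D; (m (x, y), z) \<in> D\<rbrakk> \<Longrightarrow> m (x, m (y, z)) = m (m (x, y), z)"
begin

text \<open>The differential of left translation by \<open>x\<close> at the point \<open>y\<close>.\<close>
definition dL :: "'e \<Rightarrow> 'e \<Rightarrow> 'e \<Rightarrow> 'e" where
  "dL x y v = frechet_derivative m (at (x, y)) (0, v)"

definition X :: "'e \<Rightarrow> 'e \<Rightarrow> 'e" where
  "X v x = frechet_derivative (\<lambda>y. m (x, y)) (at e0) v"

definition br :: "'e \<Rightarrow> 'e \<Rightarrow> 'e" where
  "br u v = frechet_derivative (X v) (at e0) u - frechet_derivative (X u) (at e0) v"

text \<open>The left Maurer-Cartan form: translate back to the identity with the inverse of \<open>x\<close>. Its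
  definition through the smooth maps \<open>m\<close> and \<open>i\<close>, instead of as an inverse of \<open>\<lambda>v. X v x\<close>, makes its
  smoothness immediate.\<close>
definition \<theta> :: "'e \<Rightarrow> 'e \<Rightarrow> 'e" where
  "\<theta> x v = dL (i x) x v"

lemma open_slice: "open {y. (x, y) \<in> D}"
  using open_vimage[OF open_D, of "\<lambda>y. (x, y)"] by (simp add: vimage_def continuous_intros)

lemma m_deriv:
  assumes "(x, y) \<in> D" shows "((\<lambda>y. m (x, y)) has_derivative dL x y) (at y)"
  unfolding dL_def
  by (rule has_derivative_compose[where f = "\<lambda>y. (x, y)" and g = m,
        OF _ smooth_on_has_derivative[OF smooth_m assms]])
     (auto intro!: derivative_eq_intros)

lemma dL_linear: "(x, y) \<in> D \<Longrightarrow> linear (dL x y)"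
  using m_deriv has_derivative_linear by blast

lemma X_eq: "x \<in> W \<Longrightarrow> X v x = dL x e0 v"
  unfolding X_def using frechet_derivative_at[OF m_deriv[OF right_one(1)]] by metis

lemma X_smooth: "smooth_on (X v) W"
proof (rule smooth_on_cong[OF open_W])
  show "dL x e0 v = X v x" if "x \<in> W" for x using X_eq[OF that] by simp
  show "smooth_on (\<lambda>x. dL x e0 v) W"
    unfolding dL_def
    by (rule smooth_on_deriv_apply[OF open_W open_D _ smooth_m])
       (auto intro!: smooth_on_Pair smooth_on_const open_W right_one
         smooth_on_ident)
qed

lemma X_linear: "x \<in> W \<Longrightarrow> linear (\<lambda>v. X v x)"
  using dL_linear[OF right_one(1)] X_eq by simp

lemma X_deriv: "x \<in> W \<Longrightarrow> (X v has_derivative frechet_derivative (X v) (at x)) (at x)"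
  by (rule smooth_on_has_derivative[OF X_smooth])

lemma X_e0: "X v e0 = v"
proof -
  have "((\<lambda>y. m (e0, y)) has_derivative (\<lambda>v. v)) (at e0)"
    by (rule has_derivative_transform_within_open[OF has_derivative_ident open_W e0_W])
       (simp add: left_one)
  thus ?thesis unfolding X_def by (simp add: frechet_derivative_at[symmetric])
qed

text \<open>Left invariance of the fields \<open>X v\<close>: differentiate the associative law in the last variable.\<close>
lemma X_equivariant:
  assumes xy: "(x, y) \<in> D" and y: "y \<in> W" shows "dL x y (X v y) = X v (m (x, y))"
proof -
  let ?N = "{z. (y, z) \<in> D} \<inter> {z. (m (x, y), z) \<in> D}"
  have "((\<lambda>z. m (x, m (y, z))) has_derivative (\<lambda>v. dL x y (dL y e0 v))) (at e0)"
    using has_derivative_compose[where f = "\<lambda>z. m (y, z)" and g = "\<lambda>z. m (x, z)",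
        OF m_deriv[OF right_one(1)[OF y]]] m_deriv[OF xy] right_one(2)[OF y] by simp
  moreover have "((\<lambda>z. m (x, m (y, z))) has_derivative dL (m (x, y)) e0) (at e0)"
  proof (rule has_derivative_transform_within_open[OF m_deriv])
    show "open ?N" by (intro open_Int open_slice)
    show "e0 \<in> ?N" "(m (x, y), e0) \<in> D" using right_one(1) y m_in_W[OF xy] by auto
    show "m (m (x, y), z) = m (x, m (y, z))" if "z \<in> ?N" for z
      using assoc(2)[OF xy] that by simp
  qed
  ultimately have "(\<lambda>v. dL x y (dL y e0 v)) = dL (m (x, y)) e0" by (rule has_derivative_unique)
  thus ?thesis using X_eq[OF y] X_eq[OF m_in_W[OF xy]] by metis
qed

text \<open>Differentiate the invariance \<open>dL x y (X v y) = X v (m (x, y))\<close> in \<open>y\<close> at \<open>e0\<close> and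
  antisymmetrise; the second derivatives of \<open>m\<close> cancel because they are symmetric.\<close>
lemma X_bracket:
  assumes x: "x \<in> W"
  shows "frechet_derivative (X v) (at x) (X u x) - frechet_derivative (X u) (at x) (X v x)
    = X (br u v) x"
proof -
  define N where "N = {y. (x, y) \<in> D} \<inter> W"
  let ?g = "\<lambda>y. m (x, y)"
  have N: "open N" "e0 \<in> N"
    unfolding N_def using open_slice open_W right_one(1)[OF x] e0_W by auto
  have g: "smooth_on ?g N"
    by (rule smooth_on_compose[OF N(1) open_D _ smooth_m])
       (auto simp: N_def intro!: smooth_on_Pair smooth_on_const smooth_on_ident open_Int open_slice open_W)
  have gT: "frechet_derivative ?g (at y) = dL x y" if "y \<in> N" for y
    using frechet_derivative_at[OF m_deriv[of x y]] that by (simp add: N_def)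
  have gx: "?g e0 = x" by (rule right_one(2)[OF x])
  have *: "frechet_derivative (X v) (at x) (X u x)
      = frechet_derivative (\<lambda>y. frechet_derivative ?g (at y) v) (at e0) u
        + X (frechet_derivative (X v) (at e0) u) x" for u v
  proof -
    have "((\<lambda>y. X v (?g y)) has_derivative (\<lambda>u. frechet_derivative (X v) (at x) (dL x e0 u))) (at e0)"
      by (rule has_derivative_compose[where f = ?g and g = "X v", OF m_deriv[OF right_one(1)[OF x]]])
         (simp add: gx X_deriv[OF x])
    moreover have "((\<lambda>y. X v (?g y)) has_derivative
        (\<lambda>u. frechet_derivative (\<lambda>y. frechet_derivative ?g (at y) (X v e0)) (at e0) u
          + frechet_derivative ?g (at e0) (frechet_derivative (X v) (at e0) u))) (at e0)"
    proof (rule has_derivative_transform_within_open[OF _ N])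
      show "((\<lambda>y. frechet_derivative ?g (at y) (X v y)) has_derivative
        (\<lambda>u. frechet_derivative (\<lambda>y. frechet_derivative ?g (at y) (X v e0)) (at e0) u
          + frechet_derivative ?g (at e0) (frechet_derivative (X v) (at e0) u))) (at e0)"
        by (rule has_derivative_linear_family[OF N _ smooth_on_deriv[OF g] X_deriv[OF e0_W]])
           (auto intro: has_derivative_linear smooth_on_has_derivative[OF g])
      show "frechet_derivative ?g (at y) (X v y) = X v (?g y)" if "y \<in> N" for y
        using gT[OF that] X_equivariant[of x y v] that by (simp add: N_def)
    qed
    ultimately have "(\<lambda>u. frechet_derivative (X v) (at x) (dL x e0 u)) =
        (\<lambda>u. frechet_derivative (\<lambda>y. frechet_derivative ?g (at y) (X v e0)) (at e0) u
          + frechet_derivative ?g (at e0) (frechet_derivative (X v) (at e0) u))"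
      by (rule has_derivative_unique)
    from fun_cong[OF this, of u] show ?thesis by (simp add: X_e0 gT[OF N(2)] X_eq[OF x])
  qed
  have "X (br u v) x = X (frechet_derivative (X v) (at e0) u) x - X (frechet_derivative (X u) (at e0) v) x"
    unfolding br_def by (rule linear_diff[OF X_linear[OF x]])
  thus ?thesis
    using *[of v u] *[of u v] mixed_derivatives_commute[OF N g, of u v] by simp
qed

lemma X_deriv_linear:
  assumes "x \<in> W" shows "linear (\<lambda>v. frechet_derivative (X v) (at x) u)"
proof (rule linearI)
  fix v w :: 'e and c :: real
  have "((\<lambda>y. X v y + X w y) has_derivative
     (\<lambda>u. frechet_derivative (X v) (at x) u + frechet_derivative (X w) (at x) u)) (at x)"
    by (intro has_derivative_add X_deriv assms)
  hence "(X (v + w) has_derivative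
     (\<lambda>u. frechet_derivative (X v) (at x) u + frechet_derivative (X w) (at x) u)) (at x)"
    by (rule has_derivative_transform_within_open[OF _ open_W assms])
       (simp add: linear_add[OF X_linear])
  from frechet_derivative_at[OF this]
  show "frechet_derivative (X (v + w)) (at x) u
      = frechet_derivative (X v) (at x) u + frechet_derivative (X w) (at x) u" by metis
  have "((\<lambda>y. c *\<^sub>R X v y) has_derivative (\<lambda>u. c *\<^sub>R frechet_derivative (X v) (at x) u)) (at x)"
    by (intro has_derivative_scaleR_right X_deriv assms)
  hence "(X (c *\<^sub>R v) has_derivative (\<lambda>u. c *\<^sub>R frechet_derivative (X v) (at x) u)) (at x)"
    by (rule has_derivative_transform_within_open[OF _ open_W assms])
       (simp add: linear_scale[OF X_linear])
  from frechet_derivative_at[OF this]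
  show "frechet_derivative (X (c *\<^sub>R v)) (at x) u = c *\<^sub>R frechet_derivative (X v) (at x) u" by metis
qed

lemma br_bilinear: "bilinear br"
  unfolding bilinear_def br_def
  using X_deriv_linear[OF e0_W] has_derivative_linear[OF X_deriv[OF e0_W]]
  by (auto intro!: linear_compose_sub)

lemma br_antisym: "br u v = - br v u"
  by (simp add: br_def)

text \<open>By \<open>X_bracket\<close>, \<open>br v w\<close> is the value at \<open>e0\<close> of a commutator of vector fields, whose derivative
  contributes second derivatives of the fields. In the cyclic sum these cancel by symmetry and the
  first order terms cancel in pairs.\<close>
lemma br_jacobi: "br u (br v w) + br v (br w u) + br w (br u v) = 0"
proof -
  let ?A = "\<lambda>v. frechet_derivative (X v) (at e0)"
  let ?H = "\<lambda>w v u. frechet_derivative (\<lambda>x. frechet_derivative (X w) (at x) v) (at e0) u"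
  have lin: "linear (frechet_derivative (X v) (at x))" if "x \<in> W" for v x
    by (rule has_derivative_linear[OF X_deriv[OF that]])
  have fam: "((\<lambda>x. frechet_derivative (X w) (at x) (X v x)) has_derivative
       (\<lambda>u. ?H w (X v e0) u + ?A w (?A v u))) (at e0)" for v w
    by (rule has_derivative_linear_family[OF open_W e0_W lin smooth_on_deriv[OF X_smooth] X_deriv[OF e0_W]])
  have A: "?A (br v w) u = ?H w v u + ?A w (?A v u) - (?H v w u + ?A v (?A w u))" for u v w
  proof -
    have "(X (br v w) has_derivative (\<lambda>u. ?H w (X v e0) u + ?A w (?A v u)
         - (?H v (X w e0) u + ?A v (?A w u)))) (at e0)"
      by (rule has_derivative_transform_within_open[OF has_derivative_diff[OF fam fam] open_W e0_W X_bracket])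
    hence "?A (br v w) = (\<lambda>u. ?H w (X v e0) u + ?A w (?A v u) - (?H v (X w e0) u + ?A v (?A w u)))"
      by (rule frechet_derivative_at[symmetric])
    thus ?thesis by (simp add: X_e0)
  qed
  have sym: "?H w v u = ?H w u v" for u v w
    by (rule mixed_derivatives_commute[OF open_W e0_W X_smooth])
  have jac: "br u (br v w) = ?H w v u + ?A w (?A v u) - (?H v w u + ?A v (?A w u))
      - (?A u (?A w v) - ?A u (?A v w))" for u v w
    unfolding br_def[of u "br v w"] A unfolding br_def linear_diff[OF lin[OF e0_W]] ..
  show ?thesis
    unfolding jac[of u v w] jac[of v w u] jac[of w u v]
    using sym[of w v u] sym[of v w u] sym[of u w v] by simp
qed

lemma \<theta>_linear: "x \<in> I \<Longrightarrow> linear (\<theta> x)"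
  using dL_linear[OF left_inverse(1)] unfolding \<theta>_def[abs_def] by simp

lemma \<theta>_smooth: "smooth_on (\<lambda>x. \<theta> x v) I"
  unfolding \<theta>_def dL_def
  by (rule smooth_on_deriv_apply[OF open_I open_D _ smooth_m])
     (auto intro!: smooth_on_Pair smooth_on_const open_I smooth_i left_inverse
         smooth_on_ident)

lemma \<theta>_X: "x \<in> I \<Longrightarrow> \<theta> x (X v x) = v"
  unfolding \<theta>_def using X_equivariant[OF left_inverse(1), of x v] left_inverse(2) X_e0 I_W by auto

lemma X_\<theta>:
  assumes "x \<in> I" shows "X (\<theta> x v) x = v"
proof -
  have "linear (\<lambda>v. X v x)" using X_linear assms I_W by blast
  moreover have "\<theta> x \<circ> (\<lambda>v. X v x) = id" using \<theta>_X[OF assms] by auto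
  ultimately have "(\<lambda>v. X v x) \<circ> \<theta> x = id"
    using linear_inverse_left[OF \<theta>_linear[OF assms]] by blast
  thus ?thesis by (metis comp_apply id_apply)
qed

text \<open>Differentiate \<open>\<theta> y (X v y) = v\<close> along \<open>\<xi>\<close>, antisymmetrise and insert the commutator of
  the fields \<open>X v\<close>.\<close>
lemma maurer_cartan:
  assumes x: "x \<in> I"
  shows "frechet_derivative (\<lambda>y. \<theta> y \<eta>) (at x) \<xi> - frechet_derivative (\<lambda>y. \<theta> y \<xi>) (at x) \<eta>
    = - br (\<theta> x \<xi>) (\<theta> x \<eta>)"
proof -
  have xW: "x \<in> W" using x I_W by blast
  have *: "frechet_derivative (\<lambda>y. \<theta> y (X v x)) (at x) \<zeta> = - \<theta> x (frechet_derivative (X v) (at x) \<zeta>)" for v \<zeta>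
  proof -
    have "((\<lambda>y. \<theta> y (X v y)) has_derivative (\<lambda>u. frechet_derivative (\<lambda>y. \<theta> y (X v x)) (at x) u
        + \<theta> x (frechet_derivative (X v) (at x) u))) (at x)"
      by (rule has_derivative_linear_family[OF open_I x \<theta>_linear \<theta>_smooth X_deriv[OF xW]])
    moreover have "((\<lambda>y. \<theta> y (X v y)) has_derivative (\<lambda>u. 0)) (at x)"
      by (rule has_derivative_transform_within_open[OF has_derivative_const[of v] open_I x])
         (simp add: \<theta>_X)
    ultimately have "(\<lambda>u. frechet_derivative (\<lambda>y. \<theta> y (X v x)) (at x) u
        + \<theta> x (frechet_derivative (X v) (at x) u)) = (\<lambda>u. 0)" by (rule has_derivative_unique)
    from fun_cong[OF this, of \<zeta>] show ?thesis by (simp add: eq_neg_iff_add_eq_0)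
  qed
  let ?u = "\<theta> x \<xi>" and ?v = "\<theta> x \<eta>"
  have "br ?u ?v = \<theta> x (frechet_derivative (X ?v) (at x) \<xi>) - \<theta> x (frechet_derivative (X ?u) (at x) \<eta>)"
    using \<theta>_X[OF x, of "br ?u ?v"] X_bracket[OF xW, of ?v ?u] X_\<theta>[OF x] linear_diff[OF \<theta>_linear[OF x]] by metis
  thus ?thesis using *[of ?v \<xi>] *[of ?u \<eta>] X_\<theta>[OF x] by simp
qed

end

section \<open>Local development of a Lie group with two-step nilpotent algebra\<close>

text \<open>The Baker-Campbell-Hausdorff series of a two-step nilpotent bracket, where it stops after the
  first commutator.\<close>
definition bch :: "('e::real_vector \<Rightarrow> 'e \<Rightarrow> 'e) \<Rightarrow> 'e \<Rightarrow> 'e \<Rightarrow> 'e" where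
  "bch b x y = x + y + (1/2) *\<^sub>R b x y"

locale two_step_bracket =
  fixes br :: "'e::euclidean_space \<Rightarrow> 'e \<Rightarrow> 'e"
  assumes bilin: "bilinear br" and alt: "br x x = 0" and two_step: "br x (br y z) = 0"
begin

lemma br_simps:
  "br (x + y) z = br x z + br y z" "br x (y + z) = br x y + br x z"
  "br (x - y) z = br x z - br y z" "br x (y - z) = br x y - br x z"
  "br (c *\<^sub>R x) y = c *\<^sub>R br x y" "br x (c *\<^sub>R y) = c *\<^sub>R br x y"
  "br (- x) y = - br x y" "br x (- y) = - br x y" "br 0 x = 0" "br x 0 = 0"
  using bilin
  by (auto simp: bilinear_ladd bilinear_radd bilinear_lsub bilinear_rsub bilinear_lmul
      bilinear_rmul bilinear_lneg bilinear_rneg bilinear_lzero bilinear_rzero)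

lemma antisym: "br x y = - br y x"
proof -
  have "0 = br (x + y) (x + y)" by (simp only: alt)
  also have "\<dots> = (br x x + br x y) + (br y x + br y y)" by (simp only: br_simps ac_simps)
  finally have "br x y + br y x = 0" by (simp add: alt)
  thus ?thesis by (simp add: eq_neg_iff_add_eq_0)
qed

lemma two_step': "br (br x y) z = 0"
  using antisym[of "br x y" z] two_step by simp

lemma bounded: "bounded_bilinear br"
  using bilin bilinear_conv_bounded_bilinear by blast

end

text \<open>\<open>Q\<close> is a projection along a central subspace that contains all brackets. Such a map always
  exists in the two-step nilpotent case; it separates the part of the Maurer-Cartan form that is
  closed.\<close>
locale two_step_local_lie_group = local_lie_group +
  fixes Q :: "'a \<Rightarrow> 'a"
  assumes linear_Q: "linear Q" and Q_br: "Q (br u v) = 0" and br_Q: "br (Q u) v = br u v"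
begin

lemma br_br: "br u (br v w) = 0"
proof -
  have "br (br v w) u = br (Q (br v w)) u" by (rule br_Q[symmetric])
  also have "\<dots> = 0" by (simp add: Q_br bilinear_lzero[OF br_bilinear])
  finally show ?thesis by (simp add: br_antisym[of u])
qed

sublocale two_step_bracket br
  by unfold_locales (use br_bilinear br_antisym br_br in \<open>auto simp: br_def\<close>)

lemma Q_deriv:
  assumes "x \<in> I"
  shows "frechet_derivative (\<lambda>y. Q (\<theta> y v)) (at x) u = Q (frechet_derivative (\<lambda>y. \<theta> y v) (at x) u)"
  by (rule frechet_derivative_linear_compose)
     (use linear_Q smooth_on_has_derivative[OF \<theta>_smooth assms] in
       \<open>auto simp: linear_conv_bounded_linear differentiable_def\<close>)

lemma \<theta>_deriv: "x \<in> I \<Longrightarrow>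
    ((\<lambda>y. \<theta> y v) has_derivative frechet_derivative (\<lambda>y. \<theta> y v) (at x)) (at x)"
  by (rule smooth_on_has_derivative[OF \<theta>_smooth])

text \<open>The Maurer-Cartan form is integrated in two steps. Since \<open>Q\<close> kills brackets, \<open>Q \<circ> \<theta>\<close> is closed
  and has a primitive \<open>f\<close>. The correction \<open>(1/2) *\<^sub>R br f \<theta>\<close> then makes the whole form \<open>\<beta>\<close> closed, and
  its primitive \<open>F\<close> satisfies \<open>Q \<circ> F = f\<close>, so that \<open>f\<close> may be replaced by \<open>F\<close> under the bracket.
  The equation for \<open>F\<close> says that \<open>F\<close> pulls the Maurer-Cartan form of \<open>bch\<close> back to \<open>\<theta>\<close>; no ordinary
  differential equation has to be solved.\<close>
lemma developing_map:
  assumes B: "open B" "convex B" "e0 \<in> B" "B \<subseteq> I"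
  obtains F where "F e0 = 0"
    "\<And>x. x \<in> B \<Longrightarrow> (F has_derivative (\<lambda>v. \<theta> x v + (1/2) *\<^sub>R br (F x) (\<theta> x v))) (at x)"
proof -
  have bQ: "bounded_linear Q" using linear_Q by (simp add: linear_conv_bounded_linear)
  have BI: "x \<in> B \<Longrightarrow> x \<in> I" for x using B by blast
  have sm\<theta>: "smooth_on (\<lambda>x. \<theta> x v) B" for v by (rule smooth_on_subset[OF \<theta>_smooth B(4)])
  have smQ: "smooth_on (\<lambda>x. Q (\<theta> x v)) B" for v
    by (rule smooth_on_linear_compose[OF bQ B(1) sm\<theta>])
  obtain f where f: "f e0 = 0" "\<And>x. x \<in> B \<Longrightarrow> (f has_derivative (\<lambda>v. Q (\<theta> x v))) (at x)"
  proof (rule poincare_lemma_1_forms[OF B(1-3), of "\<lambda>x v. Q (\<theta> x v)"])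
    show "linear (\<lambda>v. Q (\<theta> x v))" if "x \<in> B" for x
      using linear_compose[OF \<theta>_linear[OF BI[OF that]] linear_Q] by (simp add: o_def)
    show "smooth_on (\<lambda>x. Q (\<theta> x v)) B" for v by (rule smQ)
    show "frechet_derivative (\<lambda>y. Q (\<theta> y v)) (at x) u = frechet_derivative (\<lambda>y. Q (\<theta> y u)) (at x) v"
      if "x \<in> B" for x u v
    proof -
      have "Q (frechet_derivative (\<lambda>y. \<theta> y v) (at x) u) - Q (frechet_derivative (\<lambda>y. \<theta> y u) (at x) v)
         = Q (- br (\<theta> x u) (\<theta> x v))"
        using maurer_cartan[OF BI[OF that], of v u] linear_diff[OF linear_Q] by metis
      thus ?thesis using Q_br linear_neg[OF linear_Q] by (simp add: Q_deriv[OF BI[OF that]])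
    qed
  qed blast
  have f_smooth: "smooth_on f B"
    by (rule smooth_on_bootstrap[OF B(1) f(2)]) (auto intro: smooth_onD smQ)
  define \<beta> where "\<beta> x v = \<theta> x v + (1/2) *\<^sub>R br (f x) (\<theta> x v)" for x v
  have \<beta>_smooth: "smooth_on (\<lambda>x. \<beta> x v) B" for v
    unfolding \<beta>_def
    by (intro smooth_on_add B(1) sm\<theta> smooth_on_linear_compose[OF bounded_linear_scaleR_right]
        smooth_on_bilinear[OF bounded] f_smooth)
  have \<beta>_deriv: "frechet_derivative (\<lambda>y. \<beta> y v) (at x) u
      = frechet_derivative (\<lambda>y. \<theta> y v) (at x) u
        + (1/2) *\<^sub>R (br (f x) (frechet_derivative (\<lambda>y. \<theta> y v) (at x) u) + br (\<theta> x u) (\<theta> x v))"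
    if "x \<in> B" for x u v
  proof -
    have "((\<lambda>y. \<beta> y v) has_derivative (\<lambda>u. frechet_derivative (\<lambda>y. \<theta> y v) (at x) u
        + (1/2) *\<^sub>R (br (f x) (frechet_derivative (\<lambda>y. \<theta> y v) (at x) u) + br (Q (\<theta> x u)) (\<theta> x v)))) (at x)"
      unfolding \<beta>_def
      by (intro has_derivative_add has_derivative_scaleR_right bounded_bilinear.FDERIV[OF bounded]
          \<theta>_deriv BI that f(2))
    hence "(\<lambda>u. frechet_derivative (\<lambda>y. \<theta> y v) (at x) u
        + (1/2) *\<^sub>R (br (f x) (frechet_derivative (\<lambda>y. \<theta> y v) (at x) u) + br (Q (\<theta> x u)) (\<theta> x v)))
       = frechet_derivative (\<lambda>y. \<beta> y v) (at x)" by (rule frechet_derivative_at)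
    from fun_cong[OF this, of u] show ?thesis by (simp add: br_Q)
  qed
  obtain F where F: "F e0 = 0" "\<And>x. x \<in> B \<Longrightarrow> (F has_derivative \<beta> x) (at x)"
  proof (rule poincare_lemma_1_forms[OF B(1-3), of \<beta>])
    show "linear (\<beta> x)" if "x \<in> B" for x
      using linear_add[OF \<theta>_linear[OF BI[OF that]]] linear_scale[OF \<theta>_linear[OF BI[OF that]]]
      by (intro linearI) (simp_all add: \<beta>_def br_simps algebra_simps)
    show "smooth_on (\<lambda>x. \<beta> x v) B" for v by (rule \<beta>_smooth)
    show "frechet_derivative (\<lambda>y. \<beta> y v) (at x) u = frechet_derivative (\<lambda>y. \<beta> y u) (at x) v"
      if "x \<in> B" for x u v
    proof -
      let ?a = "frechet_derivative (\<lambda>y. \<theta> y v) (at x) u" and ?b = "frechet_derivative (\<lambda>y. \<theta> y u) (at x) v"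
      have ab: "?a = ?b - br (\<theta> x u) (\<theta> x v)"
        using maurer_cartan[OF BI[OF that], of v u] by (simp add: algebra_simps)
      have "br (\<theta> x v) (\<theta> x u) = - br (\<theta> x u) (\<theta> x v)" by (rule antisym)
      moreover have "(1/2) *\<^sub>R z + (1/2) *\<^sub>R z = z" for z :: 'a
        by (simp add: scaleR_left_distrib[symmetric])
      ultimately show ?thesis unfolding \<beta>_deriv[OF that] ab
        by (simp add: br_simps two_step algebra_simps)
    qed
  qed blast
  have "((\<lambda>x. Q (F x) - f x) has_derivative (\<lambda>v. 0)) (at x within B)" if "x \<in> B" for x
  proof -
    have "((\<lambda>x. Q (F x) - f x) has_derivative (\<lambda>v. Q (\<beta> x v) - Q (\<theta> x v))) (at x)"
      by (intro has_derivative_diff bounded_linear.has_derivative[OF bQ] F f that)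
    moreover have "Q (\<beta> x v) - Q (\<theta> x v) = 0" for v
      by (simp add: \<beta>_def linear_add[OF linear_Q] linear_scale[OF linear_Q] Q_br)
    ultimately show ?thesis by (simp add: has_derivative_at_withinI)
  qed
  from has_derivative_zero_constant[OF B(2) this]
  obtain c where c: "\<And>x. x \<in> B \<Longrightarrow> Q (F x) - f x = c" by auto
  have "Q (F x) = f x" if "x \<in> B" for x
    using c[OF that] c[OF B(3)] F(1) f(1) linear_0[OF linear_Q] by simp
  hence "br (f x) v = br (F x) v" if "x \<in> B" for x v
    using that br_Q by metis
  hence "\<beta> x = (\<lambda>v. \<theta> x v + (1/2) *\<^sub>R br (F x) (\<theta> x v))" if "x \<in> B" for x
    using that by (auto simp: \<beta>_def)
  with F show ?thesis using that by metis
qed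

text \<open>For the difference of two solutions, first the \<open>Q\<close>-part has derivative zero; then the bracket
  with the difference vanishes, so the whole difference is constant.\<close>
lemma developing_map_unique:
  assumes C: "convex C" "c \<in> C" "C \<subseteq> I"
    and g: "\<And>x. x \<in> C \<Longrightarrow> (g has_derivative (\<lambda>v. \<theta> x v + (1/2) *\<^sub>R br (g x) (\<theta> x v))) (at x)"
    and h: "\<And>x. x \<in> C \<Longrightarrow> (h has_derivative (\<lambda>v. \<theta> x v + (1/2) *\<^sub>R br (h x) (\<theta> x v))) (at x)"
    and eq: "g c = h c" and x: "x \<in> C"
  shows "g x = h x"
proof -
  have bQ: "bounded_linear Q" using linear_Q by (simp add: linear_conv_bounded_linear)
  have d: "((\<lambda>x. g x - h x) has_derivative (\<lambda>v. (1/2) *\<^sub>R br (g x - h x) (\<theta> x v))) (at x)" if "x \<in> C" for x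
    using has_derivative_diff[OF g[OF that] h[OF that]]
    by (simp add: br_simps scaleR_diff_right algebra_simps)
  have "((\<lambda>x. Q (g x - h x)) has_derivative (\<lambda>v. 0)) (at x within C)" if "x \<in> C" for x
    using bounded_linear.has_derivative[OF bQ d[OF that]]
    by (simp add: linear_scale[OF linear_Q] Q_br has_derivative_at_withinI)
  from has_derivative_zero_constant[OF C(1) this]
  obtain k where k: "\<And>x. x \<in> C \<Longrightarrow> Q (g x - h x) = k" by auto
  have "Q (g x - h x) = 0" if "x \<in> C" for x
    using k[OF that] k[OF C(2)] eq linear_0[OF linear_Q] by simp
  hence "br (g x - h x) v = 0" if "x \<in> C" for x v
    using that br_Q[of "g x - h x" v] br_simps(9) by simp
  hence "((\<lambda>x. g x - h x) has_derivative (\<lambda>v. 0)) (at x within C)" if "x \<in> C" for x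
    using d[OF that] that by (simp add: has_derivative_at_withinI)
  from has_derivative_zero_constant[OF C(1) this]
  obtain l where l: "\<And>x. x \<in> C \<Longrightarrow> g x - h x = l" by auto
  show ?thesis using l[OF x] l[OF C(2)] eq by simp
qed

text \<open>Both \<open>\<lambda>y. F (m (x, y))\<close> and \<open>\<lambda>y. bch br (F x) (F y)\<close> solve the developing equation and agree
  at \<open>e0\<close>, so \<open>F\<close> is a local homomorphism. Its differential at \<open>e0\<close> is the identity, and the derivative
  of the local inverse is a smooth expression in that inverse, so the inverse is smooth too.\<close>
lemma local_chart:
  obtains U V F P where "open U" "e0 \<in> U" "U \<subseteq> I" "open V" "0 \<in> V" "homeomorphism U V F P"
    "F e0 = 0" "smooth_on F U" "smooth_on P V"
    "\<And>x y. \<lbrakk>x \<in> U; y \<in> U; (x, y) \<in> D; m (x, y) \<in> U\<rbrakk> \<Longrightarrow> F (m (x, y)) = bch br (F x) (F y)"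
proof -
  obtain r where r: "r > 0" "ball e0 r \<subseteq> I" using open_I e0_I open_contains_ball by blast
  let ?B = "ball e0 r"
  have e0B: "e0 \<in> ?B" using r by simp
  obtain F where F: "F e0 = 0"
    "\<And>x. x \<in> ?B \<Longrightarrow> (F has_derivative (\<lambda>v. \<theta> x v + (1/2) *\<^sub>R br (F x) (\<theta> x v))) (at x)"
    using developing_map[OF open_ball convex_ball e0B r(2)] by blast
  have F_smooth: "smooth_on F ?B"
  proof (rule smooth_on_bootstrap[OF open_ball F(2)])
    fix k v assume "ck_on k F ?B"
    moreover have "ck_on k (\<lambda>x. \<theta> x v) ?B"
      using smooth_onD[OF smooth_on_subset[OF \<theta>_smooth r(2)]] .
    ultimately show "ck_on k (\<lambda>x. \<theta> x v + (1/2) *\<^sub>R br (F x) (\<theta> x v)) ?B"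
      by (intro ck_on_add open_ball ck_on_linear_compose[OF bounded_linear_scaleR_right]
          ck_on_bilinear[OF bounded])
  qed
  define N where "N = D \<inter> m -` ?B"
  have "open N"
    unfolding N_def using continuous_open_preimage[OF smooth_on_continuous[OF smooth_m] open_D open_ball] .
  moreover have "(e0, e0) \<in> N"
    using right_one[OF e0_W] e0B by (simp add: N_def)
  ultimately obtain A A' where A: "open A" "open A'" "(e0, e0) \<in> A \<times> A'" "A \<times> A' \<subseteq> N"
    by (metis open_prod_elim)
  have "open (A \<inter> A' \<inter> ?B)" "e0 \<in> A \<inter> A' \<inter> ?B" using A e0B by auto
  then obtain s where s: "s > 0" "ball e0 s \<subseteq> A \<inter> A' \<inter> ?B" using open_contains_ball by blast
  let ?C = "ball e0 s"
  have CB: "?C \<subseteq> ?B" using s by blast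
  have CI: "?C \<subseteq> I" using CB r by blast
  have CN: "(x, y) \<in> D" "m (x, y) \<in> ?B" if "x \<in> ?C" "y \<in> ?C" for x y
  proof -
    have "(x, y) \<in> A \<times> A'" using that s(2) by blast
    hence "(x, y) \<in> N" using A(4) by blast
    thus "(x, y) \<in> D" "m (x, y) \<in> ?B" by (auto simp: N_def)
  qed
  have hom: "F (m (x, y)) = bch br (F x) (F y)" if x: "x \<in> ?C" and y: "y \<in> ?C" for x y
  proof (rule developing_map_unique[OF convex_ball _ CI _ _ _ y, of e0 "\<lambda>y. F (m (x, y))" "\<lambda>y. bch br (F x) (F y)"])
    show "e0 \<in> ?C" using s(1) by simp
    show "F (m (x, e0)) = bch br (F x) (F e0)"
    proof -
      have "x \<in> W" using x CI I_W by blast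
      thus ?thesis by (simp add: right_one(2) F(1) bch_def br_simps)
    qed
  next
    fix y assume y: "y \<in> ?C"
    have D: "(x, y) \<in> D" and mB: "m (x, y) \<in> ?B" using CN[OF x y] .
    have yI: "y \<in> I" and mI: "m (x, y) \<in> I" using y mB CI r by auto
    have T: "\<theta> (m (x, y)) (dL x y v) = \<theta> y v" for v
      using X_equivariant[OF D, of "\<theta> y v"] X_\<theta>[OF yI, of v] \<theta>_X[OF mI] yI I_W by auto
    show "((\<lambda>y. F (m (x, y))) has_derivative
        (\<lambda>v. \<theta> y v + (1/2) *\<^sub>R br (F (m (x, y))) (\<theta> y v))) (at y)"
      using has_derivative_compose[where f = "\<lambda>y. m (x, y)" and g = F, OF m_deriv[OF D] F(2)[OF mB]]
      by (simp add: T)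
    have "((\<lambda>y. bch br (F x) (F y)) has_derivative (\<lambda>v. (\<theta> y v + (1/2) *\<^sub>R br (F y) (\<theta> y v))
        + (1/2) *\<^sub>R br (F x) (\<theta> y v + (1/2) *\<^sub>R br (F y) (\<theta> y v)))) (at y)"
      unfolding bch_def
      using F(2)[of y] y CB
      by (auto intro!: derivative_eq_intros bounded_bilinear.bounded_linear_right[OF bounded]
          bounded_linear.has_derivative[OF bounded_bilinear.bounded_linear_right[OF bounded]])
    thus "((\<lambda>y. bch br (F x) (F y)) has_derivative (\<lambda>v. \<theta> y v + (1/2) *\<^sub>R br (bch br (F x) (F y)) (\<theta> y v))) (at y)"
      by (simp add: bch_def br_simps two_step two_step' scaleR_add_right algebra_simps)
  qed
  define F' where "F' x = Blinfun (\<lambda>v. \<theta> x v + (1/2) *\<^sub>R br (F x) (\<theta> x v))" for x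
  have F': "blinfun_apply (F' x) = (\<lambda>v. \<theta> x v + (1/2) *\<^sub>R br (F x) (\<theta> x v))" if "x \<in> ?B" for x
    unfolding F'_def by (rule bounded_linear_Blinfun_apply[OF has_derivative_bounded_linear[OF F(2)[OF that]]])
  have F'C: "(F has_derivative blinfun_apply (F' x)) (at x)" if "x \<in> ?C" for x
    using F(2) F' CB that by (metis subsetD)
  have contF': "continuous_on ?C F'"
  proof (rule continuous_on_blinfun_componentwise)
    fix v
    have "continuous_on ?C F" "continuous_on ?C (\<lambda>x. \<theta> x v)"
      using smooth_on_continuous[OF smooth_on_subset[OF F_smooth CB]]
        smooth_on_continuous[OF smooth_on_subset[OF \<theta>_smooth CI]] by auto
    hence "continuous_on ?C (\<lambda>x. \<theta> x v + (1/2) *\<^sub>R br (F x) (\<theta> x v))"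
      by (intro continuous_intros bounded_bilinear.continuous_on[OF bounded])
    thus "continuous_on ?C (\<lambda>x. blinfun_apply (F' x) v)"
      by (rule continuous_on_eq) (use F' CB in auto)
  qed
  have id: "id_blinfun o\<^sub>L F' e0 = id_blinfun"
    using \<theta>_X[OF e0_I] by (intro blinfun_eqI) (simp add: F'[OF e0B] F(1) br_simps X_e0)
  have e0C: "e0 \<in> ?C" using s by simp
  obtain U V P g' where U: "open U" "U \<subseteq> ?C" "e0 \<in> U" "open V" "F e0 \<in> V" "homeomorphism U V F P"
    "\<And>y. y \<in> V \<Longrightarrow> (P has_derivative (g' y)) (at y)"
    "\<And>y. y \<in> V \<Longrightarrow> g' y = inv_into UNIV (blinfun_apply (F' (P y)))"
    "\<And>y. y \<in> V \<Longrightarrow> bij (blinfun_apply (F' (P y)))"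
    using inverse_function_theorem[OF open_ball F'C contF' e0C id] by blast
  have PU: "P z \<in> U" "F (P z) = z" if "z \<in> V" for z
    using U(6) that by (auto simp: homeomorphism_def)
  have g': "g' z w = X (w - (1/2) *\<^sub>R br z w) (P z)" if "z \<in> V" for z w
  proof -
    have PB: "P z \<in> ?B" "P z \<in> I" using PU[OF that] U(2) CB CI by auto
    have "blinfun_apply (F' (P z)) (X (w - (1/2) *\<^sub>R br z w) (P z)) = w"
      using PU[OF that] by (simp add: F'[OF PB(1)] \<theta>_X[OF PB(2)] br_simps two_step)
    thus ?thesis unfolding U(8)[OF that] using inv_f_eq[OF bij_is_inj[OF U(9)[OF that]]] by blast
  qed
  have "smooth_on P V"
  proof (rule smooth_on_bootstrap[OF U(4,7)])
    fix k w assume k: "ck_on k P V"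
    have UW: "U \<subseteq> W" using U(2) CI I_W by blast
    show "ck_on k (\<lambda>z. g' z w) V"
    proof (rule ck_on_cong[OF U(4)])
      show "X (w - (1/2) *\<^sub>R br z w) (P z) = g' z w" if "z \<in> V" for z using g'[OF that] by simp
      have "ck_on k (\<lambda>z. w + br (- (1/2) *\<^sub>R z) w) V"
        by (intro ck_on_add U(4) ck_on_const ck_on_linear
            bounded_linear_compose[OF bounded_bilinear.bounded_linear_left[OF bounded]]
            bounded_linear_scaleR_right)
      hence w: "ck_on k (\<lambda>z. w - (1/2) *\<^sub>R br z w) V" by (simp add: br_simps)
      show "ck_on k (\<lambda>z. X (w - (1/2) *\<^sub>R br z w) (P z)) V"
      proof (rule ck_on_linear_family[OF U(4) _ _ w, of "\<lambda>z v. X v (P z)"])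
        show "linear (\<lambda>v. X v (P z))" if "z \<in> V" for z
          using X_linear PU(1)[OF that] UW by blast
        show "ck_on k (\<lambda>z. X v (P z)) V" for v
          by (rule ck_on_compose[OF U(4) open_W _ smooth_onD[OF X_smooth] k]) (use PU UW in auto)
      qed
    qed
  qed
  moreover have "smooth_on F U" using smooth_on_subset[OF F_smooth] U(2) CB by blast
  moreover have "F (m (x, y)) = bch br (F x) (F y)" if "x \<in> U" "y \<in> U" for x y
    using hom that U(2) by blast
  ultimately show ?thesis
    using that[OF U(1,3) _ U(4) _ U(6) F(1)] U(2,5) CI F(1) by auto
qed

end

section \<open>Nilpotent Lie algebras with integrable quaternionic contact structure\<close>

text \<open>This is \<open>Im (q cnj p)\<close> for quaternions; its three components are
  \<open>e12 + e34\<close>, \<open>e13 + e42\<close> and \<open>e14 + e23\<close>.\<close>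
definition Om :: "quat \<Rightarrow> quat \<Rightarrow> real^3" where
  "Om p q = fst p *\<^sub>R snd q - fst q *\<^sub>R snd p + cross3 (snd p) (snd q)"

lemma Om_simps [simp]: "Om 0 q = 0" "Om p 0 = 0" "Om p p = 0"
  "Om (c *\<^sub>R p) q = c *\<^sub>R Om p q" "Om p (c *\<^sub>R q) = c *\<^sub>R Om p q"
  by (simp_all add: Om_def cross_mult_left cross_mult_right algebra_simps)

lemma Om_skew: "Om q p = - Om p q"
  using cross_skew[of "snd p" "snd q"] by (simp add: Om_def)

text \<open>For a nonzero \<open>v\<close> the form \<open>v \<bullet> Om p q\<close> is the symplectic form of the complex structure
  given by \<open>v\<close>, up to a factor; every nonzero combination of the three forms is nondegenerate.\<close>
lemma Om_nondegenerate:
  assumes "v \<noteq> 0" and *: "\<And>p. v \<bullet> Om p q = 0" shows "q = 0"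
proof -
  obtain b B where q: "q = (b, B)" by fastforce
  have vB: "v \<bullet> B = 0" using *[of "(1, 0)"] by (simp add: q Om_def)
  have "b * (v \<bullet> v) = 0"
    using *[of "(0, v)"] by (simp add: q Om_def inner_diff_right inner_add_right dot_cross_self)
  hence b: "b = 0" using assms(1) by simp
  let ?w = "cross3 B v"
  have "v \<bullet> cross3 ?w B = 0" using *[of "(0, ?w)"] by (simp add: q b Om_def)
  hence "?w \<bullet> ?w = 0" using cross_triple[of ?w B v] by (simp add: inner_commute)
  hence "cross3 B v = 0" by simp
  moreover have "B \<bullet> v = 0" using vB by (simp add: inner_commute)
  ultimately have "B = 0" using norm_and_cross_eq_0[of B v] assms(1) by simp
  thus ?thesis by (simp add: q b zero_prod_def)
qed

text \<open>\<open>Im (p cnj q) = 0\<close> says that \<open>p\<close> is a real multiple of \<open>q\<close>.\<close>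
lemma Om_eq_0_imp_parallel:
  assumes "q \<noteq> 0" and *: "Om q p = 0" obtains c where "p = c *\<^sub>R q"
proof -
  obtain b B where q: "q = (b, B)" by fastforce
  obtain a A where p: "p = (a, A)" by fastforce
  have E: "b *\<^sub>R A - a *\<^sub>R B + cross3 B A = 0" using * by (simp add: q p Om_def)
  show ?thesis
  proof (cases "b = 0")
    case False
    have "cross3 B A \<bullet> (b *\<^sub>R A - a *\<^sub>R B + cross3 B A) = cross3 B A \<bullet> cross3 B A"
      by (simp add: inner_diff_right inner_add_right dot_cross_self inner_commute)
    hence "cross3 B A = 0" using E by simp
    with E have "b *\<^sub>R A = a *\<^sub>R B" by simp
    hence "(1/b) *\<^sub>R (b *\<^sub>R A) = (1/b) *\<^sub>R (a *\<^sub>R B)" by simp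
    hence "A = (a/b) *\<^sub>R B" using False by simp
    thus ?thesis using that[of "a / b"] False by (simp add: q p)
  next
    case True
    hence B: "B \<noteq> 0" using assms(1) by (simp add: q zero_prod_def)
    have E': "cross3 B A = a *\<^sub>R B" using E True by simp
    have "B \<bullet> cross3 B A = 0" by (simp add: dot_cross_self)
    hence "a * (B \<bullet> B) = 0" by (simp only: E' inner_scaleR_right)
    hence a: "a = 0" using B by simp
    hence "cross3 B (cross3 B A) = 0" using E' by simp
    hence "(B \<bullet> B) *\<^sub>R A = (B \<bullet> A) *\<^sub>R B" by (simp add: Lagrange)
    hence "(1 / (B \<bullet> B)) *\<^sub>R ((B \<bullet> B) *\<^sub>R A) = (1 / (B \<bullet> B)) *\<^sub>R ((B \<bullet> A) *\<^sub>R B)" by simp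
    hence "A = ((B \<bullet> A) / (B \<bullet> B)) *\<^sub>R B" using B by simp
    thus ?thesis using that[of "(B \<bullet> A) / (B \<bullet> B)"] True a by (simp add: q p)
  qed
qed

text \<open>The solution is \<open>n q / norm q ^ 2\<close>, with \<open>n\<close> read as an imaginary quaternion.\<close>
lemma Om_surj:
  assumes "q \<noteq> 0" obtains r where "Om q r = n"
proof -
  obtain b B where q: "q = (b, B)" by fastforce
  define N where "N = b * b + B \<bullet> B"
  have N: "N \<noteq> 0" using assms unfolding N_def q
    by (metis add_nonneg_eq_0_iff inner_eq_zero_iff inner_ge_zero mult_eq_0_iff zero_le_square zero_prod_def)
  have "Om q (- (n \<bullet> B), b *\<^sub>R n + cross3 n B) = N *\<^sub>R n"
    using cross_skew[of B n]
    by (simp add: q Om_def N_def cross_add_right cross_mult_right Lagrange inner_commute algebra_simps)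
  hence "Om q ((1 / N) *\<^sub>R (- (n \<bullet> B), b *\<^sub>R n + cross3 n B)) = n"
    using N by (simp only: Om_simps) simp
  thus ?thesis using that by blast
qed

lemma exists_orthogonal_to_two:
  fixes a b :: "real^3" obtains v where "v \<noteq> 0" "v \<bullet> a = 0" "v \<bullet> b = 0"
proof -
  have "dim {a, b} \<le> card {a, b}" by (rule dim_le_card') simp
  also have "\<dots> \<le> 2" by (simp add: card_insert_if)
  finally have "dim {a, b} < DIM(real^3)" by simp
  then obtain v where "v \<noteq> 0" "\<And>y. y \<in> span {a, b} \<Longrightarrow> orthogonal v y"
    using orthogonal_to_subspace_exists by blast
  thus ?thesis using that by (auto simp: orthogonal_def span_base)
qed

text \<open>The last term of the lower central series that is not inside \<open>J\<close> provides the element.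
  It is a central element for \<open>J = {0}\<close> and central modulo \<open>J\<close> for larger \<open>J\<close>.\<close>
lemma nilpotent_central_mod:
  assumes "nilpotent_bracket br" "J \<noteq> UNIV" "0 \<in> J"
  obtains z where "z \<notin> J" "\<And>x. br x z \<in> J"
proof -
  obtain n where "lower_central br n = {0}" using assms(1) by (auto simp: nilpotent_bracket_def)
  hence "lower_central br n \<subseteq> J" using assms(3) by simp
  moreover have "\<not> lower_central br 0 \<subseteq> J" using assms(2) by auto
  ultimately obtain k where k: "\<not> lower_central br k \<subseteq> J" "lower_central br (Suc k) \<subseteq> J"
    using ex_least_nat_less[of "\<lambda>k. lower_central br k \<subseteq> J" n] by blast
  then obtain z where "z \<in> lower_central br k" "z \<notin> J" by blast
  moreover have "br x z \<in> lower_central br (Suc k)" for x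
    using \<open>z \<in> lower_central br k\<close> by (auto intro: span_base)
  ultimately show ?thesis using that k(2) by blast
qed

text \<open>\<open>H\<close> collects \<open>e1, ..., e4\<close> into a quaternion, \<open>V\<close> collects \<open>e5, e6, e7\<close> and \<open>f\<close> collects
  \<open>f1, f2, f3\<close>. In vector notation the three structure equations are one formula for \<open>V (br x y)\<close>,
  in which the terms with \<open>f\<close> become cross products and \<open>T\<close> is the unspecified part in the span of
  \<open>e56, e57, e67\<close>. Call \<open>x\<close> horizontal if \<open>V x = 0\<close> and vertical if \<open>H x = 0\<close>.
  The differentials of \<open>e1, ..., e4\<close> are not prescribed, so \<open>H (br x y)\<close> is arbitrary here;
  nilpotency and the Jacobi identity will force it to vanish.\<close>
locale nilpotent_qc_algebra =
  fixes br :: "'e::euclidean_space \<Rightarrow> 'e \<Rightarrow> 'e"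
    and H :: "'e \<Rightarrow> quat" and V :: "'e \<Rightarrow> real^3" and f :: "'e \<Rightarrow> real^3"
    and T :: "real^3 \<Rightarrow> real^3 \<Rightarrow> real^3"
  assumes bilin: "bilinear br" and antisym: "br x y = - br y x"
    and jacobi: "br x (br y z) + br y (br z x) + br z (br x y) = 0"
    and nilp: "nilpotent_bracket br"
    and linear_H: "linear H" and linear_V: "linear V"
    and inj: "\<lbrakk>H x = 0; V x = 0\<rbrakk> \<Longrightarrow> x = 0"
    and surj: "\<exists>x. H x = p \<and> V x = v"
    and f_horizontal: "H x = H y \<Longrightarrow> f x = f y"
    and T_zero: "T 0 v = 0" "T v 0 = 0"
    and vertical_bracket: "V (br x y) = - (Om (H x) (H y) + cross3 (f x) (V y) - cross3 (f y) (V x) + T (V x) (V y))"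
begin

lemmas br_simps = bilinear_ladd[OF bilin] bilinear_radd[OF bilin] bilinear_lsub[OF bilin]
  bilinear_rsub[OF bilin] bilinear_lmul[OF bilin] bilinear_rmul[OF bilin]
  bilinear_lneg[OF bilin] bilinear_rneg[OF bilin] bilinear_lzero[OF bilin] bilinear_rzero[OF bilin]

lemmas HV_simps = linear_add[OF linear_H] linear_add[OF linear_V] linear_diff[OF linear_H]
  linear_diff[OF linear_V] linear_scale[OF linear_H] linear_scale[OF linear_V]
  linear_neg[OF linear_H] linear_neg[OF linear_V] linear_0[OF linear_H] linear_0[OF linear_V]

lemma vertical_bracket_hor: "V x = 0 \<Longrightarrow> V (br x y) = - (Om (H x) (H y) + cross3 (f x) (V y))"
  using vertical_bracket[of x y] T_zero by simp

text \<open>The basic step: a direction \<open>v\<close> that is orthogonal both to the vertical part of \<open>br x z\<close> and to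
  the \<open>f\<close>-term leaves \<open>v \<bullet> Om p (H z) = 0\<close> for all \<open>p\<close>.\<close>
lemma vertical_if:
  assumes "v \<noteq> 0" and "\<And>x. V x = 0 \<Longrightarrow> v \<bullet> V (br x z) = 0"
    and "\<And>x. V x = 0 \<Longrightarrow> v \<bullet> cross3 (f x) (V z) = 0"
  shows "H z = 0"
proof (rule Om_nondegenerate[OF assms(1)])
  fix p
  obtain x where x: "H x = p" "V x = 0" using surj by blast
  show "v \<bullet> Om p (H z) = 0"
    using assms(2,3)[OF x(2)] vertical_bracket_hor[OF x(2), of z] x(1)
    by (simp add: inner_diff_right)
qed

text \<open>A central \<open>z\<close> is vertical, and then \<open>f x\<close> is a multiple of \<open>V z\<close> for every horizontal \<open>x\<close>.
  An element \<open>w\<close> that is central modulo \<open>z\<close> is vertical as well, and the structure equation reads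
  \<open>l x *\<^sub>R V z = - (c x *\<^sub>R cross3 (V z) (V w))\<close>. The two sides are orthogonal, so both vanish.\<close>
lemma f_zero: "f x = 0"
proof -
  have "{0} \<noteq> (UNIV :: 'e set)"
  proof
    assume *: "{0} = (UNIV :: 'e set)"
    obtain u where "H u = (1, 0)" using surj by blast
    moreover have "u = 0" using * by blast
    ultimately show False by (simp add: HV_simps zero_prod_def)
  qed
  then obtain z where z: "z \<noteq> 0" "\<And>x. br x z = 0"
    using nilpotent_central_mod[OF nilp, of "{0}"] by (metis singleton_iff)
  have Vz: "V z \<noteq> 0"
  proof
    assume "V z = 0"
    hence "H z = 0"
      by (intro vertical_if[of "axis 1 1"]) (simp_all add: z HV_simps axis_eq_0_iff)
    with \<open>V z = 0\<close> show False using inj z(1) by blast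
  qed
  have Hz: "H z = 0"
    by (rule vertical_if[OF Vz]) (simp_all add: z HV_simps dot_cross_self)
  have "\<exists>c. f x = c *\<^sub>R V z" if "V x = 0" for x
  proof -
    have "cross3 (f x) (V z) = 0" using vertical_bracket_hor[OF that, of z] by (simp add: z Hz HV_simps)
    hence "cross3 (V z) (cross3 (f x) (V z)) = 0" by simp
    hence "(V z \<bullet> V z) *\<^sub>R f x = (V z \<bullet> f x) *\<^sub>R V z" by (simp add: Lagrange)
    hence "(1 / (V z \<bullet> V z)) *\<^sub>R ((V z \<bullet> V z) *\<^sub>R f x) = (1 / (V z \<bullet> V z)) *\<^sub>R ((V z \<bullet> f x) *\<^sub>R V z)"
      by simp
    thus ?thesis using Vz by auto
  qed
  then obtain c where c: "\<And>x. V x = 0 \<Longrightarrow> f x = c x *\<^sub>R V z" by metis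
  have "H u = 0" if "u \<in> span {z}" for u
    using that Hz by (auto simp: span_singleton HV_simps)
  moreover obtain u where "H u = (1, 0)" using surj by blast
  ultimately have "span {z} \<noteq> UNIV" by (metis UNIV_I zero_neq_one zero_prod_def fst_conv)
  then obtain w where w: "w \<notin> span {z}" "\<And>x. br x w \<in> span {z}"
    using nilpotent_central_mod[OF nilp _ span_zero] by metis
  have "\<exists>l. br x w = l *\<^sub>R z" for x using w(2)[of x] by (auto simp: span_singleton)
  then obtain l where l: "\<And>x. br x w = l x *\<^sub>R z" by metis
  let ?n = "cross3 (V z) (V w)"
  obtain v where v: "v \<noteq> 0" "v \<bullet> V z = 0" "v \<bullet> ?n = 0" by (rule exists_orthogonal_to_two)
  have Hw: "H w = 0"
    by (rule vertical_if[OF v(1)]) (simp_all add: l HV_simps c cross_mult_left v)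
  have n: "?n \<noteq> 0"
  proof
    assume "?n = 0"
    hence "cross3 (V z) (cross3 (V z) (V w)) = 0" by simp
    hence "(V z \<bullet> V w) *\<^sub>R V z = (V z \<bullet> V z) *\<^sub>R V w" by (simp add: Lagrange)
    hence "(1 / (V z \<bullet> V z)) *\<^sub>R ((V z \<bullet> V w) *\<^sub>R V z) = (1 / (V z \<bullet> V z)) *\<^sub>R ((V z \<bullet> V z) *\<^sub>R V w)"
      by simp
    hence "V (w - ((V z \<bullet> V w) / (V z \<bullet> V z)) *\<^sub>R z) = 0" using Vz by (simp add: HV_simps)
    hence "w = ((V z \<bullet> V w) / (V z \<bullet> V z)) *\<^sub>R z"
      using inj[of "w - ((V z \<bullet> V w) / (V z \<bullet> V z)) *\<^sub>R z"] by (simp add: HV_simps Hw Hz)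
    thus False using w(1) by (metis span_base span_scale insertI1)
  qed
  have hor: "f x = 0" if "V x = 0" for x
  proof -
    have "l x *\<^sub>R V z = - (c x *\<^sub>R ?n)"
      using vertical_bracket_hor[OF that, of w] by (simp add: l Hw HV_simps c[OF that] cross_mult_left)
    hence "?n \<bullet> (l x *\<^sub>R V z) = ?n \<bullet> (- (c x *\<^sub>R ?n))" by simp
    hence "c x * (?n \<bullet> ?n) = 0"
      by (simp add: dot_cross_self inner_commute[of ?n "V z"])
    hence "c x = 0" using n by simp
    thus ?thesis using c[OF that] by simp
  qed
  obtain y where "H y = H x" "V y = 0" using surj by blast
  thus ?thesis using hor f_horizontal by metis
qed

text \<open>The vertical elements that commute with all horizontal ones form a subspace \<open>K\<close>. If it were
  too small, some \<open>v\<close> would be orthogonal to \<open>V ` K\<close>; an element that is central modulo \<open>K\<close> would then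
  be vertical and have brackets without vertical part, hence lie in \<open>K\<close> itself.\<close>
lemma br_hor_ver:
  assumes "V x = 0" "H y = 0" shows "br x y = 0"
proof -
  define K where "K = {y. H y = 0 \<and> (\<forall>x. V x = 0 \<longrightarrow> br x y = 0)}"
  have subK: "subspace K"
    by (auto simp: subspace_def K_def HV_simps br_simps)
  have subVK: "subspace (V ` K)" by (rule linear_subspace_image[OF linear_V subK])
  have "V ` K = UNIV"
  proof (rule ccontr)
    assume "V ` K \<noteq> UNIV"
    hence "span (V ` K) \<noteq> UNIV" using span_eq_iff subVK by metis
    then obtain v where v: "v \<noteq> 0" "\<And>y. y \<in> K \<Longrightarrow> v \<bullet> V y = 0"
      using span_not_UNIV_orthogonal by (metis imageI span_base)
    have "K \<noteq> UNIV" using \<open>V ` K \<noteq> UNIV\<close> surj by (metis UNIV_I surj_def)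
    then obtain y where y: "y \<notin> K" "\<And>x. br x y \<in> K"
      using nilpotent_central_mod[OF nilp _ subspace_0[OF subK]] by metis
    have Hy: "H y = 0"
      by (rule vertical_if[OF v(1)]) (simp_all add: f_zero v(2) y(2))
    have "br x y = 0" if "V x = 0" for x
      using inj[of "br x y"] y(2)[of x] vertical_bracket_hor[OF that, of y] by (simp add: K_def Hy f_zero)
    thus False using y(1) Hy by (simp add: K_def)
  qed
  then obtain y' where y': "y' \<in> K" "V y' = V y" by (metis UNIV_I imageE)
  have "y' = y" using inj[of "y' - y"] y' assms(2) by (simp add: HV_simps K_def)
  thus ?thesis using y'(1) assms(1) by (simp add: K_def)
qed

text \<open>Since \<open>Om\<close> is onto, every element is a bracket of horizontal elements plus a horizontal
  element. The latter commutes with vertical elements, and the former does so by the Jacobi identity.\<close>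
lemma ver_central:
  assumes "H y = 0" shows "br u y = 0"
proof -
  obtain x where x: "H x = (1, 0)" "V x = 0" using surj by blast
  obtain x' where x': "H x' = (0, - V u)" "V x' = 0" using surj by blast
  let ?h = "u - br x x'"
  have "V (br x x') = V u" using vertical_bracket_hor[OF x(2), of x'] by (simp add: x x' f_zero Om_def)
  hence "br ?h y = 0" by (intro br_hor_ver assms) (simp add: HV_simps)
  moreover have "br y (br x x') = 0"
    using jacobi[of x x' y] antisym[of y x] br_hor_ver[OF x(2) assms] br_hor_ver[OF x'(2) assms]
    by (simp add: br_simps)
  ultimately show ?thesis using antisym[of y "br x x'"] by (simp add: br_simps)
qed

lemma V_br: "V (br x y) = - Om (H x) (H y)"
proof -
  obtain x' where x': "H x' = H x" "V x' = 0" using surj by blast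
  have "br y (x - x') = 0" by (rule ver_central) (simp add: HV_simps x')
  hence "br x y = br x' y" using antisym[of x y] antisym[of x' y] by (simp add: br_simps)
  thus ?thesis using vertical_bracket_hor[OF x'(2), of y] by (simp add: x' f_zero)
qed

text \<open>Modulo the vertical centre there remains a four-dimensional nilpotent algebra on which the
  three forms \<open>Om\<close> are closed (the fact \<open>jac\<close>). For an element \<open>w\<close> that is central there, closedness
  gives \<open>Om (H w) (H (br x z)) = 0\<close>, so all brackets are multiples of \<open>H w\<close>. Closedness once more, tested
  on a third vector \<open>z\<close> for which \<open>Om (H w) (H z)\<close> is orthogonal to the other two values, kills the factor.\<close>
lemma H_br: "H (br x y) = 0"
proof -
  have "{x. H x = 0} \<noteq> UNIV"
  proof -
    obtain u where "H u = (1, 0)" using surj by blast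
    hence "u \<notin> {x. H x = 0}" by (simp add: zero_prod_def)
    thus ?thesis by blast
  qed
  then obtain w where w: "H w \<noteq> 0" "\<And>x. H (br x w) = 0"
    using nilpotent_central_mod[OF nilp, of "{x. H x = 0}"] by (auto simp: HV_simps)
  let ?q = "H w"
  have jac: "Om (H x) (H (br y z)) + Om (H y) (H (br z x)) + Om (H z) (H (br x y)) = 0" for x y z
  proof -
    have "V (br x (br y z) + br y (br z x) + br z (br x y)) = 0" by (simp only: jacobi HV_simps)
    hence "- (Om (H x) (H (br y z)) + Om (H y) (H (br z x)) + Om (H z) (H (br x y))) = 0"
      by (simp add: HV_simps V_br)
    thus ?thesis by (simp only: neg_equal_0_iff_equal)
  qed
  have w': "H (br w x) = 0" for x using w(2)[of x] antisym[of w x] by (simp add: HV_simps)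
  have "\<exists>c. H (br x z) = c *\<^sub>R ?q" for x z
  proof -
    have "Om ?q (H (br x z)) = 0" using jac[of w x z] by (simp add: w w')
    from Om_eq_0_imp_parallel[OF w(1) this] show ?thesis by metis
  qed
  then obtain \<beta> where \<beta>: "\<And>x z. H (br x z) = \<beta> x z *\<^sub>R ?q" by metis
  obtain n where n: "n \<noteq> 0" "n \<bullet> Om ?q (H x) = 0" "n \<bullet> Om ?q (H y) = 0"
    by (rule exists_orthogonal_to_two)
  obtain r where r: "Om ?q r = n" by (rule Om_surj[OF w(1)])
  obtain z where z: "H z = r" using surj by blast
  have "n \<bullet> (Om ?q (H x)) * \<beta> y z + n \<bullet> (Om ?q (H y)) * \<beta> z x + n \<bullet> (Om ?q (H z)) * \<beta> x y = 0"
    using arg_cong[OF jac[of x y z], of "\<lambda>v. n \<bullet> v"]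
    by (simp add: \<beta> inner_add_right Om_skew[of ?q] algebra_simps)
  hence "\<beta> x y = 0" using n by (simp add: r z)
  thus ?thesis by (simp add: \<beta>)
qed

end

section \<open>Extension of a local homomorphism by taking roots\<close>

lemma (in two_step_bracket) bch_zero [simp]: "bch br x 0 = x" "bch br 0 x = x"
  by (simp_all add: bch_def br_simps)

lemma (in two_step_bracket) bch_parallel: "bch br (a *\<^sub>R x) (b *\<^sub>R x) = (a + b) *\<^sub>R x"
  by (simp add: bch_def br_simps alt scaleR_left_distrib)

locale local_bch_hom = group G + two_step_bracket br
  for G :: "'g monoid" (structure) and br :: "'a::euclidean_space \<Rightarrow> 'a \<Rightarrow> 'a" +
  fixes P :: "'a \<Rightarrow> 'g" and \<epsilon> :: real
  assumes eps: "\<epsilon> > 0" and P_closed [simp]: "P x \<in> carrier G"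
    and P_mult: "\<lbrakk>norm x < \<epsilon>; norm y < \<epsilon>\<rbrakk> \<Longrightarrow> P x \<otimes> P y = P (bch br x y)"
begin

lemma P_zero: "P 0 = \<one>"
  using P_mult[of 0 0] eps by (simp add: l_cancel_one)

lemma P_pow: "norm (real k *\<^sub>R x) < \<epsilon> \<Longrightarrow> P (real k *\<^sub>R x) = P x [^] k"
proof (induction k)
  case 0
  then show ?case by (simp add: P_zero)
next
  case (Suc k)
  have "real (Suc k) * norm x < \<epsilon>" using Suc.prems by simp
  moreover have "real k * norm x \<le> real (Suc k) * norm x" "1 * norm x \<le> real (Suc k) * norm x"
    by (intro mult_right_mono; simp)+
  ultimately have n: "norm (real k *\<^sub>R x) < \<epsilon>" "norm x < \<epsilon>" by auto
  have "P x [^] Suc k = P (real k *\<^sub>R x) \<otimes> P x" using Suc.IH n by simp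
  also have "\<dots> = P (bch br (real k *\<^sub>R x) (1 *\<^sub>R x))" using P_mult[OF n] by simp
  finally show ?case by (simp only: bch_parallel) (simp add: add.commute)
qed

text \<open>In \<open>bch\<close> the \<open>N\<close>-th root of \<open>x\<close> is \<open>x / N\<close>, so a homomorphism that extends \<open>P\<close> has to be
  \<open>P (x / N) ^ N\<close> as soon as \<open>x / N\<close> is in the ball. The value does not depend on \<open>N\<close>
  (lemma \<open>p_eq\<close>).\<close>
definition p :: "'a \<Rightarrow> 'g" where
  "p x = P ((1 / real (Suc (nat \<lceil>norm x / \<epsilon>\<rceil>))) *\<^sub>R x) [^] Suc (nat \<lceil>norm x / \<epsilon>\<rceil>)"

lemma root_independent:
  assumes "norm x < \<epsilon> * real N" "norm x < \<epsilon> * real M"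
  shows "P ((1 / real N) *\<^sub>R x) [^] N = P ((1 / real M) *\<^sub>R x) [^] M"
proof -
  have *: "P ((1 / real N) *\<^sub>R x) [^] N = P ((1 / real (N * M)) *\<^sub>R x) [^] (N * M)"
    if "norm x < \<epsilon> * real N" "norm x < \<epsilon> * real M" for N M
  proof -
    have pos: "real N > 0" "real M > 0"
      using that by (cases "N = 0"; cases "M = 0"; simp)+
    have e: "real M *\<^sub>R ((1 / real (N * M)) *\<^sub>R x) = (1 / real N) *\<^sub>R x" using pos by simp
    have "norm ((1 / real N) *\<^sub>R x) < \<epsilon>" using that(1) pos by (simp add: field_simps)
    hence "P ((1 / real N) *\<^sub>R x) = P ((1 / real (N * M)) *\<^sub>R x) [^] M"
      using P_pow[of M "(1 / real (N * M)) *\<^sub>R x"] unfolding e by simp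
    thus ?thesis by (simp add: nat_pow_pow mult.commute)
  qed
  show ?thesis using *[OF assms] *[OF assms(2,1)] by (simp add: mult.commute)
qed

lemma p_eq: "norm x < \<epsilon> * real N \<Longrightarrow> p x = P ((1 / real N) *\<^sub>R x) [^] N"
  unfolding p_def
proof (rule root_independent)
  have "norm x / \<epsilon> < real (Suc (nat \<lceil>norm x / \<epsilon>\<rceil>))"
    using real_nat_ceiling_ge[of "norm x / \<epsilon>"] by simp
  thus "norm x < \<epsilon> * real (Suc (nat \<lceil>norm x / \<epsilon>\<rceil>))"
    using eps by (simp add: pos_divide_less_eq mult.commute)
qed

lemma p_closed [simp]: "p x \<in> carrier G" by (simp add: p_def)

lemma p_local: "norm x < \<epsilon> \<Longrightarrow> p x = P x"
  using p_eq[of x 1] by simp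

lemma exists_large: "\<exists>N>0. r < \<epsilon> * real N"
proof -
  obtain N where N: "r / \<epsilon> < real N" using reals_Archimedean2 by blast
  hence "r < \<epsilon> * real (Suc N)" using eps by (simp add: pos_divide_less_eq algebra_simps)
  thus ?thesis by blast
qed

lemma norm_root: "N > 0 \<Longrightarrow> norm x < \<epsilon> * real N \<Longrightarrow> norm ((1 / real N) *\<^sub>R x) < \<epsilon>"
  by (simp add: field_simps)

lemma p_add_commuting:
  assumes "br x y = 0" shows "p (x + y) = p x \<otimes> p y"
proof -
  obtain N where N: "N > 0" "norm x + norm y < \<epsilon> * real N" using exists_large by blast
  have n: "norm x < \<epsilon> * real N" "norm y < \<epsilon> * real N" "norm (x + y) < \<epsilon> * real N"
    using N(2) norm_triangle_ineq[of x y] norm_ge_zero[of x] norm_ge_zero[of y] by linarith+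
  let ?x = "(1 / real N) *\<^sub>R x" and ?y = "(1 / real N) *\<^sub>R y"
  have 1: "P ?x \<otimes> P ?y = P ((1 / real N) *\<^sub>R (x + y))"
    using P_mult[OF norm_root[OF N(1) n(1)] norm_root[OF N(1) n(2)]] assms
    by (simp add: bch_def br_simps scaleR_add_right)
  have 2: "P ?y \<otimes> P ?x = P ((1 / real N) *\<^sub>R (x + y))"
    using P_mult[OF norm_root[OF N(1) n(2)] norm_root[OF N(1) n(1)]] assms antisym[of y x]
    by (simp add: bch_def br_simps scaleR_add_right add.commute)
  have "(P ?x \<otimes> P ?y) [^] N = P ?x [^] N \<otimes> P ?y [^] N"
    by (rule pow_mult_distrib) (simp_all add: 1 2)
  thus ?thesis using p_eq[OF n(1)] p_eq[OF n(2)] p_eq[OF n(3)] 1 by simp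
qed

lemma p_scale: "p (real n *\<^sub>R x) = p x [^] n"
proof (induction n)
  case 0
  then show ?case using p_local[of 0] eps by (simp add: P_zero)
next
  case (Suc n)
  have "p (real n *\<^sub>R x + x) = p (real n *\<^sub>R x) \<otimes> p x"
    by (rule p_add_commuting) (simp add: br_simps alt)
  thus ?case using Suc by (simp add: scaleR_left_distrib add.commute)
qed

lemma intertwine_pow:
  assumes "g \<in> carrier G" "h \<in> carrier G" "h' \<in> carrier G" "g \<otimes> h = h' \<otimes> g"
  shows "g \<otimes> h [^] (k::nat) = h' [^] k \<otimes> g"
proof (induction k)
  case (Suc k)
  have "g \<otimes> h [^] Suc k = (g \<otimes> h [^] k) \<otimes> h" using assms by (simp add: m_assoc)
  also have "\<dots> = h' [^] k \<otimes> (g \<otimes> h)" using assms Suc by (simp add: m_assoc)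
  also have "\<dots> = h' [^] Suc k \<otimes> g" using assms by (simp add: m_assoc)
  finally show ?case .
qed (use assms in simp)

text \<open>On the ball both sides are products given by \<open>bch\<close>; pass from the \<open>M\<close>-th root of \<open>y\<close> to \<open>y\<close> by
  taking powers.\<close>
lemma P_conj:
  assumes z: "norm z < \<epsilon>" shows "P z \<otimes> p y = p (y + br z y) \<otimes> P z"
proof -
  let ?y = "y + br z y"
  obtain M where M: "M > 0" "norm y + norm ?y < \<epsilon> * real M" using exists_large by blast
  have n: "norm y < \<epsilon> * real M" "norm ?y < \<epsilon> * real M"
    using M(2) norm_ge_zero[of y] norm_ge_zero[of ?y] by linarith+
  have "bch br z ((1 / real M) *\<^sub>R y) = bch br ((1 / real M) *\<^sub>R ?y) z"
  proof -
    have "br y z = - br z y" by (rule antisym)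
    moreover have "(1/2) *\<^sub>R v + (1/2) *\<^sub>R v = v" for v :: 'a
      by (simp add: scaleR_left_distrib[symmetric])
    moreover have "v / 2 + v / 2 = v" for v :: real by simp
    ultimately show ?thesis
      by (simp add: bch_def br_simps two_step' algebra_simps flip: scaleR_left_distrib)
  qed
  hence "P z \<otimes> P ((1 / real M) *\<^sub>R y) = P ((1 / real M) *\<^sub>R ?y) \<otimes> P z"
    using P_mult[OF z norm_root[OF M(1) n(1)]] P_mult[OF norm_root[OF M(1) n(2)] z] by simp
  from intertwine_pow[OF _ _ _ this, of M] show ?thesis
    using p_eq[OF n(1)] p_eq[OF n(2)] by simp
qed

lemma p_conj: "p x \<otimes> p y = p (y + br x y) \<otimes> p x"
proof -
  obtain N where N: "N > 0" "norm x < \<epsilon> * real N" using exists_large by blast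
  define z where "z = (1 / real N) *\<^sub>R x"
  have z: "norm z < \<epsilon>" unfolding z_def by (rule norm_root[OF N])
  have "P z [^] k \<otimes> p y = p (y + real k *\<^sub>R br z y) \<otimes> P z [^] k" for k
  proof (induction k)
    case (Suc k)
    have "P z [^] Suc k \<otimes> p y = P z [^] k \<otimes> (P z \<otimes> p y)" by (simp add: m_assoc)
    also have "\<dots> = P z \<otimes> P z [^] k \<otimes> p y"
      using nat_pow_mult[of "P z" 1 k] nat_pow_mult[of "P z" k 1] by (simp flip: m_assoc)
    also have "\<dots> = P z \<otimes> p (y + real k *\<^sub>R br z y) \<otimes> P z [^] k"
      using Suc by (simp add: m_assoc)
    also have "\<dots> = p (y + real k *\<^sub>R br z y + br z (y + real k *\<^sub>R br z y)) \<otimes> (P z \<otimes> P z [^] k)"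
      using P_conj[OF z, of "y + real k *\<^sub>R br z y"] by (simp add: m_assoc)
    also have "y + real k *\<^sub>R br z y + br z (y + real k *\<^sub>R br z y) = y + real (Suc k) *\<^sub>R br z y"
      by (simp add: br_simps two_step algebra_simps)
    also have "P z \<otimes> P z [^] k = P z [^] Suc k"
      using nat_pow_mult[of "P z" 1 k] by simp
    finally show ?case .
  qed (simp add: m_assoc)
  from this[of N] show ?thesis
    using p_eq[OF N(2)] N(1) by (simp add: z_def br_simps)
qed

lemma pow_mult_central_commutator:
  assumes gh: "g \<in> carrier G" "h \<in> carrier G" "k \<in> carrier G"
    and c: "g \<otimes> h = k \<otimes> (h \<otimes> g)" and kg: "k \<otimes> g = g \<otimes> k" and kh: "k \<otimes> h = h \<otimes> k"
  shows "g [^] n \<otimes> h [^] n = k [^] (n * (n - 1) div 2) \<otimes> (g \<otimes> h) [^] (n::nat)"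
proof (induction n)
  case (Suc n)
  have k_comm: "k [^] j \<otimes> x = x \<otimes> k [^] j" if "x \<in> carrier G" "k \<otimes> x = x \<otimes> k" for x and j :: nat
    using intertwine_pow[of x k k j] gh that by simp
  have kgh: "k \<otimes> (g \<otimes> h) = (g \<otimes> h) \<otimes> k"
    using gh kg kh by (metis m_assoc)
  have "g \<otimes> (g \<otimes> h) = (k \<otimes> (g \<otimes> h)) \<otimes> g"
  proof -
    have "g \<otimes> (g \<otimes> h) = g \<otimes> k \<otimes> h \<otimes> g" using gh by (simp add: c m_assoc)
    also have "\<dots> = k \<otimes> (g \<otimes> h) \<otimes> g" using gh by (simp add: kg[symmetric] m_assoc)
    finally show ?thesis .
  qed
  from intertwine_pow[OF _ _ _ this, of n] gh
  have "g \<otimes> (g \<otimes> h) [^] n = (k \<otimes> (g \<otimes> h)) [^] n \<otimes> g" by simp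
  also have "(k \<otimes> (g \<otimes> h)) [^] n = k [^] n \<otimes> (g \<otimes> h) [^] n"
    using gh kgh by (intro pow_mult_distrib) auto
  finally have *: "g \<otimes> (g \<otimes> h) [^] n = k [^] n \<otimes> (g \<otimes> h) [^] n \<otimes> g" .
  have t: "Suc n * (Suc n - 1) div 2 = n * (n - 1) div 2 + n"
  proof -
    have "Suc n * n = n * (n - 1) + n * 2" by (cases n) auto
    thus ?thesis by simp
  qed
  have "g [^] Suc n \<otimes> h [^] Suc n = g \<otimes> (g [^] n \<otimes> h [^] n) \<otimes> h"
    using gh nat_pow_mult[of g 1 n] nat_pow_mult[of g n 1] by (simp add: m_assoc flip: m_assoc[of g "g [^] n"])
  also have "\<dots> = g \<otimes> k [^] (n * (n - 1) div 2) \<otimes> (g \<otimes> h) [^] n \<otimes> h"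
    using gh Suc by (simp add: m_assoc)
  also have "g \<otimes> k [^] (n * (n - 1) div 2) = k [^] (n * (n - 1) div 2) \<otimes> g"
    using k_comm[of g] gh kg by simp
  also have "k [^] (n * (n - 1) div 2) \<otimes> g \<otimes> (g \<otimes> h) [^] n \<otimes> h
     = k [^] (n * (n - 1) div 2) \<otimes> (g \<otimes> (g \<otimes> h) [^] n) \<otimes> h"
    using gh by (simp add: m_assoc)
  also have "\<dots> = (k [^] (n * (n - 1) div 2) \<otimes> k [^] n) \<otimes> ((g \<otimes> h) [^] n \<otimes> (g \<otimes> h))"
    unfolding * using gh by (simp add: m_assoc)
  also have "\<dots> = k [^] (Suc n * (Suc n - 1) div 2) \<otimes> (g \<otimes> h) [^] Suc n"
    using gh by (simp only: nat_pow_mult t nat_pow_Suc)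
  finally show ?case .
qed (use gh in simp)

text \<open>With \<open>g\<close>, \<open>h\<close> the images of \<open>x / N\<close>, \<open>y / N\<close>, the local law computes \<open>(g h)^N\<close> as the image of
  \<open>x + y + br x y / (2 N)\<close>. On the other hand \<open>g^N h^N\<close> differs from \<open>(g h)^N\<close> by the power
  \<open>N (N - 1) / 2\<close> of the central commutator, which is the image of \<open>br x y / N^2\<close>. Together the central
  terms add up to \<open>br x y / 2\<close> for every large \<open>N\<close>, without passing to a limit.\<close>
theorem p_bch: "p (bch br x y) = p x \<otimes> p y"
proof -
  let ?z = "br x y"
  obtain N where N: "N > 0" "norm x + norm y + norm (x + y) + norm ?z < \<epsilon> * real N"
    using exists_large by blast
  define c where "c = 1 / real N"
  have n: "norm x < \<epsilon> * real N" "norm y < \<epsilon> * real N" using N(2) by (smt (verit) norm_ge_zero)+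
  let ?w = "x + y + (c / 2) *\<^sub>R ?z"
  have "norm ((c / 2) *\<^sub>R ?z) \<le> 1 * norm ?z"
    unfolding norm_scaleR by (rule mult_right_mono) (use N(1) in \<open>auto simp: c_def\<close>)
  hence nw: "norm ?w < \<epsilon> * real N"
    using N(2) norm_triangle_ineq[of "x + y" "(c / 2) *\<^sub>R ?z"] by (smt (verit) norm_ge_zero)
  have cN: "real N * c = 1" using N(1) by (simp add: c_def)
  let ?g = "p (c *\<^sub>R x)" and ?h = "p (c *\<^sub>R y)" and ?k = "p ((c * c) *\<^sub>R ?z)"
  have small: "norm (c *\<^sub>R x) < \<epsilon>" "norm (c *\<^sub>R y) < \<epsilon>"
    unfolding c_def by (rule norm_root[OF N(1)], rule n)+
  have gh: "?g \<otimes> ?h = P (c *\<^sub>R ?w)"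
    using P_mult[OF small] by (simp add: p_local[OF small(1)] p_local[OF small(2)] bch_def br_simps algebra_simps)
  have ghN: "(?g \<otimes> ?h) [^] N = p ?w"
    unfolding gh using p_eq[OF nw] by (simp add: c_def)
  have gN: "?g [^] N = p x" and hN: "?h [^] N = p y"
    using p_scale[of N "c *\<^sub>R x"] p_scale[of N "c *\<^sub>R y"] cN by simp_all
  have central: "?k \<otimes> p u = p u \<otimes> ?k" for u
    using p_conj[of "(c * c) *\<^sub>R ?z" u] by (simp add: br_simps two_step')
  have comm: "?g \<otimes> ?h = ?k \<otimes> (?h \<otimes> ?g)"
  proof -
    have "?g \<otimes> ?h = p ((c * c) *\<^sub>R ?z + c *\<^sub>R y) \<otimes> ?g"
      using p_conj[of "c *\<^sub>R x" "c *\<^sub>R y"] by (simp add: br_simps add.commute)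
    also have "p ((c * c) *\<^sub>R ?z + c *\<^sub>R y) = ?k \<otimes> ?h"
      by (rule p_add_commuting) (simp add: br_simps two_step')
    finally show ?thesis by (simp add: m_assoc)
  qed
  define t where "t = N * (N - 1) div 2"
  have "even (N * (N - 1))" by (cases "even N") simp_all
  hence "real (N * (N - 1)) = 2 * real t" unfolding t_def by (metis dvd_mult_div_cancel of_nat_mult of_nat_numeral)
  hence t: "real t = real N * (real N - 1) / 2" using N(1) by (simp add: of_nat_diff)
  have "p x \<otimes> p y = ?k [^] t \<otimes> p ?w"
    using pow_mult_central_commutator[OF _ _ _ comm central central, of N]
    by (simp add: gN hN ghN t_def)
  also have "\<dots> = p ((real t * (c * c)) *\<^sub>R ?z + ?w)"
    using p_add_commuting[of "real t *\<^sub>R ((c * c) *\<^sub>R ?z)" ?w] p_scale[of t "(c * c) *\<^sub>R ?z"]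
    by (simp add: br_simps two_step' two_step)
  also have "real t * (c * c) = 1 / 2 - c / 2"
    using N(1) unfolding t c_def by (simp add: field_simps)
  also have "(1 / 2 - c / 2) *\<^sub>R ?z + ?w = bch br x y"
    by (simp add: bch_def algebra_simps)
  finally show ?thesis by simp
qed

end

section \<open>From a Lie group to its local model\<close>

context lie_group
begin

lemma in_carrier [simp]: "x \<in> carrier G" by (simp add: carrier_UNIV)

lemma chart:
  assumes "(U, \<phi>) \<in> A"
  shows "open U" "open (\<phi> ` U)" "homeomorphism U (\<phi> ` U) \<phi> (inv_into U \<phi>)"
    "inj_on \<phi> U" "continuous_on U \<phi>" "continuous_on (\<phi> ` U) (inv_into U \<phi>)"
    "\<And>a. a \<in> U \<Longrightarrow> inv_into U \<phi> (\<phi> a) = a"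
proof -
  show *: "open U" "open (\<phi> ` U)" "homeomorphism U (\<phi> ` U) \<phi> (inv_into U \<phi>)"
    using atlas assms unfolding smooth_atlas_def by auto
  show "inj_on \<phi> U" using *(3) unfolding homeomorphism_def by (metis inj_onI)
  thus "\<And>a. a \<in> U \<Longrightarrow> inv_into U \<phi> (\<phi> a) = a" by simp
  show "continuous_on U \<phi>" "continuous_on (\<phi> ` U) (inv_into U \<phi>)"
    using *(3) by (auto simp: homeomorphism_def)
qed

lemma chart_at: obtains U \<phi> where "(U, \<phi>) \<in> A" "g \<in> U"
proof -
  have "g \<in> (\<Union>(U, \<phi>)\<in>A. U)" using atlas by (simp add: smooth_atlas_def)
  thus ?thesis using that by auto
qed

lemma continuous_mult: "continuous_on UNIV (\<lambda>z. fst z \<otimes> snd z)"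
  using smooth_mult by (simp add: smooth_map_def split_beta)

lemma continuous_on_mult:
  "continuous_on S f \<Longrightarrow> continuous_on S h \<Longrightarrow> continuous_on S (\<lambda>x. f x \<otimes> h x)"
  using continuous_on_compose2[OF continuous_mult, of S "\<lambda>x. (f x, h x)"]
  by (simp add: continuous_on_Pair)

lemma continuous_on_inverse: "continuous_on S f \<Longrightarrow> continuous_on S (\<lambda>x. inv f x)"
  using smooth_inv continuous_on_compose2[of UNIV "m_inv G" S f] by (auto simp: smooth_map_def)

lemma open_translate:
  assumes "open S" shows "open {x. g \<otimes> x \<in> S}"
  using open_vimage[OF assms continuous_on_mult[OF continuous_on_const continuous_on_id, of UNIV g]]
  by (simp add: vimage_def)

lemma mult_in_charts:
  assumes "(U\<^sub>1, \<phi>\<^sub>1) \<in> A" "(U\<^sub>2, \<phi>\<^sub>2) \<in> A" "(U\<^sub>3, \<phi>\<^sub>3) \<in> A"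
  defines "D \<equiv> {z \<in> \<phi>\<^sub>1 ` U\<^sub>1 \<times> \<phi>\<^sub>2 ` U\<^sub>2. inv_into U\<^sub>1 \<phi>\<^sub>1 (fst z) \<otimes> inv_into U\<^sub>2 \<phi>\<^sub>2 (snd z) \<in> U\<^sub>3}"
  shows "open D" "smooth_on (\<lambda>z. \<phi>\<^sub>3 (inv_into U\<^sub>1 \<phi>\<^sub>1 (fst z) \<otimes> inv_into U\<^sub>2 \<phi>\<^sub>2 (snd z))) D"
proof -
  let ?\<psi>\<^sub>1 = "inv_into U\<^sub>1 \<phi>\<^sub>1" and ?\<psi>\<^sub>2 = "inv_into U\<^sub>2 \<phi>\<^sub>2"
  note c1 = chart[OF assms(1)] and c2 = chart[OF assms(2)] and c3 = chart[OF assms(3)]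
  have "continuous_on (\<phi>\<^sub>1 ` U\<^sub>1 \<times> \<phi>\<^sub>2 ` U\<^sub>2) (\<lambda>z. ?\<psi>\<^sub>1 (fst z) \<otimes> ?\<psi>\<^sub>2 (snd z))"
    by (intro continuous_on_mult continuous_on_compose2[OF c1(6)] continuous_on_compose2[OF c2(6)]
        continuous_intros) auto
  from continuous_open_preimage[OF this open_Times[OF c1(2) c2(2)] c3(1)]
  have "open ((\<phi>\<^sub>1 ` U\<^sub>1 \<times> \<phi>\<^sub>2 ` U\<^sub>2) \<inter> (\<lambda>z. ?\<psi>\<^sub>1 (fst z) \<otimes> ?\<psi>\<^sub>2 (snd z)) -` U\<^sub>3)" .
  moreover have "(\<phi>\<^sub>1 ` U\<^sub>1 \<times> \<phi>\<^sub>2 ` U\<^sub>2) \<inter> (\<lambda>z. ?\<psi>\<^sub>1 (fst z) \<otimes> ?\<psi>\<^sub>2 (snd z)) -` U\<^sub>3 = D"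
    unfolding D_def by blast
  ultimately show D: "open D" by simp
  have inj: "inj_on (map_prod \<phi>\<^sub>1 \<phi>\<^sub>2) (U\<^sub>1 \<times> U\<^sub>2)"
    using c1(4) c2(4) by (rule map_prod_inj_on)
  have inv: "inv_into (U\<^sub>1 \<times> U\<^sub>2) (map_prod \<phi>\<^sub>1 \<phi>\<^sub>2) (\<phi>\<^sub>1 a, \<phi>\<^sub>2 c) = (a, c)" if "a \<in> U\<^sub>1" "c \<in> U\<^sub>2" for a c
    using inv_into_f_f[OF inj, of "(a, c)"] that by simp
  have img: "map_prod \<phi>\<^sub>1 \<phi>\<^sub>2 ` ((U\<^sub>1 \<times> U\<^sub>2) \<inter> (\<lambda>(x, y). x \<otimes> y) -` U\<^sub>3) = D" (is "?I = D")
  proof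
    show "?I \<subseteq> D" by (auto simp: D_def c1(7) c2(7))
    show "D \<subseteq> ?I"
    proof
      fix z assume "z \<in> D"
      then obtain a c where "z = (\<phi>\<^sub>1 a, \<phi>\<^sub>2 c)" "a \<in> U\<^sub>1" "c \<in> U\<^sub>2" "a \<otimes> c \<in> U\<^sub>3"
        by (auto simp: D_def c1(7) c2(7))
      thus "z \<in> ?I" by (intro image_eqI[of _ _ "(a, c)"]) auto
    qed
  qed
  have "(U\<^sub>1 \<times> U\<^sub>2, map_prod \<phi>\<^sub>1 \<phi>\<^sub>2) \<in> prod_atlas A A" using assms(1,2) by (auto simp: prod_atlas_def)
  hence "smooth_on (\<phi>\<^sub>3 \<circ> (\<lambda>(x, y). x \<otimes> y) \<circ> inv_into (U\<^sub>1 \<times> U\<^sub>2) (map_prod \<phi>\<^sub>1 \<phi>\<^sub>2)) D"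
    using smooth_mult assms(3) unfolding smooth_map_def img[symmetric] by blast
  thus "smooth_on (\<lambda>z. \<phi>\<^sub>3 (?\<psi>\<^sub>1 (fst z) \<otimes> ?\<psi>\<^sub>2 (snd z))) D"
    by (rule smooth_on_cong[OF D, rotated]) (auto simp: D_def inv c1(7) c2(7))
qed

lemma inverse_in_chart:
  assumes "(U, \<phi>) \<in> A"
  defines "I \<equiv> {x \<in> \<phi> ` U. inv (inv_into U \<phi> x) \<in> U}"
  shows "open I" "smooth_on (\<lambda>x. \<phi> (inv (inv_into U \<phi> x))) I"
proof -
  note c = chart[OF assms(1)]
  have "open (\<phi> ` U \<inter> (\<lambda>x. inv (inv_into U \<phi> x)) -` U)"
    by (rule continuous_open_preimage[OF continuous_on_inverse[OF c(6)] c(2,1)])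
  moreover have "\<phi> ` U \<inter> (\<lambda>x. inv (inv_into U \<phi> x)) -` U = I" unfolding I_def by blast
  ultimately show I: "open I" by simp
  have img: "\<phi> ` (U \<inter> m_inv G -` U) = I" by (auto simp: I_def c(7))
  have "smooth_on (\<phi> \<circ> m_inv G \<circ> inv_into U \<phi>) I"
    using smooth_inv assms(1) unfolding smooth_map_def img[symmetric] by blast
  thus "smooth_on (\<lambda>x. \<phi> (inv (inv_into U \<phi> x))) I" by (simp add: o_def)
qed

lemma one_chart: "one_chart G A \<in> A" "\<one> \<in> fst (one_chart G A)"
proof -
  have "\<exists>c. c \<in> A \<and> \<one> \<in> fst c" using chart_at[of "\<one>"] by (metis fst_conv)
  from someI_ex[OF this] show "one_chart G A \<in> A" "\<one> \<in> fst (one_chart G A)"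
    unfolding one_chart_def by auto
qed

abbreviation "U0 \<equiv> fst (one_chart G A)"
abbreviation "\<phi>0 \<equiv> snd (one_chart G A)"
abbreviation "\<psi>0 \<equiv> inv_into U0 \<phi>0"

lemma one_chart_in_atlas: "(U0, \<phi>0) \<in> A" using one_chart(1) by simp

lemmas chart0 = chart[OF one_chart_in_atlas]

lemma local_group:
  "local_lie_group (\<lambda>z. \<phi>0 (\<psi>0 (fst z) \<otimes> \<psi>0 (snd z))) (\<lambda>x. \<phi>0 (inv (\<psi>0 x))) (\<phi>0 \<one>)
     {z \<in> \<phi>0 ` U0 \<times> \<phi>0 ` U0. \<psi>0 (fst z) \<otimes> \<psi>0 (snd z) \<in> U0} (\<phi>0 ` U0) {x \<in> \<phi>0 ` U0. inv (\<psi>0 x) \<in> U0}"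
  by (unfold_locales, rule mult_in_charts[OF one_chart_in_atlas one_chart_in_atlas one_chart_in_atlas], rule mult_in_charts[OF one_chart_in_atlas one_chart_in_atlas one_chart_in_atlas],
      rule chart0(2), use one_chart(2) in \<open>auto simp: chart0(7) m_assoc\<close>,
      rule inverse_in_chart[OF one_chart_in_atlas], rule inverse_in_chart[OF one_chart_in_atlas])

lemma lie_bracket_eq:
  "lie_bracket G A = local_lie_group.br (\<lambda>z. \<phi>0 (\<psi>0 (fst z) \<otimes> \<psi>0 (snd z))) (\<phi>0 \<one>)"
proof -
  interpret L: local_lie_group "\<lambda>z. \<phi>0 (\<psi>0 (fst z) \<otimes> \<psi>0 (snd z))" "\<lambda>x. \<phi>0 (inv (\<psi>0 x))" "\<phi>0 \<one>"
     "{z \<in> \<phi>0 ` U0 \<times> \<phi>0 ` U0. \<psi>0 (fst z) \<otimes> \<psi>0 (snd z) \<in> U0}" "\<phi>0 ` U0" "{x \<in> \<phi>0 ` U0. inv (\<psi>0 x) \<in> U0}"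
    by (rule local_group)
  have "left_inv_field G A v = L.X v" for v
    by (intro ext) (simp add: left_inv_field_def L.X_def split_beta Let_def)
  thus ?thesis by (intro ext) (simp add: lie_bracket_def L.br_def Let_def)
qed

lemma lie_bracket_bilinear: "bilinear (lie_bracket G A)"
  and lie_bracket_antisym: "lie_bracket G A u v = - lie_bracket G A v u"
  and lie_bracket_jacobi: "lie_bracket G A u (lie_bracket G A v w)
     + lie_bracket G A v (lie_bracket G A w u) + lie_bracket G A w (lie_bracket G A u v) = 0"
  unfolding lie_bracket_eq
  by (rule local_lie_group.br_bilinear[OF local_group] local_lie_group.br_antisym[OF local_group]
      local_lie_group.br_jacobi[OF local_group])+

end

text \<open>A local isomorphism of Lie groups near the identities: \<open>P\<close> from \<open>bch\<close> to \<open>G\<close> with local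
  inverse \<open>F\<close>, both smooth in the chart at the identity.\<close>
locale local_bch_model = lie_group G A + local_bch_hom G b P \<epsilon>
  for G :: "'g::{t2_space, second_countable_topology} monoid" (structure)
    and A :: "('g, 'e::euclidean_space) chart set"
    and b :: "'a::euclidean_space \<Rightarrow> 'a \<Rightarrow> 'a" and P :: "'a \<Rightarrow> 'g" and \<epsilon> :: real +
  fixes F :: "'g \<Rightarrow> 'a"
  assumes open_image: "open (P ` ball 0 \<epsilon>)" and image_in_chart: "P ` ball 0 \<epsilon> \<subseteq> U0"
    and F_P: "x \<in> ball 0 \<epsilon> \<Longrightarrow> F (P x) = x"
    and cont_P: "continuous_on (ball 0 \<epsilon>) P" and cont_F: "continuous_on (P ` ball 0 \<epsilon>) F"
    and smooth_P: "smooth_on (\<lambda>x. \<phi>0 (P x)) (ball 0 \<epsilon>)"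
    and smooth_F: "smooth_on (\<lambda>y. F (\<psi>0 y)) (\<phi>0 ` P ` ball 0 \<epsilon>)"

context lie_group
begin

text \<open>The linear isomorphism \<open>L\<close> transports the local development to a model bracket \<open>b\<close>. The radius \<open>\<epsilon>\<close> is chosen such that products of two elements of the ball
  remain in the domain on which \<open>F0\<close> is injective.\<close>
lemma local_bch_model_exists:
  fixes b :: "'a::euclidean_space \<Rightarrow> 'a \<Rightarrow> 'a" and Q :: "'e \<Rightarrow> 'e"
  assumes Q: "linear Q" "\<And>u v. Q (lie_bracket G A u v) = 0"
      "\<And>u v. lie_bracket G A (Q u) v = lie_bracket G A u v"
    and b: "two_step_bracket b"
    and L: "linear L" "linear L'" "\<And>x. L' (L x) = x" "\<And>y. L (L' y) = y"
      "\<And>x y. L (b x y) = lie_bracket G A (L x) (L y)"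
  shows "\<exists>P \<epsilon> F. local_bch_model G A b P \<epsilon> F"
proof -
  let ?m = "\<lambda>z. \<phi>0 (\<psi>0 (fst z) \<otimes> \<psi>0 (snd z))"
  let ?D = "{z \<in> \<phi>0 ` U0 \<times> \<phi>0 ` U0. \<psi>0 (fst z) \<otimes> \<psi>0 (snd z) \<in> U0}"
  let ?I = "{x \<in> \<phi>0 ` U0. inv (\<psi>0 x) \<in> U0}"
  interpret L: two_step_local_lie_group ?m "\<lambda>x. \<phi>0 (inv (\<psi>0 x))" "\<phi>0 \<one>" ?D "\<phi>0 ` U0" ?I Q
    unfolding two_step_local_lie_group_def two_step_local_lie_group_axioms_def
    using local_group Q by (simp add: lie_bracket_eq)
  interpret b: two_step_bracket b by (rule b)
  obtain U V F0 P0 where UV: "open U" "\<phi>0 \<one> \<in> U" "U \<subseteq> ?I" "open V" "0 \<in> V" "homeomorphism U V F0 P0"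
    "F0 (\<phi>0 \<one>) = 0" "smooth_on F0 U" "smooth_on P0 V"
    "\<And>x y. \<lbrakk>x \<in> U; y \<in> U; (x, y) \<in> ?D; ?m (x, y) \<in> U\<rbrakk> \<Longrightarrow> F0 (?m (x, y)) = bch L.br (F0 x) (F0 y)"
    by (rule L.local_chart) blast
  have bL: "bounded_linear L" "bounded_linear L'" using L by (simp_all add: linear_conv_bounded_linear)
  have FP0: "P0 z \<in> U" "F0 (P0 z) = z" if "z \<in> V" for z using UV(6) that by (auto simp: homeomorphism_def)
  have PF0: "F0 z \<in> V" "P0 (F0 z) = z" if "z \<in> U" for z using UV(6) that by (auto simp: homeomorphism_def)
  have cP0: "continuous_on V P0" and cF0: "continuous_on U F0" using UV(6) by (auto simp: homeomorphism_def)
  have UW: "U \<subseteq> \<phi>0 ` U0" using UV(3) by blast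
  define V1 where "V1 = L -` V"
  have V1: "open V1" unfolding V1_def
    by (rule open_vimage[OF UV(4) linear_continuous_on[OF bL(1)]])
  have cPL: "continuous_on V1 (\<lambda>x. P0 (L x))"
    by (rule continuous_on_compose2[OF cP0 linear_continuous_on[OF bL(1)]]) (auto simp: V1_def)
  have L0: "L 0 = 0" "L' 0 = 0" using linear_0[OF L(1)] linear_0[OF L(2)] by auto
  have P00: "P0 0 = \<phi>0 \<one>" using PF0(2)[OF UV(2)] UV(7) by simp
  define N where "N = (V1 \<times> V1) \<inter> (\<lambda>z. (P0 (L (fst z)), P0 (L (snd z)))) -` (?D \<inter> ?m -` U)"
  have "open N" unfolding N_def
  proof (rule continuous_open_preimage)
    show "continuous_on (V1 \<times> V1) (\<lambda>z. (P0 (L (fst z)), P0 (L (snd z))))"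
      by (intro continuous_on_Pair continuous_on_compose2[OF cPL] continuous_intros) auto
    show "open (?D \<inter> ?m -` U)"
      by (rule continuous_open_preimage[OF smooth_on_continuous[OF L.smooth_m] L.open_D UV(1)])
  qed (use V1 in \<open>auto intro: open_Times\<close>)
  moreover have "(0, 0) \<in> N"
    using L.right_one[OF L.e0_W] UV(2,5) by (simp add: N_def V1_def L0 P00)
  ultimately obtain B1 B2 where B12: "open B1" "open B2" "(0, 0) \<in> B1 \<times> B2" "B1 \<times> B2 \<subseteq> N"
    by (metis open_prod_elim)
  hence "open (B1 \<inter> B2)" "0 \<in> B1 \<inter> B2" by auto
  then obtain \<epsilon> where \<epsilon>: "\<epsilon> > 0" "ball 0 \<epsilon> \<subseteq> B1 \<inter> B2" using open_contains_ball by blast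
  let ?B = "ball (0::'a) \<epsilon>"
  have N: "(x, y) \<in> N" if "x \<in> ?B" "y \<in> ?B" for x y
  proof -
    have "(x, y) \<in> B1 \<times> B2" using that \<epsilon>(2) by blast
    thus ?thesis using B12(4) by blast
  qed
  have BV: "x \<in> V1" "L x \<in> V" if "x \<in> ?B" for x using N[OF that that] by (auto simp: N_def V1_def)
  define P where "P x = \<psi>0 (P0 (L x))" for x
  define F where "F g = L' (F0 (\<phi>0 g))" for g
  have \<phi>P: "\<phi>0 (P x) = P0 (L x)" "P x \<in> U0" if "x \<in> ?B" for x
  proof -
    have "P0 (L x) \<in> \<phi>0 ` U0" using FP0(1)[OF BV(2)[OF that]] UW by blast
    thus "\<phi>0 (P x) = P0 (L x)" "P x \<in> U0" unfolding P_def by (auto simp: chart0(7))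
  qed
  have FP: "F (P x) = x" if "x \<in> ?B" for x
    using \<phi>P[OF that] FP0(2)[OF BV(2)[OF that]] by (simp add: F_def L)
  have \<phi>Pimg: "\<phi>0 ` P ` ?B = U \<inter> F0 -` (L' -` ?B)"
  proof
    show "\<phi>0 ` P ` ?B \<subseteq> U \<inter> F0 -` (L' -` ?B)"
      using \<phi>P FP0 BV(2) by (auto simp: L)
    show "U \<inter> F0 -` (L' -` ?B) \<subseteq> \<phi>0 ` P ` ?B"
    proof
      fix y assume y: "y \<in> U \<inter> F0 -` (L' -` ?B)"
      hence "\<phi>0 (P (L' (F0 y))) = y" using \<phi>P(1)[of "L' (F0 y)"] PF0(2)[of y] by (simp add: L)
      with y show "y \<in> \<phi>0 ` P ` ?B" by (metis IntD2 image_eqI vimageE)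
    qed
  qed
  have open_LB: "open (L' -` ?B)"
    by (rule open_vimage[OF open_ball linear_continuous_on[OF bL(2)]])
  have open\<phi>: "open (\<phi>0 ` P ` ?B)"
    unfolding \<phi>Pimg by (rule continuous_open_preimage[OF cF0 UV(1) open_LB])
  have PB_U0: "P ` ?B \<subseteq> U0" using \<phi>P(2) by blast
  have Pimg: "P ` ?B = U0 \<inter> \<phi>0 -` (\<phi>0 ` P ` ?B)"
    using PB_U0 chart0(4) by (auto simp: inj_on_def)
  show ?thesis
  proof (intro exI)
    show "local_bch_model G A b P \<epsilon> F"
    proof (unfold_locales)
      show "\<epsilon> > 0" by (rule \<epsilon>(1))
      show "P x \<in> carrier G" for x by simp
      show "P x \<otimes> P y = P (bch b x y)" if "norm x < \<epsilon>" "norm y < \<epsilon>" for x y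
      proof -
        have xy: "x \<in> ?B" "y \<in> ?B" using that by auto
        let ?x = "P0 (L x)" and ?y = "P0 (L y)"
        have D: "(?x, ?y) \<in> ?D" "?m (?x, ?y) \<in> U" using N[OF xy] by (auto simp: N_def)
        have "F0 (?m (?x, ?y)) = bch L.br (L x) (L y)"
          using UV(10)[OF FP0(1) FP0(1) D] FP0(2) BV(2) xy by simp
        also have "\<dots> = L (bch b x y)"
          using L by (simp add: bch_def linear_add linear_scale lie_bracket_eq)
        finally have "?m (?x, ?y) = P0 (L (bch b x y))" using PF0(2)[OF D(2)] by simp
        hence "\<psi>0 (?m (?x, ?y)) = P (bch b x y)" by (simp add: P_def)
        moreover have "\<psi>0 (?m (?x, ?y)) = P x \<otimes> P y" using D(1) by (simp add: P_def chart0(7))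
        ultimately show ?thesis by simp
      qed
      show "open (P ` ball 0 \<epsilon>)"
        by (subst Pimg, rule continuous_open_preimage[OF chart0(5,1) open\<phi>])
      show "P ` ball 0 \<epsilon> \<subseteq> U0" by (rule PB_U0)
      show "F (P x) = x" if "x \<in> ball 0 \<epsilon>" for x by (rule FP[OF that])
      show "continuous_on (ball 0 \<epsilon>) P" unfolding P_def
        by (rule continuous_on_compose2[OF chart0(6) continuous_on_subset[OF cPL]])
           (use BV FP0 UW in auto)
      show "continuous_on (P ` ball 0 \<epsilon>) F" unfolding F_def
        by (rule continuous_on_compose2[OF linear_continuous_on[OF bL(2)]
             continuous_on_compose2[OF cF0 continuous_on_subset[OF chart0(5) PB_U0]]])
           (use \<phi>Pimg in auto)
      have "smooth_on (\<lambda>x. P0 (L x)) ?B"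
        by (rule smooth_on_compose[OF open_ball UV(4) _ UV(9) smooth_on_linear[OF bL(1) open_ball]])
           (use BV in auto)
      thus "smooth_on (\<lambda>x. \<phi>0 (P x)) (ball 0 \<epsilon>)"
        by (rule smooth_on_cong[OF open_ball, rotated]) (simp add: \<phi>P)
      have "smooth_on (\<lambda>y. L' (F0 y)) (\<phi>0 ` P ` ?B)"
        by (rule smooth_on_linear_compose[OF bL(2) open\<phi> smooth_on_subset[OF UV(8)]])
           (use \<phi>Pimg in auto)
      thus "smooth_on (\<lambda>y. F (\<psi>0 y)) (\<phi>0 ` P ` ball 0 \<epsilon>)"
        by (rule smooth_on_cong[OF open\<phi>, rotated]) (use PB_U0 in \<open>auto simp: F_def chart0(7)\<close>)
    qed
  qed
qed

end

section \<open>The covering homomorphism\<close>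

context two_step_bracket
begin

lemma bch_assoc: "bch br (bch br x y) z = bch br x (bch br y z)"
  by (simp add: bch_def br_simps two_step two_step' algebra_simps)

lemma bch_minus [simp]: "bch br (- x) x = 0" "bch br x (- x) = 0"
  by (simp_all add: bch_def br_simps alt)

lemma bch_cancel [simp]: "bch br (- x) (bch br x y) = y" "bch br x (bch br (- x) y) = y"
  by (simp_all flip: bch_assoc)

lemma smooth_bch: "open S \<Longrightarrow> smooth_on (bch br a) S"
  unfolding bch_def
  by (intro smooth_on_add smooth_on_const smooth_on_ident
      smooth_on_linear_compose[OF bounded_linear_scaleR_right]
      smooth_on_linear_compose[OF bounded_bilinear.bounded_linear_right[OF bounded]])

lemma continuous_on_bch:
  "continuous_on S f \<Longrightarrow> continuous_on S g \<Longrightarrow> continuous_on S (\<lambda>x. bch br (f x) (g x))"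
  unfolding bch_def
  by (intro continuous_intros bounded_bilinear.continuous_on[OF bounded])

end

context local_bch_model
begin

abbreviation "Oe \<equiv> P ` ball 0 \<epsilon>"

lemma one_Oe: "\<one> \<in> Oe"
  using P_zero eps by (intro image_eqI[of _ _ 0]) auto

lemma P_F: "g \<in> Oe \<Longrightarrow> P (F g) = g" "g \<in> Oe \<Longrightarrow> F g \<in> ball 0 \<epsilon>"
  using F_P by auto

lemma p_P: "x \<in> ball 0 \<epsilon> \<Longrightarrow> p x = P x" using p_local by simp

lemma p_zero: "p 0 = \<one>" using p_local[of 0] P_zero eps by simp

lemma inv_p: "inv (p x) = p (- x)"
  by (rule inv_equality) (simp_all add: p_zero flip: p_bch)

lemma p_near:
  assumes "bch b (- x0) x \<in> ball 0 \<epsilon>" shows "p x = p x0 \<otimes> P (bch b (- x0) x)"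
  using p_bch[of x0 "bch b (- x0) x"] p_P[OF assms] by simp

definition near :: "'a \<Rightarrow> 'a set" where "near x0 = {x. bch b (- x0) x \<in> ball 0 \<epsilon>}"

lemma near: "open (near x0)" "x0 \<in> near x0"
proof -
  have "continuous_on UNIV (bch b (- x0))"
    using continuous_on_bch[OF continuous_on_const continuous_on_id] .
  from open_vimage[OF open_ball this] show "open (near x0)"
    unfolding near_def vimage_def .
  show "x0 \<in> near x0" using eps by (simp add: near_def)
qed

lemma continuous_p: "continuous_on UNIV p"
proof (rule continuous_at_imp_continuous_on, rule ballI)
  fix x0
  have "continuous_on (near x0) (\<lambda>x. p x0 \<otimes> P (bch b (- x0) x))"
    by (intro continuous_on_mult continuous_on_const
         continuous_on_compose2[OF cont_P continuous_on_bch[OF continuous_on_const continuous_on_id]])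
       (auto simp: near_def)
  hence "continuous_on (near x0) p"
    by (rule continuous_on_eq) (use p_near in \<open>simp add: near_def\<close>)
  thus "continuous (at x0) p" using near continuous_on_eq_continuous_at by blast
qed

lemma translate_nbhd: "open {y. inv g \<otimes> y \<in> Oe}" "g \<in> {y. inv g \<otimes> y \<in> Oe}"
  using open_translate[OF open_image] one_Oe by auto

lemma cancel: "g \<otimes> (inv g \<otimes> y) = y" "inv g \<otimes> (g \<otimes> y) = y"
  by (simp_all flip: m_assoc)

text \<open>The image is an open subgroup, hence closed.\<close>
lemma surj_p:
  assumes "connected (UNIV :: 'g set)" shows "surj p"
proof -
  have "open (range p)"
  proof (rule topological_space_class.openI)
    fix g assume "g \<in> range p"
    then obtain x where g: "g = p x" by blast
    have "{y. inv g \<otimes> y \<in> Oe} \<subseteq> range p"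
    proof safe
      fix y z assume "inv g \<otimes> y = P z" "z \<in> ball 0 \<epsilon>"
      hence "y = g \<otimes> p z" using cancel(1)[of g y] p_P by simp
      hence "y = p (bch b x z)" by (simp add: g p_bch)
      thus "y \<in> range p" by simp
    qed
    thus "\<exists>T. open T \<and> g \<in> T \<and> T \<subseteq> range p"
      by (intro exI[of _ "{y. inv g \<otimes> y \<in> Oe}"] conjI translate_nbhd)
  qed
  moreover have "open (- range p)"
  proof (rule topological_space_class.openI)
    fix g assume g: "g \<in> - range p"
    have "{y. inv g \<otimes> y \<in> Oe} \<subseteq> - range p"
    proof safe
      fix y z x assume y: "inv g \<otimes> p x = P z" "z \<in> ball 0 \<epsilon>"
      hence "p x = g \<otimes> p z" using cancel(1)[of g "p x"] p_P by simp
      hence "g = p x \<otimes> p (- z)" by (simp add: m_assoc p_zero flip: p_bch)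
      hence "g = p (bch b x (- z))" by (simp add: p_bch)
      thus False using g by simp
    qed
    thus "\<exists>T. open T \<and> g \<in> T \<and> T \<subseteq> - range p"
      by (intro exI[of _ "{y. inv g \<otimes> y \<in> Oe}"] conjI translate_nbhd)
  qed
  ultimately have "range p = {} \<or> - range p = {}"
    using connectedD[OF assms, of "range p" "- range p"] by auto
  thus ?thesis by auto
qed

text \<open>Near \<open>x0\<close> the map is \<open>P\<close> between a left translation of \<open>bch\<close> and one of \<open>G\<close>.\<close>
lemma smooth_p: "smooth_map std_atlas A p"
proof -
  have "smooth_on (\<lambda>x. \<eta> (p x)) (p -` V)" if V: "(V, \<eta>) \<in> A" for V \<eta>
  proof (rule smooth_on_local)
    fix x0 assume x0: "x0 \<in> p -` V"
    note c = chart[OF V]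
    define S where "S = near x0 \<inter> p -` V"
    have S: "open S" "x0 \<in> S"
      unfolding S_def using near x0 open_vimage[OF c(1) continuous_p] by auto
    note M = mult_in_charts[OF V one_chart_in_atlas V]
    have SB: "bch b (- x0) x \<in> ball 0 \<epsilon>" "p x = p x0 \<otimes> P (bch b (- x0) x)" "p x \<in> V" if "x \<in> S" for x
      using that p_near by (auto simp: S_def near_def)
    have PU: "P (bch b (- x0) x) \<in> U0" if "x \<in> S" for x using SB(1)[OF that] image_in_chart by blast
    have "smooth_on (\<lambda>x. \<phi>0 (P (bch b (- x0) x))) S"
      by (rule smooth_on_compose[OF S(1) open_ball _ smooth_P smooth_bch[OF S(1)]]) (use SB in auto)
    hence sm: "smooth_on (\<lambda>x. (\<eta> (p x0), \<phi>0 (P (bch b (- x0) x)))) S"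
      by (intro smooth_on_Pair S(1) smooth_on_const)
    have sub: "(\<lambda>x. (\<eta> (p x0), \<phi>0 (P (bch b (- x0) x)))) ` S
        \<subseteq> {z \<in> \<eta> ` V \<times> \<phi>0 ` U0. inv_into V \<eta> (fst z) \<otimes> \<psi>0 (snd z) \<in> V}"
      using x0 SB PU by (auto simp: c(7) chart0(7))
    have "smooth_on (\<lambda>x. \<eta> (inv_into V \<eta> (\<eta> (p x0)) \<otimes> \<psi>0 (\<phi>0 (P (bch b (- x0) x))))) S"
      using smooth_on_compose[OF S(1) M(1) sub M(2) sm] by simp
    hence "smooth_on (\<lambda>x. \<eta> (p x)) S"
      by (rule smooth_on_cong[OF S(1), rotated]) (use SB PU x0 in \<open>simp add: c(7) chart0(7)\<close>)
    thus "\<exists>T. open T \<and> x0 \<in> T \<and> smooth_on (\<lambda>x. \<eta> (p x)) T" using S by blast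
  qed
  thus ?thesis using continuous_p by (auto simp: smooth_map_def std_atlas_def o_def)
qed

lemma smooth_inverse_p:
  assumes "inj p" "surj p" shows "smooth_map A std_atlas (inv_into UNIV p)"
proof -
  let ?q = "inv_into UNIV p"
  have pq: "p (?q g) = g" for g using surj_f_inv_f[OF assms(2)] .
  have q_near: "?q g = bch b (?q g0) (F (inv g0 \<otimes> g))" if "inv g0 \<otimes> g \<in> Oe" for g g0
  proof (rule injD[OF assms(1)])
    show "p (?q g) = p (bch b (?q g0) (F (inv g0 \<otimes> g)))"
      using P_F[OF that] by (simp add: p_bch pq p_P cancel)
  qed
  have "continuous_on UNIV ?q"
  proof (rule continuous_at_imp_continuous_on, rule ballI)
    fix g0
    let ?T = "{y. inv g0 \<otimes> y \<in> Oe}"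
    have "continuous_on ?T (\<lambda>g. bch b (?q g0) (F (inv g0 \<otimes> g)))"
      by (intro continuous_on_bch continuous_on_const continuous_on_compose2[OF cont_F]
            continuous_on_mult continuous_on_id) auto
    hence "continuous_on ?T ?q" by (rule continuous_on_eq) (use q_near in auto)
    thus "continuous (at g0) ?q" using translate_nbhd[of g0] continuous_on_eq_continuous_at by blast
  qed
  moreover have "smooth_on (\<lambda>y. ?q (inv_into V \<eta> y)) (\<eta> ` V)" if V: "(V, \<eta>) \<in> A" for V \<eta>
  proof (rule smooth_on_local)
    fix y0 assume "y0 \<in> \<eta> ` V"
    then obtain g0 where g0: "g0 \<in> V" "y0 = \<eta> g0" by blast
    note c = chart[OF V]
    obtain C \<kappa> where C: "(C, \<kappa>) \<in> A" "inv g0 \<in> C" by (rule chart_at)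
    note k = chart[OF C(1)]
    note M = mult_in_charts[OF C(1) V one_chart_in_atlas]
    let ?\<eta>' = "inv_into V \<eta>"
    define S where "S = \<eta> ` V \<inter> (\<lambda>y. inv g0 \<otimes> ?\<eta>' y) -` Oe"
    have S: "open S" "y0 \<in> S"
      unfolding S_def
      using continuous_open_preimage[OF continuous_on_mult[OF continuous_on_const c(6)] c(2) open_image]
        one_Oe g0 by (auto simp: c(7))
    have SO: "inv g0 \<otimes> ?\<eta>' y \<in> Oe" "inv g0 \<otimes> ?\<eta>' y \<in> U0" "y \<in> \<eta> ` V" if "y \<in> S" for y
      using that image_in_chart by (auto simp: S_def)
    have oO: "open (\<phi>0 ` Oe)"
    proof -
      have "\<phi>0 ` Oe = \<phi>0 ` U0 \<inter> \<psi>0 -` Oe"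
        using image_in_chart by (force simp: chart0(7))
      thus ?thesis using continuous_open_preimage[OF chart0(6,2) open_image] by simp
    qed
    have sm: "smooth_on (\<lambda>y. (\<kappa> (inv g0), y)) S"
      by (intro smooth_on_Pair S(1) smooth_on_const smooth_on_ident)
    have sub: "(\<lambda>y. (\<kappa> (inv g0), y)) ` S
        \<subseteq> {z \<in> \<kappa> ` C \<times> \<eta> ` V. inv_into C \<kappa> (fst z) \<otimes> ?\<eta>' (snd z) \<in> U0}"
      using C(2) SO by (auto simp: k(7))
    have "smooth_on (\<lambda>y. \<phi>0 (inv_into C \<kappa> (\<kappa> (inv g0)) \<otimes> ?\<eta>' y)) S"
      using smooth_on_compose[OF S(1) M(1) sub M(2) sm] by simp
    hence "smooth_on (\<lambda>y. \<phi>0 (inv g0 \<otimes> ?\<eta>' y)) S" by (simp add: k(7) C(2))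
    from smooth_on_compose[OF S(1) oO _ smooth_F this]
    have "smooth_on (\<lambda>y. F (\<psi>0 (\<phi>0 (inv g0 \<otimes> ?\<eta>' y)))) S" using SO by blast
    from smooth_on_compose[OF S(1) open_UNIV _ smooth_bch[OF open_UNIV] this]
    have sm2: "smooth_on (\<lambda>y. bch b (?q g0) (F (\<psi>0 (\<phi>0 (inv g0 \<otimes> ?\<eta>' y))))) S" by blast
    have eq: "bch b (?q g0) (F (\<psi>0 (\<phi>0 (inv g0 \<otimes> ?\<eta>' y)))) = ?q (?\<eta>' y)" if "y \<in> S" for y
      using q_near[OF SO(1)[OF that]] chart0(7)[OF SO(2)[OF that]] by simp
    have "smooth_on (\<lambda>y. ?q (?\<eta>' y)) S" by (rule smooth_on_cong[OF S(1) eq sm2])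
    thus "\<exists>T. open T \<and> y0 \<in> T \<and> smooth_on (\<lambda>y. ?q (?\<eta>' y)) T" using S by blast
  qed
  ultimately show ?thesis by (auto simp: smooth_map_def std_atlas_def o_def)
qed

text \<open>Over the translate \<open>g P(ball)\<close> the sheets are the neighbourhoods of the points \<open>k a\<close> with \<open>p a = g\<close>
  and \<open>k\<close> in the kernel. They are disjoint because a point of such a sheet determines its local coordinate
  \<open>F (inv g \<otimes> p x)\<close> and hence \<open>k\<close>.\<close>
lemma covering_p:
  assumes "surj p" shows "covering_space UNIV p UNIV"
proof (rule covering_spaceI)
  show "continuous_on UNIV p" by (rule continuous_p)
  show "range p = UNIV" by (rule assms)
  fix g :: 'g
  obtain a where a: "p a = g" using assms by (metis surj_def)
  let ?T = "{y. inv g \<otimes> y \<in> Oe}"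
  let ?S = "\<lambda>k. near (bch b k a)"
  let ?v = "?S ` {k. p k = \<one>}"
  have pS: "inv g \<otimes> p x = P (bch b (- bch b k a) x)" if "p k = \<one>" "x \<in> ?S k" for k x
  proof -
    have "p x = g \<otimes> P (bch b (- bch b k a) x)"
      using p_near[of "bch b k a" x] that by (simp add: near_def p_bch a)
    thus ?thesis by (simp add: cancel)
  qed
  have union: "\<Union>?v = UNIV \<inter> p -` ?T"
  proof
    show "\<Union>?v \<subseteq> UNIV \<inter> p -` ?T" using pS by (auto simp: near_def)
    show "UNIV \<inter> p -` ?T \<subseteq> \<Union>?v"
    proof
      fix x assume "x \<in> UNIV \<inter> p -` ?T"
      then obtain z where z: "inv g \<otimes> p x = P z" "z \<in> ball 0 \<epsilon>" by auto
      define k where "k = bch b x (- bch b a z)"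
      have "p x = g \<otimes> P z" using z(1) cancel(1)[of g "p x"] by simp
      hence "p x = p (bch b a z)" using z(2) by (simp add: p_bch a p_P)
      hence "p k = \<one>" by (simp add: k_def p_bch flip: inv_p)
      moreover have "bch b (bch b k a) z = x" by (simp add: k_def bch_assoc)
      hence "bch b (- bch b k a) x = z" by (metis bch_cancel(1))
      hence "x \<in> ?S k" using z(2) by (simp add: near_def)
      ultimately show "x \<in> \<Union>?v" by blast
    qed
  qed
  have disj: "k = k'" if "p k = \<one>" "p k' = \<one>" "x \<in> ?S k" "x \<in> ?S k'" for k k' x
  proof -
    define z z' where "z = bch b (- bch b k a) x" and "z' = bch b (- bch b k' a) x"
    have "P z = P z'" using pS[of k x] pS[of k' x] that by (simp add: z_def z'_def)
    moreover have "z \<in> ball 0 \<epsilon>" "z' \<in> ball 0 \<epsilon>" using that(3,4) unfolding near_def z_def z'_def by auto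
    ultimately have zz': "z = z'" using F_P by metis
    have "x = bch b (bch b k a) z" "x = bch b (bch b k' a) z'"
      unfolding z_def z'_def by (rule bch_cancel(2)[symmetric])+
    hence "bch b k (bch b a z) = bch b k' (bch b a z)" using zz' by (simp add: bch_assoc)
    hence "bch b (bch b k (bch b a z)) (- bch b a z) = bch b (bch b k' (bch b a z)) (- bch b a z)"
      by simp
    hence "bch b k (bch b (bch b a z) (- bch b a z)) = bch b k' (bch b (bch b a z) (- bch b a z))"
      by (simp only: bch_assoc)
    thus ?thesis by simp
  qed
  have homeo: "\<exists>q. homeomorphism (?S k) ?T p q" if k: "p k = \<one>" for k
  proof
    let ?q = "\<lambda>y. bch b (bch b k a) (F (inv g \<otimes> y))"
    have qp: "?q (p x) = x" if "x \<in> ?S k" for x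
      using pS[OF k that] F_P that by (simp add: near_def)
    have pq: "p (?q y) = y" "?q y \<in> ?S k" if "y \<in> ?T" for y
    proof -
      have "p (?q y) = g \<otimes> P (F (inv g \<otimes> y))"
        using that P_F by (simp add: p_bch k a p_P)
      thus "p (?q y) = y" using that P_F by (simp add: cancel)
      show "?q y \<in> ?S k" using that P_F by (simp add: near_def)
    qed
    show "homeomorphism (?S k) ?T p ?q"
    proof (rule homeomorphismI)
      show "continuous_on (?S k) p" by (rule continuous_on_subset[OF continuous_p]) simp
      show "continuous_on ?T ?q"
        by (intro continuous_on_bch continuous_on_const continuous_on_compose2[OF cont_F]
            continuous_on_mult continuous_on_id) auto
      show "p ` ?S k \<subseteq> ?T" using pS[OF k] by (auto simp: near_def)
      show "?q ` ?T \<subseteq> ?S k" using pq(2) by blast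
    qed (use pq qp in auto)
  qed
  show "\<exists>T. g \<in> T \<and> openin (top_of_set UNIV) T \<and>
      (\<exists>v. \<Union>v = UNIV \<inter> p -` T \<and> (\<forall>u\<in>v. openin (top_of_set UNIV) u) \<and>
        pairwise disjnt v \<and> (\<forall>u\<in>v. \<exists>q. homeomorphism u T p q))"
  proof (intro exI conjI)
    show "g \<in> ?T" "openin (top_of_set UNIV) ?T" using translate_nbhd[of g] by auto
    show "\<Union>?v = UNIV \<inter> p -` ?T" by (rule union)
    show "\<forall>u\<in>?v. openin (top_of_set UNIV) u" using near by auto
    show "pairwise disjnt ?v" using disj by (force simp: pairwise_def disjnt_def)
    show "\<forall>u\<in>?v. \<exists>q. homeomorphism u ?T p q" using homeo by auto
  qed
qed

section \<open>Injectivity over a simply connected group\<close>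

lemma local_log_hom:
  obtains \<delta> where "\<delta> > 0" "\<delta> \<le> \<epsilon>" 
    "\<And>g h. \<lbrakk>g \<in> P ` ball 0 \<delta>; h \<in> P ` ball 0 \<delta>\<rbrakk> \<Longrightarrow> F (g \<otimes> h) = bch b (F g) (F h)"
proof -
  define N where "N = (\<lambda>z. bch b (fst z) (snd z)) -` ball 0 \<epsilon>"
  have "open N" unfolding N_def
    by (intro open_vimage open_ball continuous_on_bch continuous_intros)
  moreover have "(0, 0) \<in> N" using eps by (simp add: N_def)
  ultimately obtain B1 B2 where B: "open B1" "open B2" "(0, 0) \<in> B1 \<times> B2" "B1 \<times> B2 \<subseteq> N"
    by (metis open_prod_elim)
  hence "open (B1 \<inter> B2 \<inter> ball 0 \<epsilon>)" "0 \<in> B1 \<inter> B2 \<inter> ball 0 \<epsilon>" using eps by auto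
  then obtain \<delta>0 where \<delta>0: "\<delta>0 > 0" "ball 0 \<delta>0 \<subseteq> B1 \<inter> B2 \<inter> ball 0 \<epsilon>" using open_contains_ball by blast
  define \<delta> where "\<delta> = min \<delta>0 \<epsilon>"
  have \<delta>: "\<delta> > 0" "ball 0 \<delta> \<subseteq> B1 \<inter> B2" "\<delta> \<le> \<epsilon>"
    using \<delta>0 eps by (auto simp: \<delta>_def)
  show ?thesis
  proof (rule that[OF \<delta>(1,3)])
    fix g h assume "g \<in> P ` ball 0 \<delta>" "h \<in> P ` ball 0 \<delta>"
    then obtain x y where xy: "g = P x" "h = P y" "x \<in> ball 0 \<delta>" "y \<in> ball 0 \<delta>" by blast
    have "(x, y) \<in> B1 \<times> B2" using xy \<delta>(2) by blast
    hence N: "bch b x y \<in> ball 0 \<epsilon>" using B(4) by (auto simp: N_def)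
    have e: "x \<in> ball 0 \<epsilon>" "y \<in> ball 0 \<epsilon>" using xy(3,4) \<delta>(3) by auto
    have "g \<otimes> h = P (bch b x y)" using e P_mult xy(1,2) by simp
    thus "F (g \<otimes> h) = bch b (F g) (F h)" using F_P[OF N] F_P[OF e(1)] F_P[OF e(2)] xy(1,2) by simp
  qed
qed

text \<open>The discrete development of a sequence of group elements; consecutive elements are meant to be so
  close that \<open>F\<close> is a homomorphism on their quotients.\<close>
fun walk :: "(nat \<Rightarrow> 'g) \<Rightarrow> nat \<Rightarrow> 'a" where
  "walk w 0 = 0"
| "walk w (Suc n) = bch b (walk w n) (F (inv (w n) \<otimes> w (Suc n)))"

text \<open>Two sequences that stay close have conjugate developments: in every square of the ladder the
  two ways round agree because \<open>F\<close> is a local homomorphism.\<close>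
lemma walk_ladder:
  assumes \<delta>: "\<And>g h. \<lbrakk>g \<in> B; h \<in> B\<rbrakk> \<Longrightarrow> F (g \<otimes> h) = bch b (F g) (F h)"
    and "\<And>j. j < n \<Longrightarrow> inv (v j) \<otimes> v (Suc j) \<in> B" "\<And>j. j < n \<Longrightarrow> inv (w j) \<otimes> w (Suc j) \<in> B"
    and "\<And>j. j \<le> n \<Longrightarrow> inv (v j) \<otimes> w j \<in> B"
  shows "bch b (walk v n) (F (inv (v n) \<otimes> w n)) = bch b (F (inv (v 0) \<otimes> w 0)) (walk w n)"
  using assms(2-4)
proof (induction n)
  case (Suc n)
  have comp: "bch b (F (inv x \<otimes> y)) (F (inv y \<otimes> z)) = F (inv x \<otimes> z)"
    if "inv x \<otimes> y \<in> B" "inv y \<otimes> z \<in> B" for x y z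
    using \<delta>[OF that] by (simp add: m_assoc cancel)
  have "bch b (walk v (Suc n)) (F (inv (v (Suc n)) \<otimes> w (Suc n)))
      = bch b (walk v n) (F (inv (v n) \<otimes> w (Suc n)))"
    using comp[of "v n" "v (Suc n)" "w (Suc n)"] Suc.prems by (simp add: bch_assoc)
  also have "\<dots> = bch b (bch b (walk v n) (F (inv (v n) \<otimes> w n))) (F (inv (w n) \<otimes> w (Suc n)))"
    using comp[of "v n" "w n" "w (Suc n)"] Suc.prems by (simp add: bch_assoc)
  also have "\<dots> = bch b (F (inv (v 0) \<otimes> w 0)) (walk w (Suc n))"
    using Suc by (simp add: bch_assoc)
  finally show ?case .
qed simp

text \<open>If \<open>p k = 1\<close>, then \<open>t \<mapsto> p (t k)\<close> is a loop, contractible by assumption. On a fine grid in the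
  square of the homotopy, neighbouring rows have conjugate developments: the homotopy is through loops,
  so the rungs at both ends of the ladder are equal. The constant last row develops to \<open>0\<close>, hence so
  does the first row, which develops to \<open>k\<close>.\<close>
lemma simply_connected_imp_inj:
  assumes "simply_connected (UNIV :: 'g set)" shows "inj p"
proof -
  have "k = 0" if k: "p k = \<one>" for k
  proof -
    let ?\<gamma> = "\<lambda>t::real. p (t *\<^sub>R k)"
    have "path ?\<gamma>" unfolding path_def
      by (intro continuous_on_compose2[OF continuous_p] continuous_intros) auto
    moreover have "pathfinish ?\<gamma> = pathstart ?\<gamma>"
      using k p_zero by (simp add: pathfinish_def pathstart_def)
    moreover have "path (\<lambda>t::real. \<one>)" by (simp add: path_def)
    ultimately have "homotopic_loops UNIV ?\<gamma> (\<lambda>t. \<one>)"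
      using assms unfolding simply_connected_def by (simp add: pathfinish_def pathstart_def)
    then obtain h where h: "continuous_on ({0..1::real} \<times> {0..1::real}) h"
      "\<And>x. x \<in> {0..1} \<Longrightarrow> h (0, x) = p (x *\<^sub>R k)" "\<And>x. x \<in> {0..1} \<Longrightarrow> h (1, x) = \<one>"
      "\<And>t. t \<in> {0..1} \<Longrightarrow> h (t, 1) = h (t, 0)"
      unfolding homotopic_loops by (auto simp: pathfinish_def pathstart_def)
    obtain \<delta> where \<delta>: "\<delta> > 0" "\<delta> \<le> \<epsilon>"
      "\<And>g h. \<lbrakk>g \<in> P ` ball 0 \<delta>; h \<in> P ` ball 0 \<delta>\<rbrakk> \<Longrightarrow> F (g \<otimes> h) = bch b (F g) (F h)"
      by (rule local_log_hom) blast
    let ?B = "P ` ball 0 \<delta>" and ?S = "{0..1::real} \<times> {0..1::real}"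
    have B: "open ?B" "\<one> \<in> ?B"
    proof -
      have "?B = Oe \<inter> F -` ball 0 \<delta>" using \<delta>(2) F_P P_F by (force simp: image_iff)
      thus "open ?B" using continuous_open_preimage[OF cont_F open_image open_ball] by simp
      show "\<one> \<in> ?B" using P_zero \<delta>(1) by (intro image_eqI[of _ _ 0]) auto
    qed
    have "\<exists>T. open T \<and> z \<in> T \<and> (\<forall>x\<in>T \<inter> ?S. \<forall>y\<in>T \<inter> ?S. inv (h x) \<otimes> h y \<in> ?B)" if z: "z \<in> ?S" for z
    proof -
      have "continuous_on (?S \<times> ?S) (\<lambda>u. inv (h (fst u)) \<otimes> h (snd u))"
        by (intro continuous_on_mult continuous_on_inverse continuous_on_compose2[OF h(1)]
            continuous_intros) auto
      from continuous_on_open_invariant[THEN iffD1, OF this, rule_format, OF B(1)]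
      obtain M where M: "open M" "M \<inter> (?S \<times> ?S) = (\<lambda>u. inv (h (fst u)) \<otimes> h (snd u)) -` ?B \<inter> (?S \<times> ?S)"
        by blast
      have "(z, z) \<in> M" using z M(2) B(2) by auto
      then obtain T1 T2 where T: "open T1" "open T2" "(z, z) \<in> T1 \<times> T2" "T1 \<times> T2 \<subseteq> M"
        using M(1) by (metis open_prod_elim)
      have "inv (h x) \<otimes> h y \<in> ?B" if "x \<in> (T1 \<inter> T2) \<inter> ?S" "y \<in> (T1 \<inter> T2) \<inter> ?S" for x y
      proof -
        have "(x, y) \<in> M \<inter> (?S \<times> ?S)" using that T(4) by blast
        thus ?thesis using M(2) by auto
      qed
      thus ?thesis using T by (intro exI[of _ "T1 \<inter> T2"]) auto
    qed
    then obtain T where T: "\<And>z. z \<in> ?S \<Longrightarrow> open (T z) \<and> z \<in> T z \<and>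
        (\<forall>x\<in>T z \<inter> ?S. \<forall>y\<in>T z \<inter> ?S. inv (h x) \<otimes> h y \<in> ?B)" by metis
    have "compact ?S" by (intro compact_Times compact_Icc)
    then obtain e where e: "e > 0" "\<And>x. x \<in> ?S \<Longrightarrow> \<exists>G\<in>T ` ?S. ball x e \<subseteq> G"
      by (rule Heine_Borel_lemma[of ?S "T ` ?S"]) (use T in auto)
    have close: "inv (h x) \<otimes> h y \<in> ?B" if xy: "x \<in> ?S" "y \<in> ?S" "dist x y < e" for x y
    proof -
      obtain z where z: "z \<in> ?S" "ball x e \<subseteq> T z" using e(2)[OF xy(1)] by blast
      have "x \<in> T z \<inter> ?S" "y \<in> T z \<inter> ?S" using z(2) xy e(1) by auto
      thus ?thesis using T[OF z(1)] by blast
    qed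
    obtain N where N: "N > 0" "2 / e + norm k / \<epsilon> < real N"
      using reals_Archimedean2[of "max 0 (2 / e + norm k / \<epsilon>)"] by (metis max_less_iff_conj of_nat_0_less_iff)
    have Ne: "2 / real N < e" "norm k < \<epsilon> * real N"
    proof -
      have "2 / e < real N" "norm k / \<epsilon> < real N"
        using N(2) e(1) eps by (smt (verit) divide_nonneg_pos norm_ge_zero)+
      thus "2 / real N < e" "norm k < \<epsilon> * real N"
        using N(1) e(1) eps by (auto simp: field_simps)
    qed
    define z where "z i j = (real i / real N, real j / real N)" for i j
    have zS: "z i j \<in> ?S" if "i \<le> N" "j \<le> N" for i j using that N(1) by (simp add: z_def)
    have grid: "inv (h (z i j)) \<otimes> h (z i' j') \<in> ?B"
      if "i \<le> N" "i' \<le> N" "j \<le> N" "j' \<le> N" "i' = i \<or> i' = Suc i" "j' = j \<or> j' = Suc j" for i j i' j'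
    proof (rule close[OF zS zS])
      have "dist (real i / real N) (real i' / real N) \<le> 1 / real N"
        using that(5) N(1) by (auto simp: dist_real_def field_simps)
      moreover have "dist (real j / real N) (real j' / real N) \<le> 1 / real N"
        using that(6) N(1) by (auto simp: dist_real_def field_simps)
      moreover have "dist (z i j) (z i' j') \<le> dist (real i / real N) (real i' / real N)
          + dist (real j / real N) (real j' / real N)"
        unfolding z_def dist_Pair_Pair by (rule sqrt_sum_squares_le_sum) auto
      ultimately show "dist (z i j) (z i' j') < e" using Ne(1) by linarith
    qed (use that in auto)
    have row: "walk (\<lambda>j. h (z i j)) N = 0" if "i \<le> N" for i
      using that
    proof (induction rule: inc_induct)
      case base
      have "walk (\<lambda>j. h (z N j)) n = 0" if "n \<le> N" for n
        using that
      proof (induction n)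
        case (Suc n)
        have "h (z N n) = \<one>" "h (z N (Suc n)) = \<one>"
          using h(3) Suc.prems N(1) by (auto simp: z_def)
        moreover have "F \<one> = 0" using F_P[of 0] P_zero eps by simp
        ultimately show ?case using Suc by simp
      qed simp
      thus ?case by simp
    next
      case (step i)
      let ?v = "\<lambda>j. h (z i j)" and ?w = "\<lambda>j. h (z (Suc i) j)"
      have "bch b (walk ?v N) (F (inv (?v N) \<otimes> ?w N)) = bch b (F (inv (?v 0) \<otimes> ?w 0)) (walk ?w N)"
        by (rule walk_ladder[OF \<delta>(3)]) (use step.hyps in \<open>auto intro!: grid\<close>)
      moreover have "?v N = ?v 0" "?w N = ?w 0"
        using h(4) step.hyps N(1) by (auto simp: z_def)
      ultimately have "bch b (walk ?v N) (F (inv (?v 0) \<otimes> ?w 0)) = F (inv (?v 0) \<otimes> ?w 0)"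
        using step.IH by simp
      hence "bch b (bch b (walk ?v N) (F (inv (?v 0) \<otimes> ?w 0))) (- F (inv (?v 0) \<otimes> ?w 0)) = 0"
        by simp
      thus ?case by (simp only: bch_assoc bch_minus bch_zero)
    qed
    have "walk (\<lambda>j. h (z 0 j)) n = (real n / real N) *\<^sub>R k" if "n \<le> N" for n
      using that
    proof (induction n)
      case (Suc n)
      let ?k = "(1 / real N) *\<^sub>R k"
      have "h (z 0 n) = p ((real n / real N) *\<^sub>R k)" "h (z 0 (Suc n)) = p ((real (Suc n) / real N) *\<^sub>R k)"
        using h(2) Suc.prems N(1) by (auto simp: z_def)
      hence "inv (h (z 0 n)) \<otimes> h (z 0 (Suc n))
          = p (bch b ((- (real n / real N)) *\<^sub>R k) ((real (Suc n) / real N) *\<^sub>R k))"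
        by (simp add: p_bch inv_p)
      also have "\<dots> = p ?k"
        unfolding bch_parallel by (simp add: add_divide_distrib)
      also have "\<dots> = P ?k" by (rule p_local[OF norm_root[OF N(1) Ne(2)]])
      finally have "F (inv (h (z 0 n)) \<otimes> h (z 0 (Suc n))) = ?k"
        using F_P[of ?k] norm_root[OF N(1) Ne(2)] by simp
      hence "walk (\<lambda>j. h (z 0 j)) (Suc n) = bch b ((real n / real N) *\<^sub>R k) ?k"
        using Suc by simp
      thus ?case unfolding bch_parallel by (simp add: add_divide_distrib)
    qed simp
    from this[of N] row[of 0] N(1) show "k = 0" by simp
  qed
  moreover have "x = y" if "bch b (- x) y = 0" for x y
  proof -
    have "bch b x (bch b (- x) y) = x" using that by simp
    thus ?thesis by simp
  qed
  ultimately show ?thesis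
    by (intro injI) (metis inv_p l_inv p_bch in_carrier)
qed

end

section \<open>The quaternionic Heisenberg group\<close>

definition bch_group :: "('a::real_vector \<Rightarrow> 'a \<Rightarrow> 'a) \<Rightarrow> 'a monoid" where
  "bch_group b = \<lparr>carrier = UNIV, mult = bch b, one = 0\<rparr>"

lemma bch_group_simps [simp]:
  "carrier (bch_group b) = UNIV" "x \<otimes>\<^bsub>bch_group b\<^esub> y = bch b x y" "\<one>\<^bsub>bch_group b\<^esub> = 0"
  by (simp_all add: bch_group_def)

context two_step_bracket
begin

lemma group_bch: "group (bch_group br)"
proof (rule groupI)
  fix x :: 'e
  show "\<exists>y\<in>carrier (bch_group br). y \<otimes>\<^bsub>bch_group br\<^esub> x = \<one>\<^bsub>bch_group br\<^esub>"
    by (rule bexI[of _ "- x"]) simp_all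
qed (simp_all add: bch_assoc)

lemma inv_bch: "inv\<^bsub>bch_group br\<^esub> x = - x"
  by (rule group.inv_equality[OF group_bch]) auto

lemma inv_into_id: "inv_into UNIV id = id"
  by (rule ext) (metis UNIV_I id_apply inj_on_id inv_into_f_f)

lemma lie_group_bch: "lie_group (bch_group br) (std_atlas :: ('e, 'e) chart set)"
proof -
  interpret group "bch_group br" by (rule group_bch)
  have mult: "smooth_on (\<lambda>z. bch br (fst z) (snd z)) UNIV"
    unfolding bch_def
    by (intro smooth_on_add smooth_on_linear smooth_on_linear_compose[OF bounded_linear_scaleR_right]
        smooth_on_bilinear[OF bounded] bounded_linear_fst bounded_linear_snd open_UNIV)
  have "map_prod id id = (id :: 'e \<times> 'e \<Rightarrow> _)" by auto
  hence prod: "prod_atlas std_atlas std_atlas = (std_atlas :: ('e \<times> 'e, 'e \<times> 'e) chart set)"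
    by (auto simp: prod_atlas_def std_atlas_def)
  have inv: "m_inv (bch_group br) = uminus" by (rule ext) (rule inv_bch)
  show ?thesis
  proof unfold_locales
    show "smooth_atlas (std_atlas :: ('e, 'e) chart set)"
      by (auto simp: smooth_atlas_def std_atlas_def homeomorphism_def inv_into_id o_def id_def
          intro: smooth_on_ident)
    show "smooth_map (prod_atlas std_atlas std_atlas) std_atlas (\<lambda>(x, y). x \<otimes>\<^bsub>bch_group br\<^esub> y)"
      unfolding prod using mult smooth_on_continuous[OF mult]
      by (simp add: smooth_map_def std_atlas_def inv_into_id o_def split_beta)
    show "smooth_map std_atlas std_atlas (m_inv (bch_group br))"
      unfolding inv
      by (simp add: smooth_map_def std_atlas_def inv_into_id o_def continuous_on_minus
          smooth_on_linear[OF bounded_linear_minus[OF bounded_linear_ident]])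
  qed simp
qed

lemma lie_bracket_bch: "lie_bracket (bch_group br) (std_atlas :: ('e, 'e) chart set) = br"
proof (intro ext)
  fix u v :: 'e
  have c: "one_chart (bch_group br) (std_atlas :: ('e, 'e) chart set) = (UNIV, id)"
    by (auto simp: one_chart_def std_atlas_def)
  have "(bch br x has_derivative (\<lambda>v. v + (1/2) *\<^sub>R br x v)) (at 0)" for x
    unfolding bch_def
    by (auto intro!: derivative_eq_intros bounded_linear.has_derivative[OF
        bounded_bilinear.bounded_linear_right[OF bounded]])
  hence "frechet_derivative (bch br x) (at 0) = (\<lambda>v. v + (1/2) *\<^sub>R br x v)" for x
    by (rule frechet_derivative_at[symmetric])
  hence X: "left_inv_field (bch_group br) std_atlas v = (\<lambda>x. v + (1/2) *\<^sub>R br x v)" for v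
    by (intro ext) (simp add: left_inv_field_def c inv_into_id)
  have "((\<lambda>x. v + (1/2) *\<^sub>R br x v) has_derivative (\<lambda>u. (1/2) *\<^sub>R br u v)) (at 0)" for v
    by (auto intro!: derivative_eq_intros bounded_linear.has_derivative[OF
        bounded_bilinear.bounded_linear_left[OF bounded]])
  hence "frechet_derivative (\<lambda>x. v + (1/2) *\<^sub>R br x v) (at 0) = (\<lambda>u. (1/2) *\<^sub>R br u v)" for v
    by (rule frechet_derivative_at[symmetric])
  hence "lie_bracket (bch_group br) std_atlas u v = (1/2) *\<^sub>R br u v - (1/2) *\<^sub>R br v u"
    by (simp add: lie_bracket_def c X)
  also have "\<dots> = br u v"
    using antisym[of v u] by (simp flip: scaleR_left_distrib)
  finally show "lie_bracket (bch_group br) std_atlas u v = br u v" .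
qed

lemma nilpotent: "nilpotent_bracket br"
proof -
  have "br x y = 0" if "y \<in> span {br x y |x y. y \<in> (UNIV::'e set)}" for x y
    using that
  proof (induction rule: span_induct)
    case base
    show ?case by (auto simp: subspace_def br_simps)
  qed (auto simp: two_step)
  hence "{br x y |x y. y \<in> lower_central br (Suc 0)} \<subseteq> {0}" by auto
  hence "span {br x y |x y. y \<in> lower_central br (Suc 0)} \<subseteq> span {0}"
    by (rule span_mono)
  also have "span {0 :: 'e} = {0}" by (metis span_empty span_insert_0)
  finally have "lower_central br (Suc (Suc 0)) \<subseteq> {0}" by (simp only: lower_central.simps)
  moreover have "0 \<in> lower_central br (Suc (Suc 0))" by (simp only: lower_central.simps span_zero)
  ultimately have "lower_central br (Suc (Suc 0)) = {0}" by blast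
  thus ?thesis unfolding nilpotent_bracket_def by blast
qed

end

text \<open>The factor \<open>4\<close> comes from the factor \<open>2\<close> in the group law: \<open>(1/2) *\<^sub>R heis_br x y\<close> has to
  be \<open>2 Im (p cnj q)\<close>, and \<open>Om p q = - Im (p cnj q)\<close>.\<close>
definition heis_br :: "quat \<times> (real^3) \<Rightarrow> quat \<times> (real^3) \<Rightarrow> quat \<times> (real^3)" where
  "heis_br x y = (0, (- 4) *\<^sub>R Om (fst x) (fst y))"

lemma bilinear_Om: "bilinear Om"
  unfolding bilinear_def
  by (auto intro!: linearI simp: Om_def cross_add_left cross_add_right cross_mult_left
      cross_mult_right algebra_simps)

interpretation heis: two_step_bracket heis_br
proof
  show "bilinear heis_br"
    unfolding bilinear_def
    by (intro conjI allI linearI)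
       (simp_all add: heis_br_def bilinear_ladd[OF bilinear_Om] bilinear_radd[OF bilinear_Om]
         scaleR_add_right mult.commute)
qed (simp_all add: heis_br_def zero_prod_def Om_def)

lemma quat_heisenberg_eq: "quat_heisenberg = bch_group heis_br"
  by (auto simp: quat_heisenberg_def bch_group_def bch_def heis_br_def Om_def quat_mult_def
      quat_cnj_def fun_eq_iff algebra_simps)

lemma in_span_vanish:
  fixes g :: "'e::euclidean_space \<Rightarrow>\<^sub>L real"
  assumes "g \<in> span S" "\<And>h. h \<in> S \<Longrightarrow> blinfun_apply h z = 0" shows "blinfun_apply g z = 0"
  using assms(1)
proof (induction rule: span_induct)
  case base
  show ?case by (auto simp: subspace_def blinfun.bilinear_simps)
qed (use assms(2) in auto)

lemma one_to_seven: "{1..7::nat} = {1, 2, 3, 4, 5, 6, 7}" "{1..4::nat} = {1, 2, 3, 4}" by auto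

text \<open>With \<open>de5 = 4 Om\<^sub>1\<close> and so on, twice the four real coordinates of the quaternion are the right
  choice for \<open>e1, ..., e4\<close>. The forms are represented by orthogonal vectors.\<close>
lemma heis_qc: "admits_integrable_left_inv_qc quat_heisenberg std_atlas"
proof -
  define \<xi> :: "nat \<Rightarrow> quat \<times> (real^3)" where
    "\<xi> n = (if n = 1 then ((2, 0), 0) else if n = 2 then ((0, 2 *\<^sub>R axis 1 1), 0)
       else if n = 3 then ((0, 2 *\<^sub>R axis 2 1), 0) else if n = 4 then ((0, 2 *\<^sub>R axis 3 1), 0)
       else if n = 5 then (0, axis 1 1) else if n = 6 then (0, axis 2 1) else (0, axis 3 1))" for n
  define e where "e n = blinfun_inner_right (\<xi> n)" for n
  let ?J = "blinfun_inner_right :: quat \<times> (real^3) \<Rightarrow> _"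
  have J: "linear ?J"
    by (rule linearI; rule blinfun_eqI) (simp_all add: blinfun.bilinear_simps inner_add_left)
  have injJ: "inj ?J"
  proof (rule injI)
    fix x y assume "?J x = ?J y"
    hence "x \<bullet> z = y \<bullet> z" for z by (metis blinfun_inner_right.rep_eq)
    thus "x = y" using vector_eq_rdot by blast
  qed
  have surjJ: "g \<in> range ?J" for g
  proof -
    have "g = ?J (\<Sum>b\<in>Basis. blinfun_apply g b *\<^sub>R b)"
    proof (rule blinfun_eqI)
      fix x
      have "blinfun_apply g x = (\<Sum>b\<in>Basis. (x \<bullet> b) *\<^sub>R blinfun_apply g b)"
        by (rule linear_basis_expansion) (rule bounded_linear.linear[OF blinfun.bounded_linear_right])
      thus "blinfun_apply g x = blinfun_apply (?J (\<Sum>b\<in>Basis. blinfun_apply g b *\<^sub>R b)) x"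
        by (simp add: inner_sum_left inner_commute[of x] mult.commute)
    qed
    thus ?thesis by blast
  qed
  have inj\<xi>: "inj_on \<xi> {1..7}"
    unfolding one_to_seven
    by (auto simp: inj_on_def \<xi>_def axis_eq_axis zero_prod_def axis_eq_0_iff)
  have ind: "independent (\<xi> ` {1..7})"
  proof (rule pairwise_orthogonal_independent)
    show "pairwise orthogonal (\<xi> ` {1..7})"
      unfolding one_to_seven
      by (auto simp: pairwise_def orthogonal_def \<xi>_def inner_axis_axis)
    show "0 \<notin> \<xi> ` {1..7}"
      unfolding one_to_seven by (auto simp: \<xi>_def zero_prod_def axis_eq_0_iff)
  qed
  have "card (\<xi> ` {1..7}) = 7" using card_image[OF inj\<xi>] by simp
  hence "dim (\<xi> ` {1..7}) = 7" using dim_eq_card_independent[OF ind] by simp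
  hence span: "span (\<xi> ` {1..7}) = UNIV" using dim_eq_full[of "\<xi> ` {1..7}"] by simp
  have img: "e ` S = ?J ` \<xi> ` S" for S by (auto simp: e_def)
  have "inj_on e {1..7}" using comp_inj_on[OF inj\<xi> inj_on_subset[OF injJ subset_UNIV]] by (simp add: o_def e_def[abs_def])
  moreover have "independent (e ` {1..7})"
    unfolding img by (rule linear_independent_injective_image[OF J ind]) (use injJ in \<open>auto simp: inj_on_def\<close>)
  moreover have "span (e ` {1..7}) = UNIV"
    unfolding img linear_span_image[OF J] span using surjJ by auto
  ultimately have "integrable_qc_basis heis_br e (\<lambda>_. 0)"
    unfolding integrable_qc_basis_def Let_def eq_mod_span3_def
    by (auto simp: span_zero wedge_def ce_d_def e_def \<xi>_def heis_br_def Om_def inner_axis'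
        cross3_def algebra_simps intro!: exI[of _ 0])
  hence "integrable_qc_basis (lie_bracket quat_heisenberg std_atlas) e (\<lambda>_. 0)"
    unfolding quat_heisenberg_eq heis.lie_bracket_bch .
  thus ?thesis unfolding admits_integrable_left_inv_qc_def by blast
qed

text \<open>In the coordinates \<open>H\<close>, \<open>V\<close> the bracket is already that of the Heisenberg algebra up to scale:
  all horizontal components and all other terms of the structure equations vanish. Halving \<open>H\<close> turns
  the factor \<open>1\<close> in front of \<open>Om\<close> into \<open>4\<close>.\<close>
lemma qc_iso_heis:
  fixes br :: "'e::euclidean_space \<Rightarrow> 'e \<Rightarrow> 'e"
  assumes dim: "DIM('e) = 7" and bilin: "bilinear br" and antisym: "\<And>x y. br x y = - br y x"
    and jacobi: "\<And>x y z. br x (br y z) + br y (br z x) + br z (br x y) = 0"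
    and nilp: "nilpotent_bracket br" and qc: "integrable_qc_basis br e f"
  obtains L :: "'e \<Rightarrow> quat \<times> (real^3)"
  where "linear L" "bij L" "\<And>x y. L (br x y) = heis_br (L x) (L y)"
proof -
  have sp: "span (e ` {1..7}) = UNIV" and fsp: "f 1 \<in> span (e ` {1..4})" "f 2 \<in> span (e ` {1..4})"
      "f 3 \<in> span (e ` {1..4})"
    using qc by (auto simp: integrable_qc_basis_def)
  define H :: "'e \<Rightarrow> quat" where "H x = (e 1 x, vector [e 2 x, e 3 x, e 4 x])" for x
  define V :: "'e \<Rightarrow> real^3" where "V x = vector [e 5 x, e 6 x, e 7 x]" for x
  define fv :: "'e \<Rightarrow> real^3" where "fv x = vector [f 1 x, f 2 x, f 3 x]" for x
  have vec_eq: "u = v \<longleftrightarrow> u $ 1 = v $ 1 \<and> u $ 2 = v $ 2 \<and> u $ 3 = v $ 3" for u v :: "real^3"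
    by (simp add: vec_eq_iff forall_3)
  have linear_H: "linear H" and linear_V: "linear V"
    by (auto intro!: linearI simp: H_def V_def vec_eq vector_3 blinfun.bilinear_simps)
  have inj: "x = 0" if "H x = 0" "V x = 0" for x
  proof -
    have z: "blinfun_apply h x = 0" if "h \<in> e ` {1..7}" for h
      using that \<open>H x = 0\<close> \<open>V x = 0\<close> unfolding one_to_seven
      by (auto simp: H_def V_def zero_prod_def vec_eq vector_3)
    have "blinfun_apply (blinfun_inner_right x) x = 0"
      by (rule in_span_vanish[of _ "e ` {1..7}"]) (use sp z in auto)
    thus ?thesis by simp
  qed
  have linear_HV: "linear (\<lambda>x. (H x, V x))"
    using linear_H linear_V by (auto intro!: linearI simp: linear_add linear_scale)
  have inj_HV: "inj (\<lambda>x. (H x, V x))"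
    using inj by (auto simp: linear_injective_0[OF linear_HV] zero_prod_def)
  have "dim (range (\<lambda>x. (H x, V x))) = 7"
    using dim_image_eq[OF linear_HV, of UNIV] inj_HV dim by simp
  hence "span (range (\<lambda>x. (H x, V x))) = UNIV"
    using dim_eq_full[of "range (\<lambda>x. (H x, V x))"] by simp
  hence surj_HV: "range (\<lambda>x. (H x, V x)) = UNIV"
    by (simp add: linear_span_image[OF linear_HV])
  have surj: "\<exists>x. H x = p \<and> V x = v" for p v
    using surj_HV by (metis (no_types, lifting) Pair_inject UNIV_I imageE)
  have f_hor: "fv x = fv y" if "H x = H y" for x y
  proof -
    have "blinfun_apply h (x - y) = 0" if "h \<in> e ` {1..4}" for h
      using that \<open>H x = H y\<close> unfolding one_to_seven
      by (auto simp: H_def vec_eq vector_3 blinfun.bilinear_simps)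
    hence "f 1 (x - y) = 0 \<and> f 2 (x - y) = 0 \<and> f 3 (x - y) = 0"
      using fsp in_span_vanish by blast
    thus ?thesis by (simp add: fv_def blinfun.bilinear_simps)
  qed
  obtain a1 b1 c1 a2 b2 c2 a3 b3 c3 where E:
    "\<And>X Y. ce_d br (e 5) X Y - (wedge (e 1) (e 2) X Y + wedge (e 3) (e 4) X Y
        + wedge (f 2) (e 7) X Y - wedge (f 3) (e 6) X Y)
      = a1 * wedge (e 5) (e 6) X Y + b1 * wedge (e 5) (e 7) X Y + c1 * wedge (e 6) (e 7) X Y"
    "\<And>X Y. ce_d br (e 6) X Y - (wedge (e 1) (e 3) X Y + wedge (e 4) (e 2) X Y
        + wedge (f 3) (e 5) X Y - wedge (f 1) (e 7) X Y)
      = a2 * wedge (e 5) (e 6) X Y + b2 * wedge (e 5) (e 7) X Y + c2 * wedge (e 6) (e 7) X Y"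
    "\<And>X Y. ce_d br (e 7) X Y - (wedge (e 1) (e 4) X Y + wedge (e 2) (e 3) X Y
        + wedge (f 1) (e 6) X Y - wedge (f 2) (e 5) X Y)
      = a3 * wedge (e 5) (e 6) X Y + b3 * wedge (e 5) (e 7) X Y + c3 * wedge (e 6) (e 7) X Y"
    using qc unfolding integrable_qc_basis_def Let_def eq_mod_span3_def by auto
  define t where "t a b c u v = a * (u$1 * v$2 - v$1 * u$2) + b * (u$1 * v$3 - v$1 * u$3)
      + c * (u$2 * v$3 - v$2 * u$3)" for a b c :: real and u v :: "real^3"
  define T :: "real^3 \<Rightarrow> real^3 \<Rightarrow> real^3" where
    "T u v = vector [t a1 b1 c1 u v, t a2 b2 c2 u v, t a3 b3 c3 u v]" for u v
  interpret nilpotent_qc_algebra br H V fv T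
  proof (rule nilpotent_qc_algebra.intro)
    show "V (br x y) = - (Om (H x) (H y) + cross3 (fv x) (V y) - cross3 (fv y) (V x) + T (V x) (V y))" for x y
      using E(1)[of x y] E(2)[of x y] E(3)[of x y]
      by (simp add: vec_eq V_def H_def fv_def T_def t_def Om_def vector_3 cross_components
          ce_d_def wedge_def algebra_simps)
    show "T 0 v = 0" "T v 0 = 0" for v by (simp_all add: T_def t_def vec_eq vector_3)
    show "x = 0" if "H x = 0" "V x = 0" for x by (rule inj[OF that])
    show "fv x = fv y" if "H x = H y" for x y by (rule f_hor[OF that])
  qed (fact bilin antisym jacobi nilp linear_H linear_V surj)+
  define L where "L x = ((1/2) *\<^sub>R H x, V x)" for x
  show ?thesis
  proof
    show "linear L"
      using linear_H linear_V by (auto intro!: linearI simp: L_def linear_add linear_scale scaleR_add_right)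
    show "bij L"
    proof (rule bijI)
      show "inj L"
      proof (rule injI)
        fix x y assume "L x = L y"
        hence "(H x, V x) = (H y, V y)" by (simp add: L_def)
        thus "x = y" using inj_HV by (auto dest: injD)
      qed
      show "surj L"
      proof (rule surjI)
        fix y
        have "\<exists>x. H x = 2 *\<^sub>R fst y \<and> V x = snd y" by (rule surj)
        thus "L (SOME x. H x = 2 *\<^sub>R fst y \<and> V x = snd y) = y"
          by (rule someI2_ex) (simp add: L_def)
      qed
    qed
    show "L (br x y) = heis_br (L x) (L y)" for x y
      by (simp add: L_def heis_br_def V_br H_br)
  qed
qed

lemma nilpotent_qc_group_covered:
  fixes G :: "'g::{t2_space, second_countable_topology} monoid"
    and A :: "('g, 'e::euclidean_space) chart set"
  assumes dim: "DIM('e) = 7" and nil: "nilpotent_lie_group G A"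
    and qc: "admits_integrable_left_inv_qc G A"
  shows "(\<exists>p. lie_covering_hom quat_heisenberg std_atlas G A p) \<and>
    (simply_connected (UNIV :: 'g set) \<longrightarrow> lie_group_isomorphic G A quat_heisenberg std_atlas)"
proof -
  have conn: "connected (UNIV :: 'g set)" and np: "nilpotent_bracket (lie_bracket G A)"
    using nil by (auto simp: nilpotent_lie_group_def)
  interpret lie_group G A using nil by (simp add: nilpotent_lie_group_def)
  obtain e f where ef: "integrable_qc_basis (lie_bracket G A) e f"
    using qc by (auto simp: admits_integrable_left_inv_qc_def)
  obtain L :: "'e \<Rightarrow> quat \<times> (real^3)" where L: "linear L" "bij L"
    "\<And>x y. L (lie_bracket G A x y) = heis_br (L x) (L y)"
    using qc_iso_heis[OF dim lie_bracket_bilinear lie_bracket_antisym lie_bracket_jacobi np ef] by blast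
  define M where "M = inv_into UNIV L"
  have LM1: "M (L x) = x" for x unfolding M_def using L(2) by (simp add: bij_is_inj)
  have LM2: "L (M y) = y" for y unfolding M_def using L(2) by (simp add: bij_is_surj surj_f_inv_f)
  have linM: "linear M"
  proof (rule linearI)
    show "M (x + y) = M x + M y" for x y
      using LM1[of "M x + M y"] by (simp add: linear_add[OF L(1)] LM2)
    show "M (c *\<^sub>R x) = c *\<^sub>R M x" for c x
      using LM1[of "c *\<^sub>R M x"] by (simp add: linear_scale[OF L(1)] LM2)
  qed
  have M: "M (heis_br x y) = lie_bracket G A (M x) (M y)" for x y
    using L(3)[of "M x" "M y"] LM1 LM2 by metis
  define Q where "Q x = M (fst (L x), 0)" for x
  have "\<exists>P \<epsilon> F. local_bch_model G A heis_br P \<epsilon> F"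
  proof (rule local_bch_model_exists[where L = M and L' = L and Q = Q])
    have "linear (\<lambda>y :: quat \<times> (real^3). (fst y, 0 :: real^3))" by (rule linearI) auto
    from linear_compose[OF linear_compose[OF L(1) this] linM]
    show "linear Q" unfolding Q_def[abs_def] by (simp add: o_def)
    show "Q (lie_bracket G A u v) = 0" for u v
      using linear_0[OF linM] by (simp add: Q_def L(3) heis_br_def zero_prod_def)
    show "lie_bracket G A (Q u) v = lie_bracket G A u v" for u v
    proof -
      have "L (lie_bracket G A (Q u) v) = L (lie_bracket G A u v)"
        by (simp add: L(3) Q_def LM2 heis_br_def)
      thus ?thesis by (metis LM1)
    qed
  qed (fact heis.two_step_bracket_axioms L linM LM1 LM2 M)+
  then obtain P \<epsilon> F where "local_bch_model G A heis_br P \<epsilon> F" by blast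
  then interpret local_bch_model G A heis_br P \<epsilon> F .
  have hom: "p \<in> hom quat_heisenberg G"
    by (auto simp: hom_def quat_heisenberg_eq p_bch)
  have surj: "surj p" by (rule surj_p[OF conn])
  have "lie_covering_hom quat_heisenberg std_atlas G A p"
    unfolding lie_covering_hom_def using hom smooth_p covering_p[OF surj] by blast
  moreover have "lie_group_isomorphic G A quat_heisenberg std_atlas"
    if "simply_connected (UNIV :: 'g set)"
  proof -
    have inj: "inj p" by (rule simply_connected_imp_inj[OF that])
    have "bij p" using inj surj by (simp add: bij_def)
    hence "p \<in> iso quat_heisenberg G"
      using hom by (simp add: iso_def quat_heisenberg_eq carrier_UNIV)
    hence "inv_into UNIV p \<in> iso G quat_heisenberg"
      using group.iso_set_sym[of quat_heisenberg p G] heis.group_bch by (simp add: quat_heisenberg_eq)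
    moreover have "inv_into UNIV (inv_into UNIV p) = p" by (rule inv_inv_eq[OF \<open>bij p\<close>])
    ultimately show ?thesis
      unfolding lie_group_isomorphic_def using smooth_inverse_p[OF inj surj] smooth_p by metis
  qed
  ultimately show ?thesis by blast
qed

theorem mainTheorem3:
  fixes G :: "'g::{t2_space, second_countable_topology} monoid"
    and A :: "('g, 'e::euclidean_space) chart set"
  shows
    "(DIM(quat \<times> (real^3)) = 7 \<and>
      simply_connected (UNIV :: (quat \<times> (real^3)) set) \<and>
      nilpotent_lie_group quat_heisenberg std_atlas \<and>
      admits_integrable_left_inv_qc quat_heisenberg std_atlas) \<and>
     (DIM('e) = 7 \<and> nilpotent_lie_group G A \<and> admits_integrable_left_inv_qc G A \<longrightarrow>
        (\<exists>p. lie_covering_hom quat_heisenberg std_atlas G A p) \<and>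
        (simply_connected (UNIV :: 'g set) \<longrightarrow>
           lie_group_isomorphic G A quat_heisenberg std_atlas))"
proof (intro conjI impI)
  show "DIM(quat \<times> (real^3)) = 7" by simp
  show "simply_connected (UNIV :: (quat \<times> (real^3)) set)"
    by (intro convex_imp_simply_connected convex_UNIV)
  show "nilpotent_lie_group quat_heisenberg (std_atlas :: (quat \<times> (real^3), quat \<times> (real^3)) chart set)"
    unfolding nilpotent_lie_group_def quat_heisenberg_eq heis.lie_bracket_bch
    using heis.lie_group_bch heis.nilpotent by (simp add: convex_connected)
  show "admits_integrable_left_inv_qc quat_heisenberg
      (std_atlas :: (quat \<times> (real^3), quat \<times> (real^3)) chart set)"
    by (rule heis_qc)
qed (use nilpotent_qc_group_covered in blast)+

end
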